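(* Let $K$ be a field of characteristic $0$, let $N\ge 1$ be an integer, and let $q\in K$, $q\neq 0$. If $q^8\neq 1$, then the $(+)$-part $U_q^+(A_N)$ of the Drinfeld-Jimbo quantum group of type $A_N$ over $K$ is a solvable polynomial algebra (with respect to its generators $x_{ij}$, $1\le i<j\le N+1$, and its standard PBW basis).
   Context: All algebras are associative $K$-algebras with $1$; $K^*=K\setminus\{0\}$; $\mathbb{N}=\{0,1,2,\dots\}$. **The algebra $U_q^+(A_N)$.** Let $(a_{ij})$ be the Cartan matrix of type $A_N$ ($a_{ii}=2$, $a_{ij}=-1$ if $|i-j|=1$, $a_{ij}=0$ otherwise), with $d_i=1$ for all $i$. $U_q(A_N)$ is the $K$-algebra generated by $E_i,K_i^{\pm1},F_i$ ($1\le i\le N$) subject to: $K_iK_j=K_jK_i$, $K_iK_i^{-1}=K_i^{-1}K_i=1$, $E_jK_i^{\pm1}=q^{\mp d_ia_{ij}}K_i^{\pm1}E_j$, $K_i^{\pm1}F_j=q^{\mp d_ia_{ij}}F_jK_i^{\pm1}$, $E_iF_j-F_jE_i=\delta_{ij}\frac{K_i^2-K_i^{-2}}{q^{2d_i}-q^{-2d_i}}$, and for $i\ne j$, with $t=q^{2d_i}$, $\sum_{v=0}^{1-a_{ij}}(-1)^v{1-a_{ij}\brack v}_t E_i^{1-a_{ij}-v}E_jE_i^v=0$ and the same relation with each $E$ replaced by $F$. Here ${m\brack n}_t=\prod_{i=1}^n\frac{t^{m-i+1}-t^{i-m-1}}{t^i-t^{-i}}$ for $m>n>0$, and ${m\brack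 n}_t=1$ if $n=0$ or $n=m$. $U_q^+(A_N)$ is the subalgebra generated by $E_1,\dots,E_N$. **Jimbo presentation and PBW basis (known, Yamane).** Let $\Lambda_N=\{(i,j)\in\mathbb{N}\times\mathbb{N}: 1\le i<j\le N+1\}$. For $q^8\ne1$, $U_q^+(A_N)$ is the $K$-algebra with generators $x_{ij}$, $(i,j)\in\Lambda_N$ (with $x_{i,i+1}=E_i$) and defining relations - $x_{mn}x_{ij}=q^{-2}x_{ij}x_{mn}$ if $i=m<j<n$ or $i<m<j=n$; - $x_{mn}x_{ij}=x_{ij}x_{mn}$ if $i<m<n<j$ or $i<j<m<n$; - $x_{mn}x_{ij}=x_{ij}x_{mn}-(q^2-q^{-2})x_{in}x_{mj}$ if $i<m<j<n$; - $x_{mn}x_{ij}=q^2x_{ij}x_{mn}-q\,x_{in}$ if $i<j=m<n$. Its standard PBW $K$-basis is $\mathcal{B}=\{1\}\cup\{x_{i_1j_1}\cdots x_{i_kj_k}: k\ge1,\ (i_\ell,j_\ell)\in\Lambda_N,\ (i_1,j_1)\le_{lex}\cdots\le_{lex}(i_k,j_k)\}$, where $\le_{lex}$ is the lexicographic order on $\Lambda_N$. Thus the generators are listed as $a_1,\dots,a_n$, $n=N(N+1)/2$, in increasing lexicographic order of their indices. **Leading monomials.** Let $A=K[a_1,\dots,a_n]$ be a finitely generated $K$-algebra with PBW $K$-basis $\mathcal{B}=\{a^\alpha=a_1^{\alpha_1}\cdots a_n^{\alpha_n}:\alpha\in\mathbb{N}^n\}$ and let $\prec$ be a total ordering on $\mathcal{B}$.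 For $0\ne f\in A$, $\mathbf{LM}(f)$ is the $\prec$-largest element of $\mathcal{B}$ occurring with nonzero coefficient in $f$; $\mathbf{LM}(0)=0$. **Monomial ordering.** A total ordering $\prec$ on $\mathcal{B}$ is a monomial ordering if: 1. it is a well-ordering; 2. for $a^\gamma,a^\alpha,a^\beta,a^\eta\in\mathcal{B}$, if $a^\gamma\ne1$, $a^\beta\ne a^\gamma$ and $a^\gamma=\mathbf{LM}(a^\alpha a^\beta a^\eta)$, then $a^\beta\prec a^\gamma$ (hence $1\prec a^\gamma$ for all $a^\gamma\neq 1$); 3. for $a^\gamma,a^\alpha,a^\beta,a^\eta\in\mathcal{B}$, if $a^\alpha\prec a^\beta$, $\mathbf{LM}(a^\gamma a^\alpha a^\eta)\ne0$ and $\mathbf{LM}(a^\gamma a^\beta a^\eta)\notin\{0,1\}$, then $\mathbf{LM}(a^\gamma a^\alpha a^\eta)\prec\mathbf{LM}(a^\gamma a^\beta a^\eta)$. **Solvable polynomial algebra.** $A=K[a_1,\dots,a_n]$ is a solvable polynomial algebra if it has the PBW $K$-basis $\mathcal{B}=\{a^\alpha=a_1^{\alpha_1}\cdots a_n^{\alpha_n}:\alpha=(\alpha_1,\dots,\alpha_n)\in\mathbb{N}^n\}$ and there is a monomial ordering $\prec$ on $\mathcal{B}$ such that for all $1\le i<j\le n$ one has $a_ja_i=\lambda_{ji}a_ia_j+f_{ji}$ with $\lambda_{ji}\in K^*$, $f_{ji}\in A$, and $\mathbf{LM}(f_{ji})\prec a_ia_j$ whenever $f_{ji}\ne0$. *)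

theory Defs
  imports
    "HOL-Algebra.QuotRing"
    "HOL-Algebra.Subrings"
    "HOL-Algebra.Algebraic_Closure_Type"
    "HOL-Library.Poly_Mapping"
begin

section \<open>Associative unital algebras over a field\<close>

text \<open>The locale \<open>algebra\<close> of the library requires a commutative product, hence the
  following variant. The base field is the type \<open>'k\<close>, viewed as a ring record.\<close>

locale assoc_algebra =
  module "ring_of_type_algebra :: 'k ring" A + ring A
  for A :: "('k::field, 'a, 'm) module_scheme" (structure) +
  assumes smult_mult_left:
      "\<lbrakk> x \<in> carrier A; y \<in> carrier A \<rbrakk> \<Longrightarrow> (c \<odot> x) \<otimes> y = c \<odot> (x \<otimes> y)"
    and smult_mult_right:
      "\<lbrakk> x \<in> carrier A; y \<in> carrier A \<rbrakk> \<Longrightarrow> x \<otimes> (c \<odot> y) = c \<odot> (x \<otimes> y)"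

definition is_subalgebra :: "('k, 'a, 'm) module_scheme \<Rightarrow> 'a set \<Rightarrow> bool" where
  "is_subalgebra A S \<longleftrightarrow> subring S A \<and> (\<forall>c. \<forall>x\<in>S. c \<odot>\<^bsub>A\<^esub> x \<in> S)"

definition generated_subalgebra ::
    "('k, 'a, 'm) module_scheme \<Rightarrow> 'a set \<Rightarrow> ('k, 'a, 'm) module_scheme" where
  "generated_subalgebra A S = A \<lparr>carrier := \<Inter>{T. is_subalgebra A T \<and> S \<subseteq> T}\<rparr>"

definition quotient_algebra ::
    "('k, 'a, 'm) module_scheme \<Rightarrow> 'a set \<Rightarrow> ('k, 'a set) module" where
  "quotient_algebra A I =
     \<lparr>carrier = carrier (A Quot I), monoid.mult = monoid.mult (A Quot I), one = one (A Quot I),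
      ring.zero = ring.zero (A Quot I), add = ring.add (A Quot I),
      module.smult = (\<lambda>c C. \<Union>x\<in>C. I +>\<^bsub>A\<^esub> (c \<odot>\<^bsub>A\<^esub> x))\<rparr>"


section \<open>Bases and coefficients\<close>

definition is_coeffs ::
    "('k::field, 'a, 'm) module_scheme \<Rightarrow> 'a set \<Rightarrow> 'a \<Rightarrow> ('a \<Rightarrow> 'k) \<Rightarrow> bool" where
  "is_coeffs A B f c \<longleftrightarrow>
     finite {b. c b \<noteq> 0} \<and> {b. c b \<noteq> 0} \<subseteq> B \<and>
     f = (\<Oplus>\<^bsub>A\<^esub>b\<in>{b. c b \<noteq> 0}. c b \<odot>\<^bsub>A\<^esub> b)"

definition is_basis :: "('k::field, 'a, 'm) module_scheme \<Rightarrow> 'a set \<Rightarrow> bool" where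
  "is_basis A B \<longleftrightarrow> B \<subseteq> carrier A \<and> (\<forall>f\<in>carrier A. \<exists>!c. is_coeffs A B f c)"

definition coeffs_wrt ::
    "('k::field, 'a, 'm) module_scheme \<Rightarrow> 'a set \<Rightarrow> 'a \<Rightarrow> 'a \<Rightarrow> 'k" where
  "coeffs_wrt A B f = (THE c. is_coeffs A B f c)"


section \<open>PBW bases, leading monomials, monomial orderings\<close>

text \<open>The generators \<open>a\<^sub>1, \<dots>, a\<^sub>n\<close> are given as a list \<open>as\<close>, so that they are numbered
  from 0 and \<open>n = length as\<close>. Exponent vectors in \<open>\<nat>\<^sup>n\<close> are functions vanishing from \<open>n\<close> on.\<close>

definition exponents :: "nat \<Rightarrow> (nat \<Rightarrow> nat) set" where
  "exponents n = {\<alpha>. \<forall>i\<ge>n. \<alpha> i = 0}"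

definition std_monomial :: "('a, 'm) monoid_scheme \<Rightarrow> 'a list \<Rightarrow> (nat \<Rightarrow> nat) \<Rightarrow> 'a" where
  "std_monomial A as \<alpha> =
     foldr (\<lambda>i m. (as ! i) [^]\<^bsub>A\<^esub> (\<alpha> i) \<otimes>\<^bsub>A\<^esub> m) [0..<length as] \<one>\<^bsub>A\<^esub>"

definition std_monomials :: "('a, 'm) monoid_scheme \<Rightarrow> 'a list \<Rightarrow> 'a set" where
  "std_monomials A as = std_monomial A as ` exponents (length as)"

definition has_PBW_basis :: "('k::field, 'a, 'm) module_scheme \<Rightarrow> 'a list \<Rightarrow> bool" where
  "has_PBW_basis A as \<longleftrightarrow>
     inj_on (std_monomial A as) (exponents (length as)) \<and> is_basis A (std_monomials A as)"

text \<open>Orderings are reflexive relations \<open>r\<close>, as in the library; this is the strict part.\<close>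

definition strictly_below :: "('a \<times> 'a) set \<Rightarrow> 'a \<Rightarrow> 'a \<Rightarrow> bool" where
  "strictly_below r x y \<longleftrightarrow> (x, y) \<in> r \<and> x \<noteq> y"

definition LM ::
    "('k::field, 'a, 'm) module_scheme \<Rightarrow> 'a set \<Rightarrow> ('a \<times> 'a) set \<Rightarrow> 'a \<Rightarrow> 'a" where
  "LM A B r f =
     (if f = \<zero>\<^bsub>A\<^esub> then \<zero>\<^bsub>A\<^esub>
      else (THE b. coeffs_wrt A B f b \<noteq> 0 \<and>
                   (\<forall>b'. coeffs_wrt A B f b' \<noteq> 0 \<longrightarrow> (b', b) \<in> r)))"

definition monomial_ordering ::
    "('k::field, 'a, 'm) module_scheme \<Rightarrow> 'a set \<Rightarrow> ('a \<times> 'a) set \<Rightarrow> bool" where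
  "monomial_ordering A B r \<longleftrightarrow>
     well_order_on B r \<and>
     (\<forall>g\<in>B. \<forall>a\<in>B. \<forall>b\<in>B. \<forall>h\<in>B.
        g \<noteq> \<one>\<^bsub>A\<^esub> \<and> b \<noteq> g \<and> g = LM A B r (a \<otimes>\<^bsub>A\<^esub> b \<otimes>\<^bsub>A\<^esub> h) \<longrightarrow> strictly_below r b g) \<and>
     (\<forall>g\<in>B. \<forall>a\<in>B. \<forall>b\<in>B. \<forall>h\<in>B.
        strictly_below r a b \<and>
        LM A B r (g \<otimes>\<^bsub>A\<^esub> a \<otimes>\<^bsub>A\<^esub> h) \<noteq> \<zero>\<^bsub>A\<^esub> \<and>
        LM A B r (g \<otimes>\<^bsub>A\<^esub> b \<otimes>\<^bsub>A\<^esub> h) \<notin> {\<zero>\<^bsub>A\<^esub>, \<one>\<^bsub>A\<^esub>} \<longrightarrow>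
        strictly_below r (LM A B r (g \<otimes>\<^bsub>A\<^esub> a \<otimes>\<^bsub>A\<^esub> h)) (LM A B r (g \<otimes>\<^bsub>A\<^esub> b \<otimes>\<^bsub>A\<^esub> h)))"

definition solvable_polynomial_algebra ::
    "('k::field, 'a, 'm) module_scheme \<Rightarrow> 'a list \<Rightarrow> bool" where
  "solvable_polynomial_algebra A as \<longleftrightarrow>
     assoc_algebra A \<and> set as \<subseteq> carrier A \<and>
     carrier (generated_subalgebra A (set as)) = carrier A \<and>
     has_PBW_basis A as \<and>
     (\<exists>r. monomial_ordering A (std_monomials A as) r \<and>
        (\<forall>j<length as. \<forall>i<j. \<exists>c f. c \<noteq> 0 \<and> f \<in> carrier A \<and>
           as ! j \<otimes>\<^bsub>A\<^esub> as ! i = c \<odot>\<^bsub>A\<^esub> (as ! i \<otimes>\<^bsub>A\<^esub> as ! j) \<oplus>\<^bsub>A\<^esub> f \<and>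
           (f \<noteq> \<zero>\<^bsub>A\<^esub> \<longrightarrow>
              strictly_below r (LM A (std_monomials A as) r f) (as ! i \<otimes>\<^bsub>A\<^esub> as ! j))))"


section \<open>Free algebras\<close>

text \<open>The product of \<open>poly_mapping\<close> is the convolution with respect to the addition of the
  index type. Words under concatenation, written additively, therefore give the algebra of
  noncommutative polynomials.\<close>

datatype 'g word = Word (letters: "'g list")

instantiation word :: (type) monoid_add
begin

definition "0 = Word []"

definition "u + v = Word (letters u @ letters v)"

instance
  by standard (simp_all add: zero_word_def plus_word_def)

end

type_synonym ('g, 'k) ncpoly = "'g word \<Rightarrow>\<^sub>0 'k"

definition const :: "'k::field \<Rightarrow> ('g, 'k) ncpoly" where
  "const c = Poly_Mapping.single 0 c"

definition gen :: "'g \<Rightarrow> ('g, 'k::field) ncpoly" where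
  "gen g = Poly_Mapping.single (Word [g]) 1"

definition free_algebra :: "'g set \<Rightarrow> ('k::field, ('g, 'k) ncpoly) module" where
  "free_algebra G =
     \<lparr>carrier = {p. \<forall>w\<in>Poly_Mapping.keys p. set (letters w) \<subseteq> G},
      monoid.mult = (*), one = 1, ring.zero = 0, add = (+),
      module.smult = (\<lambda>c p. const c * p)\<rparr>"


section \<open>The Drinfeld-Jimbo quantum group of type \<open>A\<^sub>N\<close>\<close>

datatype qgen = GenE nat | GenK nat | GenKinv nat | GenF nat

abbreviation gE :: "nat \<Rightarrow> (qgen, 'k::field) ncpoly" where "gE i \<equiv> gen (GenE i)"
abbreviation gK :: "nat \<Rightarrow> (qgen, 'k::field) ncpoly" where "gK i \<equiv> gen (GenK i)"
abbreviation gKi :: "nat \<Rightarrow> (qgen, 'k::field) ncpoly" where "gKi i \<equiv> gen (GenKinv i)"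
abbreviation gF :: "nat \<Rightarrow> (qgen, 'k::field) ncpoly" where "gF i \<equiv> gen (GenF i)"

definition cartan :: "nat \<Rightarrow> nat \<Rightarrow> int" where
  "cartan i j = (if i = j then 2 else if i = Suc j \<or> j = Suc i then -1 else 0)"

definition qbinomial :: "'k::field \<Rightarrow> nat \<Rightarrow> nat \<Rightarrow> 'k" where
  "qbinomial t m n =
     (if n = 0 \<or> n = m then 1
      else \<Prod>i=1..n. (t powi (int m - int i + 1) - t powi (int i - int m - 1)) /
                     (t powi int i - t powi (- int i)))"

text \<open>\<open>Y\<close> is \<open>gE\<close> or \<open>gF\<close>.\<close>

definition serre ::
    "'k::field \<Rightarrow> (nat \<Rightarrow> (qgen, 'k) ncpoly) \<Rightarrow> nat \<Rightarrow> nat \<Rightarrow> (qgen, 'k) ncpoly" where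
  "serre q Y i j =
     (let m = nat (1 - cartan i j)
      in \<Sum>v=0..m. const ((-1) ^ v * qbinomial (q ^ 2) m v) * Y i ^ (m - v) * Y j * Y i ^ v)"

text \<open>In type \<open>A\<^sub>N\<close> all \<open>d\<^sub>i\<close> are 1. A relation \<open>l = r\<close> is represented by \<open>l - r\<close>.\<close>

definition Uq_relations :: "nat \<Rightarrow> 'k::field \<Rightarrow> (qgen, 'k) ncpoly set" where
  "Uq_relations N q =
     (\<Union>i\<in>{1..N}. {gK i * gKi i - 1, gKi i * gK i - 1}) \<union>
     (\<Union>i\<in>{1..N}. \<Union>j\<in>{1..N}.
        {gK i * gK j - gK j * gK i,
         gE j * gK i - const (q powi (- cartan i j)) * gK i * gE j,
         gE j * gKi i - const (q powi (cartan i j)) * gKi i * gE j,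
         gK i * gF j - const (q powi (- cartan i j)) * gF j * gK i,
         gKi i * gF j - const (q powi (cartan i j)) * gF j * gKi i,
         gE i * gF j - gF j * gE i -
           (if i = j then const (1 / (q powi 2 - q powi (-2))) * (gK i ^ 2 - gKi i ^ 2)
            else 0)}) \<union>
     (\<Union>i\<in>{1..N}. \<Union>j\<in>{1..N} - {i}. {serre q gE i j, serre q gF i j})"

definition Uq_free :: "nat \<Rightarrow> ('k::field, (qgen, 'k) ncpoly) module" where
  "Uq_free N = free_algebra (\<Union>i\<in>{1..N}. {GenE i, GenK i, GenKinv i, GenF i})"

definition Uq_ideal :: "nat \<Rightarrow> 'k::field \<Rightarrow> (qgen, 'k) ncpoly set" where
  "Uq_ideal N q = Idl\<^bsub>Uq_free N\<^esub> (Uq_relations N q)"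

definition Uq :: "nat \<Rightarrow> 'k::field \<Rightarrow> ('k, (qgen, 'k) ncpoly set) module" where
  "Uq N q = quotient_algebra (Uq_free N) (Uq_ideal N q)"

definition Uq_class :: "nat \<Rightarrow> 'k::field \<Rightarrow> (qgen, 'k) ncpoly \<Rightarrow> (qgen, 'k) ncpoly set" where
  "Uq_class N q p = Uq_ideal N q +>\<^bsub>Uq_free N\<^esub> p"

definition Uq_plus :: "nat \<Rightarrow> 'k::field \<Rightarrow> ('k, (qgen, 'k) ncpoly set) module" where
  "Uq_plus N q = generated_subalgebra (Uq N q) ((\<lambda>i. Uq_class N q (gE i)) ` {1..N})"


section \<open>Jimbo's generators\<close>

text \<open>\<open>x\<^bsub>i,i+1\<^esub> = E\<^sub>i\<close>, and the other \<open>x\<^bsub>ij\<^esub>\<close> are determined by the instances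
  \<open>x\<^bsub>n-1,n\<^esub> x\<^bsub>i,n-1\<^esub> = q\<^sup>2 x\<^bsub>i,n-1\<^esub> x\<^bsub>n-1,n\<^esub> - q x\<^bsub>in\<^esub>\<close> of Jimbo's defining relations, that is,
  \<open>x\<^bsub>in\<^esub> = q x\<^bsub>i,n-1\<^esub> E\<^bsub>n-1\<^esub> - q\<^sup>-\<^sup>1 E\<^bsub>n-1\<^esub> x\<^bsub>i,n-1\<^esub>\<close>.
  The last argument below is \<open>j - i - 1\<close>.\<close>

primrec root_poly :: "'k::field \<Rightarrow> nat \<Rightarrow> nat \<Rightarrow> (qgen, 'k) ncpoly" where
  "root_poly q i 0 = gE i"
| "root_poly q i (Suc k) =
     const q * root_poly q i k * gE (i + k + 1) -
     const (inverse q) * gE (i + k + 1) * root_poly q i k"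

definition jimbo_gen :: "nat \<Rightarrow> 'k::field \<Rightarrow> nat \<Rightarrow> nat \<Rightarrow> (qgen, 'k) ncpoly set" where
  "jimbo_gen N q i j = Uq_class N q (root_poly q i (j - i - 1))"

text \<open>All \<open>(i, j)\<close> with \<open>1 \<le> i < j \<le> N + 1\<close>, in increasing lexicographic order.\<close>

definition Lambda_list :: "nat \<Rightarrow> (nat \<times> nat) list" where
  "Lambda_list N = [(i, j). i \<leftarrow> [1..<N + 1], j \<leftarrow> [i + 1..<N + 2]]"

definition jimbo_gens :: "nat \<Rightarrow> 'k::field \<Rightarrow> (qgen, 'k) ncpoly set list" where
  "jimbo_gens N q = map (\<lambda>(i, j). jimbo_gen N q i j) (Lambda_list N)"

end

theory Submission
  imports Defs
begin

text \<open>
  Jimbo's relations follow from the Serre relations; the division by \<open>q\<^sup>2 + q\<^sup>-\<^sup>2\<close>, possible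
  since \<open>q\<^sup>8 \<noteq> 1\<close>, enters only in the proof that \<open>E\<^sub>2\<close> commutes with \<open>x\<^sub>1\<^sub>4\<close> in type \<open>A\<^sub>3\<close>. They rewrite
  \<open>x\<^bsub>mn\<^esub> x\<^bsub>ij\<^esub>\<close>, for \<open>(i, j) < (m, n)\<close>, as a nonzero multiple of \<open>x\<^bsub>ij\<^esub> x\<^bsub>mn\<^esub>\<close> plus a multiple of a word
  in generators lying strictly after \<open>(i, j)\<close>. In the pure lexicographic ordering of exponent
  vectors that word is smaller than \<open>x\<^bsub>ij\<^esub> x\<^bsub>mn\<^esub>\<close>, whence the ordered monomials span and leading
  monomials are multiplicative.

  Linear independence of the ordered monomials: the algebra \<open>U\<^sub>q\<close> acts on the free algebra in the
  \<open>E\<^sub>i\<close> modulo the Serre ideal (a Verma module), so the \<open>E\<^sub>i\<close> satisfy no relations in \<open>U\<^sub>q\<close> besides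
  consequences of the Serre relations. The formulas for left multiplication by \<open>E\<^sub>i\<close> on ordered
  monomials define operators on a space with a basis of formal exponent vectors; these operators
  satisfy the Serre relations, and an ordered monomial, applied to the zero vector, yields
  its own exponent vector. No quantum integer other than \<open>[1] = 1\<close> has to be inverted, so that
  roots of unity do no harm.
\<close>

section \<open>Serre polynomials\<close>

text \<open>The rows of exponents are handled by a coproduct pattern. The operator of E_i is a sum
  over rows, and the summand of a later row q-commutes with those of earlier rows just as K (x) E
  does with E (x) 1. Hence Serre relations pass from single rows to sums
  (\<open>serre_poly_sum\<close>); within one row they amount to [n] + [n+2] = (q^2 + q^-2) [n+1],
  an identity that survives at roots of unity. The Verma module enters because dividing by all
  relations, including those with F_i and K_i, might identify more polynomials in the E_i than the
  Serre relations do. Together the two actions give linear functionals dual to the ordered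
  monomials; these prove independence, instead of a confluence argument. Computations take place in
  type-class rings (free algebras, endomorphisms), with scalars as central elements; only the
  results are carried over to the quotient with its carrier set. There the E_i are indexed by all
  naturals, and those outside 1..N are sent to zero, so that index bounds do not intrude on the
  inductions.\<close>

definition serre_poly :: "'r::ring_1 \<Rightarrow> 'r \<Rightarrow> 'r \<Rightarrow> 'r" where
  "serre_poly b x y = x * x * y - b * (x * y * x) + y * x * x"

text \<open>Scalars are modelled by central invertible ring elements, so that the same identities
  serve free algebras and endomorphism rings.\<close>

locale central_unit =
  fixes t ti :: "'r::ring_1"
  assumes t_comm: "x * t = t * x" and ti_comm: "x * ti = ti * x" and t_inv: "t * ti = 1"
begin

lemma ti_inv: "ti * t = 1"
  using t_inv ti_comm by metis

lemma t_cancel: "t * (ti * x) = x" "ti * (t * x) = x"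
  by (simp_all add: t_inv ti_inv flip: mult.assoc)

lemma t_left_comm: "x * (t * z) = t * (x * z)" "x * (ti * z) = ti * (x * z)"
  by (simp_all add: t_comm ti_comm flip: mult.assoc)

lemmas central_simps =
  t_comm[of x] ti_comm[of x] t_left_comm[of x] for x

text \<open>The mixed terms cancel degree by degree: the part with two x and one y', for instance,
  is x x y' times 1 - (t + ti) t + t t = 0. This is the computation by which a coproduct respects
  the Serre relation.\<close>

lemma serre_poly_sum:
  assumes "x' * x = ti * ti * (x * x')" "x' * y = t * (y * x')" "y' * x = t * (x * y')"
    and "serre_poly (t + ti) x y = 0" "serre_poly (t + ti) x' y' = 0"
  shows "serre_poly (t + ti) (x + x') (y + y') = 0"
proof -
  \<comment> \<open>Products are normalised to the right, so each exchange rule is also needed in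
    front of a further factor.\<close>
  have l: "x' * (x * z) = ti * (ti * (x * (x' * z)))" "x' * (y * z) = t * (y * (x' * z))"
    "y' * (x * z) = t * (x * (y' * z))" for z
    using assms(1-3) by (simp_all flip: mult.assoc)
  have "serre_poly (t + ti) (x + x') (y + y') - serre_poly (t + ti) x y - serre_poly (t + ti) x' y' = 0"
    unfolding serre_poly_def
    by (simp add: assms(1-3) l algebra_simps central_simps[of x] central_simps[of x']
        central_simps[of y] central_simps[of y'] t_inv ti_inv t_cancel)
  then show ?thesis
    by (simp add: assms(4,5))
qed

text \<open>In the applications \<open>f\<close>, \<open>x\<close>, \<open>k\<close>, \<open>l\<close> are \<open>F\<^sub>i\<close>, \<open>E\<^sub>i\<close>, \<open>K\<^sub>i\<^sup>2\<close>, \<open>K\<^sub>i\<^sup>-\<^sup>2\<close>, or \<open>E\<^sub>i\<close>, \<open>F\<^sub>i\<close>, \<open>K\<^sub>i\<^sup>-\<^sup>2\<close>, \<open>K\<^sub>i\<^sup>2\<close>.\<close>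

lemma serre_poly_commutator_left:
  assumes "f * x = x * f - d * (k - l)" "f * y = y * f" "\<And>z. z * d = d * z"
    and "k * x = t * t * (x * k)" "l * x = ti * ti * (x * l)"
    and "k * y = ti * (y * k)" "l * y = t * (y * l)"
  shows "f * serre_poly (t + ti) x y = serre_poly (t + ti) x y * f"
proof -
  have l: "f * (x * z) = x * (f * z) - d * (k * z - l * z)" "f * (y * z) = y * (f * z)" 
    "k * (x * z) = t * (t * (x * (k * z)))" "l * (x * z) = ti * (ti * (x * (l * z)))" 
    "k * (y * z) = ti * (y * (k * z))" "l * (y * z) = t * (y * (l * z))" for z
    using assms by (simp_all add: left_diff_distrib right_diff_distrib flip: mult.assoc)
  have d: "v * (d * z) = d * (v * z)" for v z
    by (simp add: assms(3) flip: mult.assoc)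
  show ?thesis
    unfolding serre_poly_def
    by (simp add: assms(1,2,4-7) assms(3)[of x] assms(3)[of y]  assms(3)[of t] assms(3)[of ti]
        d[of x] d[of y] d[of t] d[of ti] l algebra_simps central_simps[of x] 
        central_simps[of y] central_simps[of f] central_simps[of k] t_inv ti_inv t_cancel)
qed

text \<open>Only k and l, in the place of y, are left over. Moved to the right of x x they carry the
  factors 1 - (t + ti) ti + ti ti and 1 - (t + ti) t + t t, both zero.\<close>

lemma serre_poly_commutator_right:
  assumes "f * x = x * f" "f * y = y * f - d * (k - l)" "\<And>z. z * d = d * z"
    and "k * x = ti * (x * k)" "l * x = t * (x * l)"
  shows "f * serre_poly (t + ti) x y = serre_poly (t + ti) x y * f"
proof -
  have l: "f * (y * z) = y * (f * z) - d * (k * z - l * z)" "f * (x * z) = x * (f * z)" 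
    "k * (x * z) = ti * (x * (k * z))" "l * (x * z) = t * (x * (l * z))" for z
    using assms by (simp_all add: left_diff_distrib right_diff_distrib flip: mult.assoc)
  have d: "v * (d * z) = d * (v * z)" for v z
    by (simp add: assms(3) flip: mult.assoc)
  show ?thesis
    unfolding serre_poly_def
    by (simp add: assms(1,2,4-) assms(3)[of x] assms(3)[of y]  assms(3)[of t] assms(3)[of ti]
        d[of x] d[of y] d[of t] d[of ti] l algebra_simps central_simps[of x] 
        central_simps[of y] central_simps[of f] central_simps[of k] t_inv ti_inv t_cancel)
qed

end

section \<open>Jimbo's relations modulo an ideal\<close>

locale two_sided_ideal =
  fixes J :: "'r::ring_1 set"
  assumes zero_mem: "0 \<in> J" and add_mem: "x \<in> J \<Longrightarrow> y \<in> J \<Longrightarrow> x + y \<in> J"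
    and mult_left_mem: "x \<in> J \<Longrightarrow> z * x \<in> J" and mult_right_mem: "x \<in> J \<Longrightarrow> x * z \<in> J"
begin

lemma uminus_mem: "x \<in> J \<Longrightarrow> - x \<in> J"
  using mult_left_mem[of x "- 1"] by simp

lemma diff_mem: "x \<in> J \<Longrightarrow> y \<in> J \<Longrightarrow> x - y \<in> J"
  using add_mem[OF _ uminus_mem, of x y] by simp

lemmas closure = add_mem diff_mem uminus_mem mult_left_mem mult_right_mem

definition cong (infix "\<approx>" 50) where "x \<approx> y \<longleftrightarrow> x - y \<in> J"

lemma cong_refl [simp]: "x \<approx> x"
  by (simp add: cong_def zero_mem)

lemma cong_sym: "x \<approx> y \<Longrightarrow> y \<approx> x"
  using uminus_mem[of "x - y"] by (simp add: cong_def)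

lemma cong_trans [trans]: "x \<approx> y \<Longrightarrow> y \<approx> z \<Longrightarrow> x \<approx> z"
  using add_mem[of "x - y" "y - z"] by (simp add: cong_def)

lemma cong_diff: "x \<approx> y \<Longrightarrow> u \<approx> v \<Longrightarrow> x - u \<approx> y - v"
  using diff_mem[of "x - y" "u - v"] by (simp add: cong_def algebra_simps)

lemma cong_mult:
  assumes "x \<approx> y" "u \<approx> v" shows "x * u \<approx> y * v"
proof -
  have "x * u - y * v = (x - y) * u + y * (u - v)"
    by (simp add: algebra_simps)
  with assms show ?thesis
    by (simp add: cong_def closure)
qed

end

text \<open>The recursion of \<open>root_poly\<close> in an arbitrary ring, so that it can be
  transported along substitution homomorphisms.\<close>

primrec root_vector :: "'r::ring_1 \<Rightarrow> 'r \<Rightarrow> (nat \<Rightarrow> 'r) \<Rightarrow> nat \<Rightarrow> nat \<Rightarrow> 'r" where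
  "root_vector q qi e i 0 = e i"
| "root_vector q qi e i (Suc k) =
     q * root_vector q qi e i k * e (i + k + 1) - qi * e (i + k + 1) * root_vector q qi e i k"

locale serre_relations = central_unit q qi + two_sided_ideal J
  for q qi :: "'r::ring_1" and J :: "'r set" +
  fixes e :: "nat \<Rightarrow> 'r" and w :: 'r
  assumes far: "Suc k < l \<Longrightarrow> e k * e l - e l * e k \<in> J"
    and serre_up: "serre_poly (q * q + qi * qi) (e k) (e (Suc k)) \<in> J"
    and serre_down: "serre_poly (q * q + qi * qi) (e (Suc k)) (e k) \<in> J"
    and w_inv: "w * (q * q + qi * qi) = 1"
begin

definition rv :: "nat \<Rightarrow> nat \<Rightarrow> 'r" where "rv i j = root_vector q qi e i (j - i - 1)"

definition br :: "'r \<Rightarrow> 'r \<Rightarrow> 'r" where "br a b = q * (a * b) - qi * (b * a)"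

definition comm :: "'r \<Rightarrow> 'r \<Rightarrow> bool" where "comm a b \<longleftrightarrow> a * b \<approx> b * a"

definition qcomm :: "'r \<Rightarrow> 'r \<Rightarrow> bool" where "qcomm a b \<longleftrightarrow> a * b \<approx> qi * (qi * (b * a))"

lemma rv_Suc_self: "rv i (Suc i) = e i"
  by (simp add: rv_def)

lemma rv_Suc: assumes "i < j" shows "rv i (Suc j) = br (rv i j) (e j)"
proof -
  obtain k where "j = Suc (i + k)"
    using assms less_imp_Suc_add by blast
  then show ?thesis
    by (simp add: rv_def br_def mult.assoc)
qed

section \<open>Calculus of q-brackets modulo the ideal\<close>

lemma br_cong: "a \<approx> a' \<Longrightarrow> b \<approx> b' \<Longrightarrow> br a b \<approx> br a' b'"
  unfolding br_def by (intro cong_diff cong_mult cong_refl)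

lemma comm_sym: "comm a b \<Longrightarrow> comm b a"
  by (simp add: comm_def cong_sym)

lemma comm_cong: "b' \<approx> b \<Longrightarrow> comm a b \<Longrightarrow> comm a b'"
  unfolding comm_def by (metis cong_mult cong_refl cong_sym cong_trans)

lemma qcomm_cong: "a' \<approx> a \<Longrightarrow> b' \<approx> b \<Longrightarrow> qcomm a b \<Longrightarrow> qcomm a' b'"
  unfolding qcomm_def by (meson cong_mult cong_refl cong_sym cong_trans)

lemmas unit_simps = t_inv ti_inv t_cancel algebra_simps

text \<open>Here and in the next lemmas an explicit identity writes the defect of the new relation
  as a combination of the assumed defects; closure of \<open>J\<close> does the rest.\<close>

lemma comm_br:
  assumes "comm z a" "comm z b" shows "comm z (br a b)"
proof -
  have "z * br a b - br a b * z =
      q * ((z * a - a * z) * b + a * (z * b - b * z)) - qi * ((z * b - b * z) * a + b * (z * a - a * z))"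
    by (simp add: br_def central_simps[of z] central_simps[of a] central_simps[of b] unit_simps)
  with assms show ?thesis
    unfolding comm_def cong_def by (simp only: closure)
qed

lemma qcomm_br_left1:
  assumes "qcomm a z" "comm z b" shows "qcomm (br a b) z"
proof -
  have "br a b * z - qi * (qi * (z * br a b)) =
      q * ((a * z - qi * (qi * (z * a))) * b - a * (z * b - b * z))
      - qi * (b * (a * z - qi * (qi * (z * a))) - qi * qi * (z * b - b * z) * a)"
    by (simp add: br_def central_simps[of z] central_simps[of a] central_simps[of b] unit_simps)
  with assms show ?thesis
    unfolding comm_def qcomm_def cong_def by (simp only: closure)
qed

lemma qcomm_br_right1:
  assumes "qcomm z a" "comm z b" shows "qcomm z (br a b)"
proof -
  have "z * br a b - qi * (qi * (br a b * z)) =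
      q * ((z * a - qi * (qi * (a * z))) * b + qi * qi * a * (z * b - b * z))
      - qi * (b * (z * a - qi * (qi * (a * z))) + (z * b - b * z) * a)"
    by (simp add: br_def central_simps[of z] central_simps[of a] central_simps[of b] unit_simps)
  with assms show ?thesis
    unfolding comm_def qcomm_def cong_def by (simp only: closure)
qed

lemma qcomm_br_left2:
  assumes "qcomm b z" "comm z a" shows "qcomm (br a b) z"
proof -
  have "br a b * z - qi * (qi * (z * br a b)) =
      q * (a * (b * z - qi * (qi * (z * b))) - qi * qi * (z * a - a * z) * b)
      - qi * ((b * z - qi * (qi * (z * b))) * a - b * (z * a - a * z))"
    by (simp add: br_def central_simps[of z] central_simps[of a] central_simps[of b] unit_simps)
  with assms show ?thesis
    unfolding comm_def qcomm_def cong_def by (simp only: closure)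
qed

lemma qcomm_br_right2:
  assumes "qcomm z b" "comm z a" shows "qcomm z (br a b)"
proof -
  have "z * br a b - qi * (qi * (br a b * z)) =
      q * (a * (z * b - qi * (qi * (b * z))) + (z * a - a * z) * b)
      - qi * ((z * b - qi * (qi * (b * z))) * a + qi * qi * b * (z * a - a * z))"
    by (simp add: br_def central_simps[of z] central_simps[of a] central_simps[of b] unit_simps)
  with assms show ?thesis
    unfolding comm_def qcomm_def cong_def by (simp only: closure)
qed

text \<open>In both nestings the terms a b c and c b a have the coefficients q^2 and q^-2; what
  remains of the difference is the ordinary commutator of a c - c a with b.\<close>

lemma br_assoc:
  assumes "comm a c" shows "br (br a b) c \<approx> br a (br b c)"
proof -
  have "br (br a b) c - br a (br b c) = (a * c - c * a) * b - b * (a * c - c * a)"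
    by (simp add: br_def central_simps[of c] central_simps[of a] central_simps[of b] unit_simps)
  with assms show ?thesis
    unfolding comm_def cong_def by (simp only: closure)
qed

section \<open>Relations between root vectors\<close>

lemma comm_e: "k = l \<or> Suc k < l \<or> Suc l < k \<Longrightarrow> comm (e k) (e l)"
  using far[of k l] far[of l k] uminus_mem[of "e l * e k - e k * e l"]
  by (auto simp: comm_def cong_def zero_mem)

lemma comm_rv:
  assumes "i < j" "\<And>l. i \<le> l \<Longrightarrow> l < j \<Longrightarrow> comm z (e l)"
  shows "comm z (rv i j)"
  using assms
proof (induction j)
  case (Suc j)
  show ?case
  proof (cases "i = j")
    case False
    with Suc show ?thesis
      by (simp add: rv_Suc comm_br)
  qed (use Suc in \<open>simp add: rv_Suc_self\<close>)
qed simp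

lemma comm_far: "i < j \<Longrightarrow> j < m \<Longrightarrow> m < n \<Longrightarrow> comm (rv i j) (rv m n)"
  by (intro comm_rv comm_sym[OF comm_rv] comm_e) auto

lemma comm_e_far: "i < j \<Longrightarrow> Suc k < i \<or> j < k \<Longrightarrow> comm (e k) (rv i j)"
  by (intro comm_rv comm_e) auto

text \<open>The recursion splits off the last letter; since that letter commutes with
  \<open>rv i m\<close>, \<open>br_assoc\<close> moves the cut to any place m.\<close>

lemma rv_split:
  assumes "i < m" "m < n" shows "rv i n \<approx> br (rv i m) (rv m n)"
  using assms(2)
proof (induction n)
  case (Suc n)
  show ?case
  proof (cases "m = n")
    case False
    with Suc.prems have n: "m < n" by simp
    have "rv i (Suc n) = br (rv i n) (e n)"
      using assms n by (simp add: rv_Suc)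
    also have "\<dots> \<approx> br (br (rv i m) (rv m n)) (e n)"
      by (intro br_cong Suc.IH n cong_refl)
    also have "\<dots> \<approx> br (rv i m) (br (rv m n) (e n))"
      by (intro br_assoc comm_sym[OF comm_e_far]) (use assms n in auto)
    finally show ?thesis
      using n by (simp add: rv_Suc)
  qed (use assms in \<open>simp add: rv_Suc rv_Suc_self\<close>)
qed simp

text \<open>In rank two this relation is the Serre relation itself, up to the factor -q^-1.\<close>

lemma qcomm_adjacent_left: "qcomm (rv i (i + 2)) (e i)"
proof -
  have "rv i (i + 2) * e i - qi * (qi * (e i * rv i (i + 2))) =
      - qi * serre_poly (q * q + qi * qi) (e i) (e (Suc i))"
    by (simp add: rv_Suc rv_Suc_self br_def serre_poly_def central_simps[of "e i"] central_simps[of "e (Suc i)"] unit_simps)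
  then show ?thesis
    using serre_up[of i] by (simp only: qcomm_def cong_def closure)
qed

lemma qcomm_adjacent_right: "qcomm (e (Suc i)) (rv i (i + 2))"
proof -
  have "e (Suc i) * rv i (i + 2) - qi * (qi * (rv i (i + 2) * e (Suc i))) =
      - qi * serre_poly (q * q + qi * qi) (e (Suc i)) (e i)"
    by (simp add: rv_Suc rv_Suc_self br_def serre_poly_def central_simps[of "e i"] central_simps[of "e (Suc i)"] unit_simps)
  then show ?thesis
    using serre_down[of i] by (simp only: qcomm_def cong_def closure)
qed

lemma comm_middle: "comm (e (Suc i)) (rv i (i + 3))"
proof -
  define a b c where "a = e i" and "b = e (Suc i)" and "c = e (Suc (Suc i))"
  define B where "B = q * q + qi * qi"
  have rv: "rv i (i + 3) = br (br a b) c"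
    by (simp add: rv_Suc rv_Suc_self a_def b_def c_def numeral_3_eq_3)
  \<comment> \<open>The commutator contains the subwords b a b and b c b, which the Serre relations
    can replace only after multiplication by \<open>B\<close>: \<open>B\<close> b a b becomes b b a
    + a b b, and likewise for c. All that is left is then a multiple of a c - c a.\<close>
  have "B * (b * rv i (i + 3) - rv i (i + 3) * b) =
      q * q * (a * serre_poly B b c - serre_poly B b a * c)
      + qi * qi * (c * serre_poly B b a - serre_poly B b c * a)
      + B * (b * (a * c - c * a) * b) - qi * qi * (b * b * (a * c - c * a))
      - q * q * ((a * c - c * a) * b * b)"
    by (simp add: rv br_def serre_poly_def B_def central_simps[of c] central_simps[of a] central_simps[of b] unit_simps)
  moreover have "serre_poly B b c \<in> J" "serre_poly B b a \<in> J" "a * c - c * a \<in> J"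
    using serre_up[of "Suc i"] serre_down[of i] far[of i "Suc (Suc i)"]
    by (simp_all add: a_def b_def c_def B_def)
  ultimately have "B * (b * rv i (i + 3) - rv i (i + 3) * b) \<in> J"
    by (simp only: closure)
  then have "w * (B * (b * rv i (i + 3) - rv i (i + 3) * b)) \<in> J"
    by (rule mult_left_mem)
  then show ?thesis
    by (simp add: comm_def cong_def b_def w_inv B_def flip: mult.assoc)
qed

text \<open>The letters k - 1, k, k + 1 form the window of \<open>comm_middle\<close>; the pieces
  that \<open>rv_split\<close> cuts off on either side consist of letters at distance at least two
  from k.\<close>

lemma comm_e_inner: assumes "i < k" "Suc k < j" shows "comm (e k) (rv i j)"
proof -
  obtain p where k: "k = Suc p"
    using assms by (cases k) auto
  have mid: "comm (e k) (rv p (p + 3))"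
    using comm_middle k by simp
  have right: "comm (e k) (rv p j)"
  proof (cases "p + 3 = j")
    case False
    with assms k have "rv p j \<approx> br (rv p (p + 3)) (rv (p + 3) j)"
      by (intro rv_split) auto
    moreover have "comm (e k) (br (rv p (p + 3)) (rv (p + 3) j))"
      using assms k False by (intro comm_br mid comm_e_far) auto
    ultimately show ?thesis
      by (rule comm_cong)
  qed (use mid in simp)
  show ?thesis
  proof (cases "i = p")
    case False
    with assms k have "rv i j \<approx> br (rv i p) (rv p j)"
      by (intro rv_split) auto
    moreover have "comm (e k) (br (rv i p) (rv p j))"
      using assms k False by (intro comm_br right comm_e_far) auto
    ultimately show ?thesis
      by (rule comm_cong)
  qed (use right in simp)
qed

lemma comm_nested: "i < m \<Longrightarrow> m < n \<Longrightarrow> n < j \<Longrightarrow> comm (rv i j) (rv m n)"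
  by (intro comm_rv comm_sym[OF comm_e_inner]) auto

lemma qcomm_e_left: assumes "Suc i < n" shows "qcomm (rv i n) (e i)"
proof (cases "n = i + 2")
  case False
  with assms have "rv i n \<approx> br (rv i (i + 2)) (rv (i + 2) n)"
    by (intro rv_split) auto
  moreover have "qcomm (br (rv i (i + 2)) (rv (i + 2) n)) (e i)"
    using assms False by (intro qcomm_br_left1 qcomm_adjacent_left comm_e_far) auto
  ultimately show ?thesis
    by (rule qcomm_cong[OF _ cong_refl])
qed (use qcomm_adjacent_left in simp)

text \<open>The factor q^-2 comes from the first letter e i alone: the rest of \<open>rv i j\<close>
  is nested strictly inside \<open>rv i n\<close> and commutes with it.\<close>

lemma qcomm_same_left: assumes "i < j" "j < n" shows "qcomm (rv i n) (rv i j)"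
proof (cases "j = Suc i")
  case False
  with assms have "rv i j \<approx> br (e i) (rv (Suc i) j)"
    using rv_split[of i "Suc i" j] by (simp add: rv_Suc_self)
  moreover have "qcomm (rv i n) (br (e i) (rv (Suc i) j))"
    using assms False by (intro qcomm_br_right1 qcomm_e_left comm_nested) auto
  ultimately show ?thesis
    by (rule qcomm_cong[OF cong_refl])
qed (use assms qcomm_e_left in \<open>simp add: rv_Suc_self\<close>)

lemma qcomm_e_right: assumes "i < k" shows "qcomm (e k) (rv i (Suc k))"
proof -
  obtain p where k: "k = Suc p"
    using assms by (cases k) auto
  show ?thesis
  proof (cases "i = p")
    case False
    with assms k have "rv i (Suc k) \<approx> br (rv i p) (rv p (Suc k))"
      by (intro rv_split) auto
    moreover have "qcomm (e k) (br (rv i p) (rv p (Suc k)))"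
      using assms k False qcomm_adjacent_right[of p]
      by (intro qcomm_br_right2 comm_e_far) (auto simp: numeral_2_eq_2)
    ultimately show ?thesis
      by (rule qcomm_cong[OF cong_refl])
  qed (use qcomm_adjacent_right k in \<open>simp add: numeral_2_eq_2\<close>)
qed

lemma qcomm_same_right: assumes "i < j" "j < n" shows "qcomm (rv j n) (rv i n)"
proof -
  obtain p where n: "n = Suc p"
    using assms by (cases n) auto
  show ?thesis
  proof (cases "j = p")
    case False
    with assms n have "qcomm (br (rv j p) (e p)) (rv i n)"
      by (auto intro!: qcomm_br_left2 qcomm_e_right comm_nested)
    then show ?thesis
      using False assms n by (simp add: rv_Suc)
  qed (use assms n qcomm_e_right in \<open>simp add: rv_Suc_self\<close>)
qed

lemma rv_adjacent:
  assumes "i < m" "m < n"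
  shows "rv m n * rv i m \<approx> q * q * (rv i m * rv m n) - q * rv i n"
proof -
  have "rv m n * rv i m - (q * q * (rv i m * rv m n) - q * rv i n) = q * (rv i n - br (rv i m) (rv m n))"
    by (simp add: br_def central_simps[of "rv i m"] central_simps[of "rv m n"] central_simps[of "rv i n"] unit_simps)
  with rv_split[OF assms] show ?thesis
    by (simp only: cong_def closure)
qed

lemma rv_crossing:
  assumes "i < m" "m < j" "j < n"
  shows "rv m n * rv i j \<approx> rv i j * rv m n - (q * q - qi * qi) * (rv i n * rv m j)"
proof -
  define a b c y where "a = rv i m" and "b = rv m j" and "c = rv m n" and "y = rv i n"
  have "c * a \<approx> q * q * (a * c) - q * y"
    using assms rv_adjacent[of i m n] by (simp add: a_def c_def y_def)
  moreover have "c * b \<approx> qi * (qi * (b * c))"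
    using assms qcomm_same_left[of m j n] by (simp add: b_def c_def qcomm_def)
  moreover have "y * b \<approx> b * y"
    using assms comm_nested[of i m j n] by (simp add: b_def y_def comm_def)
  \<comment> \<open>Moving c past a leaves -q y. This yields -q^2 y b from the term q a b of the
    bracket and q^-2 b y from -q^-1 b a, where c has already met b; since y and b commute, the
    coefficient is -(q^2 - q^-2).\<close>
  moreover have "c * br a b - (br a b * c - (q * q - qi * qi) * (y * b)) =
      q * (c * a - (q * q * (a * c) - q * y)) * b
      + q * q * q * a * (c * b - qi * (qi * (b * c))) - qi * (c * b - qi * (qi * (b * c))) * a
      - qi * qi * qi * b * (c * a - (q * q * (a * c) - q * y)) - qi * qi * (y * b - b * y)"
    by (simp add: br_def central_simps[of a] central_simps[of b] central_simps[of c] central_simps[of y] unit_simps)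
  ultimately have "c * br a b \<approx> br a b * c - (q * q - qi * qi) * (y * b)"
    by (simp only: cong_def closure)
  moreover have "rv i j \<approx> br a b"
    using rv_split assms by (simp add: a_def b_def)
  ultimately have "c * rv i j \<approx> rv i j * c - (q * q - qi * qi) * (y * b)"
    by (meson cong_diff cong_mult cong_refl cong_sym cong_trans)
  then show ?thesis
    by (simp add: b_def c_def y_def)
qed

end

section \<open>Linear endomorphisms and substitution homomorphisms\<close>

definition scale :: "'k::field \<Rightarrow> ('x \<Rightarrow>\<^sub>0 'k) \<Rightarrow> ('x \<Rightarrow>\<^sub>0 'k)" where
  "scale c p = Poly_Mapping.map ((*) c) p"

lemma lookup_scale [simp]: "Poly_Mapping.lookup (scale c p) x = c * Poly_Mapping.lookup p x"
  by (simp add: scale_def map.rep_eq when_def)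

lemma scale_add: "scale c (p + p') = scale c p + scale c p'"
  by (intro poly_mapping_eqI) (simp add: lookup_add distrib_left)

lemma scale_diff: "scale c (p - p') = scale c p - scale c p'"
  by (intro poly_mapping_eqI) (simp add: lookup_minus right_diff_distrib)

lemma scale_zero [simp]: "scale c 0 = 0" "scale 0 p = 0"
  by (intro poly_mapping_eqI; simp)+

lemma scale_add_left: "scale (c + d) p = scale c p + scale d p"
  by (intro poly_mapping_eqI) (simp add: lookup_add distrib_right)

lemma scale_scale: "scale c (scale d p) = scale (c * d) p"
  by (intro poly_mapping_eqI) simp

lemma scale_one [simp]: "scale 1 p = p"
  by (intro poly_mapping_eqI) simp

lemma scale_single: "scale c (Poly_Mapping.single x d) = Poly_Mapping.single x (c * d)"
  by (intro poly_mapping_eqI) (simp add: lookup_single when_def)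

lemma scale_sum: "scale c (sum f A) = (\<Sum>i\<in>A. scale c (f i))"
  by (induction A rule: infinite_finite_induct) (simp_all add: scale_add)

lemma poly_mapping_scale_induct:
  fixes p :: "'x \<Rightarrow>\<^sub>0 'k::field"
  assumes "P 0" "\<And>x. P (Poly_Mapping.single x 1)" "\<And>c p. P p \<Longrightarrow> P (scale c p)"
    and "\<And>p p'. P p \<Longrightarrow> P p' \<Longrightarrow> P (p + p')"
  shows "P p"
proof (induction p rule: update_induct)
  case (update p x c)
  then have "Poly_Mapping.update x c p = scale c (Poly_Mapping.single x 1) + p"
    by (intro poly_mapping_eqI)
       (auto simp: lookup_update lookup_add lookup_single in_keys_iff when_def)
  with update assms show ?case
    by simp
qed (rule assms)

definition linear_ext :: "('x \<Rightarrow> 'y \<Rightarrow>\<^sub>0 'k) \<Rightarrow> ('x \<Rightarrow>\<^sub>0 'k::field) \<Rightarrow> ('y \<Rightarrow>\<^sub>0 'k)" where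
  "linear_ext m p = (\<Sum>x\<in>Poly_Mapping.keys p. scale (Poly_Mapping.lookup p x) (m x))"

lemma linear_ext_zero [simp]: "linear_ext m 0 = 0"
  by (simp add: linear_ext_def)

lemma linear_ext_add: "linear_ext m (p + p') = linear_ext m p + linear_ext m p'"
  unfolding linear_ext_def by (rule setsum_keys_plus_distrib) (simp_all add: scale_add_left)

lemma linear_ext_single [simp]: "linear_ext m (Poly_Mapping.single x c) = scale c (m x)"
  by (simp add: linear_ext_def)

lemma linear_ext_scale: "linear_ext m (scale c p) = scale c (linear_ext m p)"
proof (cases "c = 0")
  case False
  then have "Poly_Mapping.keys (scale c p) = Poly_Mapping.keys p"
    by (auto simp: in_keys_iff)
  then show ?thesis
    by (simp add: linear_ext_def scale_sum scale_scale)
qed simp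

lemma linear_ext_unique:
  assumes "f 0 = 0" "\<And>x. f (Poly_Mapping.single x 1) = m x" "\<And>c p. f (scale c p) = scale c (f p)"
    and "\<And>p p'. f (p + p') = f p + f p'"
  shows "linear_ext m p = f p"
  by (induction p rule: poly_mapping_scale_induct)
     (simp_all add: assms linear_ext_add linear_ext_scale)

text \<open>Endomorphisms, encoded by the images of the basis vectors, form a ring type in which the
  scalars are central, since all its elements are linear.\<close>

typedef (overloaded) ('x, 'k) endo = "UNIV :: ('x \<Rightarrow> ('x \<Rightarrow>\<^sub>0 'k::zero)) set"
  morphisms col Endo by simp

lemma col_Endo [simp]: "col (Endo f) = f"
  by (simp add: Endo_inverse)

definition app :: "('x, 'k::field) endo \<Rightarrow> ('x \<Rightarrow>\<^sub>0 'k) \<Rightarrow> ('x \<Rightarrow>\<^sub>0 'k)" where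
  "app a = linear_ext (col a)"

lemma app_zero_right [simp]: "app a 0 = 0"
  and app_add_right: "app a (p + p') = app a p + app a p'"
  and app_scale: "app a (scale c p) = scale c (app a p)"
  and app_single: "app a (Poly_Mapping.single x c) = scale c (col a x)"
  by (simp_all add: app_def linear_ext_add linear_ext_scale)

lemma app_diff_right: "app a (p - p') = app a p - app a p'"
  using app_add_right[of a "p - p'" p'] by simp

lemma app_sum_right: "app a (sum f A) = (\<Sum>i\<in>A. app a (f i))"
  by (induction A rule: infinite_finite_induct) (simp_all add: app_add_right)

lemma endo_eqI:
  assumes "\<And>x. app a (Poly_Mapping.single x 1) = app b (Poly_Mapping.single x 1)" shows "a = b"
  using assms by (intro col_inject[THEN iffD1] ext) (simp add: app_single)

lemma app_Endo_unique:
  assumes "f 0 = 0" "\<And>c p. f (scale c p) = scale c (f p)" "\<And>p p'. f (p + p') = f p + f p'"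
  shows "app (Endo (\<lambda>x. f (Poly_Mapping.single x 1))) p = f p"
  unfolding app_def using linear_ext_unique[of f] assms by simp

instantiation endo :: (type, field) ring_1
begin

definition "0 = Endo (\<lambda>x. 0)"
definition "1 = Endo (\<lambda>x. Poly_Mapping.single x 1)"
definition "a + b = Endo (\<lambda>x. col a x + col b x)"
definition "a - b = Endo (\<lambda>x. col a x - col b x)"
definition "- a = Endo (\<lambda>x. - col a x)"
definition "a * b = Endo (\<lambda>x. app a (col b x))"

lemma app_zero [simp]: "app 0 p = (0 :: 'a \<Rightarrow>\<^sub>0 'b)"
  unfolding app_def by (rule linear_ext_unique) (simp_all add: zero_endo_def)

lemma app_one [simp]: "app 1 p = (p :: 'a \<Rightarrow>\<^sub>0 'b)"
  unfolding app_def by (rule linear_ext_unique) (simp_all add: one_endo_def)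

lemma app_add: "app (a + b) p = app a p + app b (p :: 'a \<Rightarrow>\<^sub>0 'b)"
proof -
  have "linear_ext (col (a + b)) p = app a p + app b p"
    by (rule linear_ext_unique)
       (simp_all add: plus_endo_def app_add_right app_scale scale_add app_single)
  then show ?thesis by (simp add: app_def)
qed

lemma app_diff: "app (a - b) p = app a p - app b (p :: 'a \<Rightarrow>\<^sub>0 'b)"
proof -
  have "linear_ext (col (a - b)) p = app a p - app b p"
    by (rule linear_ext_unique)
       (simp_all add: minus_endo_def app_add_right app_scale scale_diff app_single)
  then show ?thesis by (simp add: app_def)
qed

lemma app_mult: "app (a * b) p = app a (app b (p :: 'a \<Rightarrow>\<^sub>0 'b))"
proof -
  have "linear_ext (col (a * b)) p = app a (app b p)"
    by (rule linear_ext_unique)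
       (simp_all add: times_endo_def app_add_right app_scale app_single)
  then show ?thesis by (simp add: app_def)
qed

instance
proof
  fix a b c :: "('a, 'b) endo"
  show "a * b * c = a * (b * c)"
    by (rule endo_eqI) (simp add: app_mult)
  show "(a + b) * c = a * c + b * c"
    by (rule endo_eqI) (simp add: app_mult app_add)
  show "a * (b + c) = a * b + a * c"
    by (rule endo_eqI) (simp add: app_mult app_add app_add_right)
  show "1 * a = a" "a * 1 = a"
    by (rule endo_eqI, simp add: app_mult)+
  show "a + b + c = a + (b + c)" "a + b = b + a" "0 + a = a"
    by (rule endo_eqI, simp add: app_add algebra_simps)+
  show "- a + a = 0" "a - b = a + - b"
    by (simp_all add: plus_endo_def zero_endo_def uminus_endo_def minus_endo_def)
  have "app (0 :: ('a, 'b) endo) (Poly_Mapping.single undefined 1) \<noteq>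
    app 1 (Poly_Mapping.single undefined 1)"
    by (metis app_one app_zero lookup_single_eq lookup_zero zero_neq_one)
  then show "(0 :: ('a, 'b) endo) \<noteq> 1"
    by metis
qed

end

lemma app_sum: "app (sum f A) p = (\<Sum>i\<in>A. app (f i) p)"
  by (induction A rule: infinite_finite_induct) (simp_all add: app_add)

definition endo_scalar :: "'k::field \<Rightarrow> ('x, 'k) endo" where
  "endo_scalar c = Endo (\<lambda>x. Poly_Mapping.single x c)"

lemma app_endo_scalar [simp]: "app (endo_scalar c) p = scale c (p :: 'x \<Rightarrow>\<^sub>0 'k::field)"
proof -
  have "endo_scalar c = Endo (\<lambda>x::'x. scale c (Poly_Mapping.single x 1))"
    by (simp add: endo_scalar_def scale_single)
  then show ?thesis
    using app_Endo_unique[of "scale c" p] by (simp add: scale_add scale_scale mult.commute)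
qed

text \<open>A common interface for the scalars of a free algebra and of an endomorphism ring, so
  that evaluation and its compatibilities are proved once.\<close>

locale scalars =
  fixes sc :: "'k::field \<Rightarrow> 'r::ring_1"
  assumes sc_add: "sc (c + d) = sc c + sc d" and sc_mult: "sc (c * d) = sc c * sc d"
    and sc_one: "sc 1 = 1" and sc_comm: "x * sc c = sc c * x"
begin

lemma sc_zero [simp]: "sc 0 = 0"
  using sc_add[of 0 0] by simp

lemma sc_minus: "sc (- c) = - sc c"
  using sc_add[of c "- c"] by (simp add: eq_neg_iff_add_eq_0 add.commute)

lemma sc_diff: "sc (c - d) = sc c - sc d"
  using sc_add[of c "- d"] by (simp add: sc_minus)

lemma sc_central_unit: "c \<noteq> 0 \<Longrightarrow> central_unit (sc c) (sc (inverse c))"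
  by unfold_locales (rule sc_comm sc_comm | simp add: sc_one flip: sc_mult)+

end

interpretation endo: scalars "endo_scalar :: 'k::field \<Rightarrow> ('x, 'k) endo"
proof
  fix c d :: 'k and x :: "('x, 'k) endo"
  show "endo_scalar (c + d) = endo_scalar c + (endo_scalar d :: ('x, 'k) endo)"
    by (rule endo_eqI) (simp add: app_add scale_add_left)
  show "endo_scalar (c * d) = endo_scalar c * (endo_scalar d :: ('x, 'k) endo)"
    by (rule endo_eqI) (simp add: app_mult scale_scale)
  show "endo_scalar 1 = (1 :: ('x, 'k) endo)"
    by (rule endo_eqI) simp
  show "x * endo_scalar c = endo_scalar c * x"
    by (rule endo_eqI) (simp add: app_mult app_scale)
qed

lemma const_eq_scale: "const c * p = scale c (p :: ('g, 'k::field) ncpoly)"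
  unfolding const_def scale_def by (simp add: mult_map_scale_conv_mult)

lemma scale_mult_left: "scale c p * r = scale c (p * (r :: ('g, 'k::field) ncpoly))"
  by (simp add: mult.assoc flip: const_eq_scale)

lemma const_comm: "p * const c = const c * (p :: ('g, 'k::field) ncpoly)"
proof (induction p rule: poly_mapping_scale_induct)
  case (2 w)
  show ?case
    by (simp add: const_def mult_single)
next
  case (3 d p)
  then show ?case
    by (simp add: scale_mult_left) (simp add: const_eq_scale scale_scale mult.commute[of c])
qed (simp_all add: distrib_left distrib_right)

interpretation const: scalars "const :: 'k::field \<Rightarrow> ('g, 'k) ncpoly"
proof
  show "p * const c = const c * p" for p :: "('g, 'k) ncpoly" and c
    by (rule const_comm)
qed (simp_all add: const_def single_add mult_single)

lemma scale_mult_right: "p * scale c r = scale c (p * (r :: ('g, 'k::field) ncpoly))"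
proof -
  have "p * (const c * r) = const c * (p * r)"
    by (metis const_comm mult.assoc)
  then show ?thesis
    by (simp add: const_eq_scale)
qed

definition monom :: "'g list \<Rightarrow> ('g, 'k::field) ncpoly" where
  "monom w = Poly_Mapping.single (Word w) 1"

lemma monom_Nil: "monom [] = 1"
  by (simp add: monom_def flip: zero_word_def)

lemma monom_Cons: "monom (g # w) = gen g * monom w"
  by (simp add: monom_def gen_def mult_single plus_word_def)

lemma monom_letters: "Poly_Mapping.single w 1 = monom (letters w)"
  by (simp add: monom_def)

lemma ncpoly_induct [case_names one gen scale add]:
  fixes p :: "('g, 'k::field) ncpoly"
  assumes one: "P 1" and gen: "\<And>g p. P p \<Longrightarrow> P (gen g * p)" 
    and scale: "\<And>c p. P p \<Longrightarrow> P (scale c p)" and add: "\<And>p p'. P p \<Longrightarrow> P p' \<Longrightarrow> P (p + p')"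
  shows "P p"
proof (induction p rule: poly_mapping_scale_induct)
  case (2 w)
  have "P (monom v)" for v
    by (induction v) (simp_all add: monom_Nil monom_Cons one gen)
  then show ?case
    by (simp add: monom_letters)
qed (use scale[OF one, of 0] scale add in auto)

context scalars
begin

text \<open>The universal property of the free algebra: the homomorphism that sends each generator
  to the given ring element.\<close>

definition subst :: "('g \<Rightarrow> 'r) \<Rightarrow> ('g, 'k) ncpoly \<Rightarrow> 'r" where
  "subst g p = (\<Sum>w\<in>Poly_Mapping.keys p. sc (Poly_Mapping.lookup p w) * prod_list (map g (letters w)))"

lemma subst_zero [simp]: "subst g 0 = 0"
  by (simp add: subst_def)

lemma subst_monom: "subst g (monom w) = prod_list (map g w)"
  by (simp add: subst_def monom_def sc_one)

lemma subst_one [simp]: "subst g 1 = 1"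
  using subst_monom[of g "[]"] by (simp add: monom_Nil)

lemma subst_gen [simp]: "subst g (gen x) = g x"
  using subst_monom[of g "[x]"] by (simp add: monom_def gen_def)

lemma subst_add: "subst g (p + p') = subst g p + subst g p'"
  unfolding subst_def by (rule setsum_keys_plus_distrib) (simp_all add: sc_add distrib_right)

lemma subst_minus: "subst g (- p) = - subst g p"
  using subst_add[of g p "- p"] by (simp add: eq_neg_iff_add_eq_0 add.commute)

lemma subst_diff: "subst g (p - p') = subst g p - subst g p'"
  using subst_add[of g p "- p'"] by (simp add: subst_minus)

lemma subst_scale: "subst g (scale c p) = sc c * subst g p"
proof (cases "c = 0")
  case False
  then have "Poly_Mapping.keys (scale c p) = Poly_Mapping.keys p"
    by (auto simp: in_keys_iff)
  then show ?thesis
    by (simp add: subst_def sc_mult sum_distrib_left mult.assoc)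
qed simp

lemma subst_const [simp]: "subst g (const c) = sc c"
  using subst_scale[of g c 1] by (simp flip: const_eq_scale)

lemma subst_gen_mult: "subst g (gen x * p) = g x * subst g p"
proof (induction p rule: poly_mapping_scale_induct)
  case (2 w)
  then show ?case
    by (simp add: monom_letters subst_monom flip: monom_Cons)
next
  case (3 c p)
  then show ?case
    by (simp add: scale_mult_right subst_scale sc_comm[of "g x"] flip: mult.assoc)
qed (simp_all add: subst_add distrib_left)

lemma subst_mult [simp]: "subst g (p * p') = subst g p * subst g p'"
  by (induction p rule: ncpoly_induct)
     (simp_all add: subst_gen_mult scale_mult_left subst_scale subst_add distrib_right mult.assoc)

lemma subst_power: "subst g (p ^ n) = subst g p ^ n"
  by (induction n) simp_all

lemma subst_prod_list: "subst g (prod_list ps) = prod_list (map (subst g) ps)"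
  by (induction ps) simp_all

end

definition left_mult :: "('g, 'k::field) ncpoly \<Rightarrow> ('g word, 'k) endo" where
  "left_mult p = Endo (\<lambda>w. p * Poly_Mapping.single w 1)"

lemma app_left_mult [simp]: "app (left_mult p) r = p * r"
  unfolding left_mult_def by (rule app_Endo_unique) (simp_all add: scale_mult_right distrib_left)

text \<open>Induction over words: operators that obey the same recursion under left multiplication
  by a generator are determined by their value at 1.\<close>

lemma endo_word_eqI:
  fixes a :: "('g word, 'k::field) endo"
  assumes "app a 1 = app b 1" "\<And>g p. app a p = app b p \<Longrightarrow> app a (gen g * p) = app b (gen g * p)"
  shows "a = b"
proof -
  have "app a p = app b p" for p
    by (induction p rule: ncpoly_induct) (simp_all add: assms app_scale app_add_right)
  then show ?thesis
    by (blast intro: endo_eqI)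
qed

lemma app_subst_left_mult [simp]: "app (endo.subst (\<lambda>g. left_mult (gen g)) p) r = p * r"
  by (induction p rule: ncpoly_induct)
     (simp_all add: app_mult app_add endo.subst_scale endo.subst_add scale_mult_left distrib_right mult.assoc)

section \<open>The action on ordered monomials\<close>

text \<open>The quantum integer [n] for the parameter q^2.\<close>

definition qint :: "'k::field \<Rightarrow> int \<Rightarrow> 'k" where
  "qint q n = (q powi (2 * n) - q powi (- 2 * n)) / (q powi 2 - q powi - 2)"

text \<open>Replaces one factor x_{s,i} by x_{s,j}; for i = s it creates a factor x_{s,j} at the
  expense of the diagonal entry. Integer entries keep subtraction exact, so that transfers commute
  without side conditions.\<close>

definition transfer :: "nat \<Rightarrow> nat \<Rightarrow> nat \<Rightarrow> (nat \<Rightarrow> nat \<Rightarrow> int) \<Rightarrow> (nat \<Rightarrow> nat \<Rightarrow> int)" where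
  "transfer s i j \<alpha> a b =
     \<alpha> a b + (if a = s then (if b = j then 1 else 0) - (if b = i then 1 else 0) else 0)"

lemma transfer_commute: "transfer s i j (transfer s' i' j' \<alpha>) = transfer s' i' j' (transfer s i j \<alpha>)"
  by (intro ext) (simp add: transfer_def)

locale quantum_parameter =
  fixes q :: "'k::field"
  assumes q_nz: "q \<noteq> 0" and q8: "q ^ 8 \<noteq> 1"
begin

definition B where "B = q * q + inverse (q * q)"

lemma q4: "q ^ 4 \<noteq> 1" and q4': "q ^ 4 \<noteq> - 1"
proof -
  have "q ^ 8 = q ^ 4 * q ^ 4"
    by (simp flip: power_add)
  with q8 show "q ^ 4 \<noteq> 1" "q ^ 4 \<noteq> - 1"
    by (metis mult_1 mult_minus1 minus_minus)+
qed

lemma B_nz: "B \<noteq> 0"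
proof
  assume "B = 0"
  then have "q * q * B = 0" by simp
  then have "q ^ 4 + 1 = 0"
    using q_nz by (simp add: B_def algebra_simps power4_eq_xxxx)
  with q4' show False
    by (simp add: eq_neg_iff_add_eq_0)
qed

lemma denom_nz: "q powi 2 - q powi - 2 \<noteq> 0"
proof
  assume "q powi 2 - q powi - 2 = 0"
  then have "q * q * (q powi 2 - q powi - 2) = 0" by simp
  then have "q ^ 4 = 1"
    using q_nz by (simp add: power_int_minus power2_eq_square algebra_simps power4_eq_xxxx)
  with q4 show False by simp
qed

lemma qint_0 [simp]: "qint q 0 = 0"
  by (simp add: qint_def)

lemma qint_1 [simp]: "qint q 1 = 1"
  using denom_nz by (simp add: qint_def)

lemma qint_recurrence: "qint q n + qint q (n + 2) = B * qint q (n + 1)"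
proof -
  define u where "u = q powi (2 * n)"
  have p: "q powi (2 * (n + 2)) = u * q ^ 4" "q powi (2 * (n + 1)) = u * q ^ 2"
    using q_nz by (simp_all add: u_def distrib_left power_int_add)
  have m: "q powi (- 2 * k) = inverse (q powi (2 * k))" for k
    using power_int_minus[of q "2 * k"] by simp
  \<comment> \<open>With names for the inverses the claim becomes a polynomial identity whose only
    side condition is q q (r r) = 1.\<close>
  define v r where "v = inverse u" and "r = inverse q"
  have "q * r = 1"
    using q_nz by (simp add: r_def)
  moreover have "q * q * (r * r) = (q * r) * (q * r)"
    by (simp only: ac_simps)
  ultimately have "q * q * (r * r) = 1"
    by simp
  moreover have "(q * q + r * r) * (u * q ^ 2 - v * r ^ 2) =
      u * q ^ 4 - v * r ^ 4 + (u - v) * (q * q * (r * r))"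
    by (simp add: algebra_simps power2_eq_square power4_eq_xxxx)
  ultimately have "u - v + (u * q ^ 4 - v * r ^ 4) = (q * q + r * r) * (u * q ^ 2 - v * r ^ 2)"
    by simp
  then have "u - inverse u + (u * q ^ 4 - inverse (u * q ^ 4)) = B * (u * q ^ 2 - inverse (u * q ^ 2))"
    by (simp add: B_def v_def r_def power_inverse)
  moreover define d where "d = q powi 2 - q powi - 2"
  moreover have "qint q n = (u - inverse u) / d" "qint q (n + 1) = (u * q ^ 2 - inverse (u * q ^ 2)) / d"
    "qint q (n + 2) = (u * q ^ 4 - inverse (u * q ^ 4)) / d"
    unfolding qint_def m d_def by (simp_all only: p u_def)
  ultimately show ?thesis
    by (simp only: add_divide_distrib[symmetric] times_divide_eq_right)
qed

text \<open>The label \<open>\<alpha>\<close> stands for the ordered monomial with exponents \<open>\<alpha> s j\<close>, \<open>s < j\<close>; the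
  diagonal entries only record row sums. Left multiplication by \<open>x\<^bsub>i,i+1\<^esub>\<close> passes the rows
  \<open>0, \<dots>, s - 1\<close> and then turns one factor \<open>x\<^bsub>s,i\<^esub>\<close> of row \<open>s\<close> into \<open>x\<^bsub>s,i+1\<^esub>\<close>, or
  is absorbed into row \<open>s = i\<close>. Labels with negative entries do no harm.\<close>

definition weight :: "nat \<Rightarrow> nat \<Rightarrow> (nat \<Rightarrow> nat \<Rightarrow> int) \<Rightarrow> int" where
  "weight i s \<alpha> = (\<Sum>r<s. \<alpha> r i - \<alpha> r (Suc i))"

text \<open>Moving x_{i,i+1} through n factors x_{s,i}, the crossing after k of them leaves -q
  x_{s,i+1} with the factor q^(2k), and sorting this past the remaining n - 1 - k factors costs
  q^(-2(n-1-k)). Summed over k, the powers give [n].\<close>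

definition row_coeff :: "nat \<Rightarrow> nat \<Rightarrow> (nat \<Rightarrow> nat \<Rightarrow> int) \<Rightarrow> 'k" where
  "row_coeff i s \<alpha> = (if s < i then - q * qint q (\<alpha> s i) else if s = i then 1 else 0)"

definition row_op :: "nat \<Rightarrow> nat \<Rightarrow> (nat \<Rightarrow> nat \<Rightarrow> int, 'k) endo" where
  "row_op i s = Endo (\<lambda>\<alpha>. Poly_Mapping.single (transfer s i (Suc i) \<alpha>)
     (q powi (2 * weight i s \<alpha>) * row_coeff i s \<alpha>))"

definition E_upto :: "nat \<Rightarrow> nat \<Rightarrow> (nat \<Rightarrow> nat \<Rightarrow> int, 'k) endo" where
  "E_upto m i = (\<Sum>s<m. row_op i s)"

definition E_op :: "nat \<Rightarrow> (nat \<Rightarrow> nat \<Rightarrow> int, 'k) endo" where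
  "E_op i = E_upto (Suc i) i"

section \<open>Serre relations for the row operators\<close>

lemma app_row_op:
  "app (row_op i s) (Poly_Mapping.single \<alpha> c) =
     Poly_Mapping.single (transfer s i (Suc i) \<alpha>) (c * (q powi (2 * weight i s \<alpha>) * row_coeff i s \<alpha>))"
  by (simp add: row_op_def app_single scale_single)

lemma row_op_zero: "i < s \<Longrightarrow> row_op i s = 0"
  by (rule endo_eqI) (simp add: app_row_op row_coeff_def)

lemma E_op_eq: "i < m \<Longrightarrow> E_op i = E_upto m i"
  unfolding E_op_def E_upto_def by (rule sum.mono_neutral_left) (auto simp: row_op_zero)

lemma weight_transfer_below: 
  "s < m \<Longrightarrow> weight i m (transfer s a b \<alpha>) = weight i m \<alpha> 
    + (if b = i then 1 else 0) - (if a = i then 1 else 0)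
    - (if b = Suc i then 1 else 0) + (if a = Suc i then 1 else 0)"
proof -
  assume "s < m"
  have "weight i m (transfer s a b \<alpha>) = weight i m \<alpha> + (\<Sum>r<m. if r = s then  
    (if b = i then 1 else 0) - (if a = i then 1 else 0)
    - (if b = Suc i then 1 else 0) + (if a = Suc i then 1 else 0) else 0)"
    unfolding weight_def sum.distrib[symmetric] 
    by (intro sum.cong refl) (auto simp: transfer_def)
  with \<open>s < m\<close> show ?thesis
    by simp
qed

lemma weight_transfer_above: "m \<le> s \<Longrightarrow> weight i m (transfer s a b \<alpha>) = weight i m \<alpha>"
  unfolding weight_def by (intro sum.cong refl) (auto simp: transfer_def)

lemma row_coeff_transfer: "s \<noteq> r \<Longrightarrow> row_coeff i s (transfer r a b \<alpha>) = row_coeff i s \<alpha>"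
  by (auto simp: row_coeff_def transfer_def)

text \<open>The operator of row m sees the change in the earlier row s only through its weight; one
  factor moved from column j to j + 1 shifts that weight by minus the Cartan entry of i and
  j.\<close>

lemma row_op_qcommute:
  assumes "s < m"
  shows "row_op i m * row_op j s =
    endo_scalar (if i = j then inverse (q * q) * inverse (q * q) else if i = Suc j \<or> j = Suc i then q * q else 1)
     * (row_op j s * row_op i m)"
proof (rule endo_eqI)
  fix \<alpha> :: "nat \<Rightarrow> nat \<Rightarrow> int"
  have "q powi (2 * weight i m (transfer s j (Suc j) \<alpha>)) = q powi (2 * weight i m \<alpha>) *
    (if i = j then inverse (q * q) * inverse (q * q) else if i = Suc j \<or> j = Suc i then q * q else 1)"
    using q_nz assms by (auto simp: weight_transfer_below power_int_add power_int_diff power_int_minus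
        distrib_left right_diff_distrib power2_eq_square field_simps eval_nat_numeral)
  then show "app (row_op i m * row_op j s) (Poly_Mapping.single \<alpha> 1) = app (endo_scalar (if i = j then inverse (q * q) * inverse (q * q) else if i = Suc j \<or> j = Suc i then q * q else 1)
     * (row_op j s * row_op i m)) (Poly_Mapping.single \<alpha> 1)"
    using assms by (simp add: app_mult app_row_op scale_single transfer_commute[of m]
        weight_transfer_above row_coeff_transfer ac_simps)
qed

text \<open>The column max i j is raised by the operator with the smaller index and lowered by the
  other. Up to a common factor the three words therefore evaluate \<open>qint\<close> at three
  consecutive integers.\<close>

lemma row_coeff_serre:
  assumes "i = Suc j \<or> j = Suc i" "s \<le> i" "s \<le> j"
  defines "Ti \<equiv> transfer s i (Suc i)" and "Tj \<equiv> transfer s j (Suc j)"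
  shows "row_coeff j s \<alpha> * row_coeff i s (Tj \<alpha>) * row_coeff i s (Ti (Tj \<alpha>))
    - B * (row_coeff i s \<alpha> * row_coeff j s (Ti \<alpha>) * row_coeff i s (Tj (Ti \<alpha>)))
    + row_coeff i s \<alpha> * row_coeff i s (Ti \<alpha>) * row_coeff j s (Ti (Ti \<alpha>)) = 0" (is "?lhs = 0")
  using assms(1)
proof
  assume i: "i = Suc j"
  define n where "n = \<alpha> s i"
  define c where "c = row_coeff j s \<alpha>"
  have "row_coeff j s (Ti \<alpha>) = c" "row_coeff j s (Ti (Ti \<alpha>)) = c"
    "row_coeff i s \<alpha> = - q * qint q n" "row_coeff i s (Tj \<alpha>) = - q * qint q (n + 1)"
    "row_coeff i s (Ti \<alpha>) = - q * qint q (n - 1)"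
    "row_coeff i s (Ti (Tj \<alpha>)) = - q * qint q n" "row_coeff i s (Tj (Ti \<alpha>)) = - q * qint q n"
    using assms i by (simp_all add: row_coeff_def transfer_def n_def c_def)
  then have "?lhs = c * q * q * qint q n * (qint q (n - 1) + qint q (n + 1) - B * qint q n)"
    unfolding c_def[symmetric] by (simp add: algebra_simps)
  then show ?thesis
    using qint_recurrence[of "n - 1"] by (simp add: add.commute)
next
  assume j: "j = Suc i"
  define n where "n = \<alpha> s j"
  define c d where "c = row_coeff i s \<alpha>" and "d = row_coeff i s (Ti \<alpha>)"
  have "row_coeff i s (Tj \<alpha>) = c" "row_coeff i s (Ti (Tj \<alpha>)) = d" "row_coeff i s (Tj (Ti \<alpha>)) = d"
    "row_coeff j s \<alpha> = - q * qint q n" "row_coeff j s (Ti \<alpha>) = - q * qint q (n + 1)"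
    "row_coeff j s (Ti (Ti \<alpha>)) = - q * qint q (n + 2)"
    using assms j by (auto simp add: row_coeff_def transfer_def n_def c_def d_def add.commute)
  then have "?lhs = - q * c * d * (qint q n + qint q (n + 2) - B * qint q (n + 1))"
    unfolding c_def[symmetric] d_def[symmetric] by (simp add: algebra_simps)
  then show ?thesis
    using qint_recurrence[of n] by simp
qed

text \<open>All three words lead to the same label, and weights are unaffected because they look
  only at rows before s. The relation is thus a scalar one, \<open>row_coeff_serre\<close>.\<close>

lemma row_serre:
  assumes "i = Suc j \<or> j = Suc i"
  shows "serre_poly (endo_scalar B) (row_op i s) (row_op j s) = 0"
proof (cases "i < s \<or> j < s")
  case True
  then show ?thesis
    by (auto simp: row_op_zero serre_poly_def)
next
  case False
  show ?thesis
  proof (rule endo_eqI)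
    fix \<alpha> :: "nat \<Rightarrow> nat \<Rightarrow> int"
    define u where "u = q powi (2 * weight i s \<alpha>) * q powi (2 * weight i s \<alpha>) * q powi (2 * weight j s \<alpha>)"
    define Ti Tj where "Ti = transfer s i (Suc i)" and "Tj = transfer s j (Suc j)"
    define l where "l = Ti (Ti (Tj \<alpha>))"
    have "weight k s (Ti \<beta>) = weight k s \<beta>" "weight k s (Tj \<beta>) = weight k s \<beta>" for k \<beta>
      by (simp_all add: Ti_def Tj_def weight_transfer_above)
    moreover have "Ti (Tj (Ti \<alpha>)) = l" "Tj (Ti (Ti \<alpha>)) = l"
      by (simp_all add: l_def Ti_def Tj_def transfer_commute[of s j])
    ultimately have "app (serre_poly (endo_scalar B) (row_op i s) (row_op j s)) (Poly_Mapping.single \<alpha> 1) =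
      Poly_Mapping.single l (u *
       (row_coeff j s \<alpha> * row_coeff i s (Tj \<alpha>) * row_coeff i s (Ti (Tj \<alpha>))
       - B * (row_coeff i s \<alpha> * row_coeff j s (Ti \<alpha>) * row_coeff i s (Tj (Ti \<alpha>)))
       + row_coeff i s \<alpha> * row_coeff i s (Ti \<alpha>) * row_coeff j s (Ti (Ti \<alpha>))))"
      by (simp add: serre_poly_def app_mult app_add app_diff app_row_op scale_single weight_transfer_above
          distrib_left right_diff_distrib single_add single_diff mult_ac
          flip: Ti_def Tj_def l_def) (simp add: u_def mult_ac)
    moreover note row_coeff_serre[of i j s \<alpha>]
    ultimately show "app (serre_poly (endo_scalar B) (row_op i s) (row_op j s)) (Poly_Mapping.single \<alpha> 1) =
      app 0 (Poly_Mapping.single \<alpha> 1)"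
      using assms False by (simp add: Ti_def Tj_def not_less)
  qed
qed

lemma central: "central_unit (endo_scalar (q * q)) (endo_scalar (inverse (q * q)))"
  using q_nz by (intro endo.sc_central_unit) simp

lemma endo_scalar_B: "endo_scalar B = endo_scalar (q * q) + endo_scalar (inverse (q * q))"
  by (simp add: B_def endo.sc_add)

text \<open>Induction over the rows: adjoining row m is the situation of
  \<open>serre_poly_sum\<close>, with the exchange rules supplied by
  \<open>row_op_qcommute\<close>.\<close>

lemma E_upto_serre:
  assumes "i = Suc j \<or> j = Suc i"
  shows "serre_poly (endo_scalar B) (E_upto m i) (E_upto m j) = 0"
proof (induction m)
  case (Suc m)
  have s: "row_op i m * E_upto m k = endo_scalar c * (E_upto m k * row_op i m)"
    if "\<And>s. s < m \<Longrightarrow> row_op i m * row_op k s = endo_scalar c * (row_op k s * row_op i m)" for i k c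
    unfolding E_upto_def sum_distrib_left sum_distrib_right by (intro sum.cong refl that) simp
  have u: "E_upto (Suc m) k = E_upto m k + row_op k m" for k
    by (simp add: E_upto_def)
  have "row_op i m * E_upto m i = endo_scalar (inverse (q * q) * inverse (q * q)) * (E_upto m i * row_op i m)"
    by (rule s) (subst row_op_qcommute, auto)
  moreover have "row_op i m * E_upto m j = endo_scalar (q * q) * (E_upto m j * row_op i m)"
    by (rule s) (subst row_op_qcommute, use assms in auto)
  moreover have "row_op j m * E_upto m i = endo_scalar (q * q) * (E_upto m i * row_op j m)"
    by (rule s) (subst row_op_qcommute, use assms in auto)
  ultimately have "serre_poly (endo_scalar B) (E_upto m i + row_op i m) (E_upto m j + row_op j m) = 0"
    using Suc row_serre[OF assms, of m] central_unit.serre_poly_sum[OF central]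
    unfolding endo_scalar_B endo.sc_mult by blast
  then show ?case
    by (simp only: u)
qed (simp add: E_upto_def serre_poly_def)

lemma E_op_serre:
  assumes "i = Suc j \<or> j = Suc i"
  shows "serre_poly (endo_scalar B) (E_op i) (E_op j) = 0"
  using E_upto_serre[OF assms, of "Suc (max i j)"]
  by (simp add: E_op_eq[of i "Suc (max i j)"] E_op_eq[of j "Suc (max i j)"])

lemma row_op_commute:
  assumes "Suc i < j" shows "row_op i r * row_op j s = row_op j s * row_op i r"
proof (cases r s rule: linorder_cases)
  case equal
  then show ?thesis
    using assms by (intro endo_eqI) (auto simp: app_mult app_row_op weight_transfer_above 
        row_coeff_def transfer_def transfer_commute[of s j] mult_ac)
qed (use assms row_op_qcommute[of r s] row_op_qcommute[of s r] in \<open>auto simp: endo.sc_one\<close>)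

lemma E_op_commute: assumes "Suc i < j" shows "E_op i * E_op j = E_op j * E_op i"
proof -
  have "E_op i * E_op j = (\<Sum>r<Suc i. \<Sum>s<Suc j. row_op j s * row_op i r)"
    unfolding E_op_def E_upto_def sum_product using assms by (intro sum.cong refl row_op_commute)
  then show ?thesis
    unfolding E_op_def E_upto_def sum_product by (subst sum.swap)
qed

section \<open>Ordered monomials applied to the zero label\<close>

definition x_op :: "nat \<Rightarrow> nat \<Rightarrow> (nat \<Rightarrow> nat \<Rightarrow> int, 'k) endo" where
  "x_op i k = root_vector (endo_scalar q) (endo_scalar (inverse q)) E_op i k"

text \<open>Rows before i are empty, so their terms vanish by [0] = 0 and the weight in front of row
  i is zero. The term of row i is isolated since it alone survives in the commutator formed in
  \<open>app_x_op\<close>.\<close>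

lemma app_E_op:
  assumes "i \<le> j" "\<And>a b. a < b \<Longrightarrow> a < i \<or> a = i \<and> b < j \<Longrightarrow> \<alpha> a b = 0"
  shows "app (E_op j) (Poly_Mapping.single \<alpha> 1) =
    Poly_Mapping.single (transfer i j (Suc j) \<alpha>) (row_coeff j i \<alpha>) +
    (\<Sum>s\<in>{i<..j}. Poly_Mapping.single (transfer s j (Suc j) \<alpha>) (q powi (2 * weight j s \<alpha>) * row_coeff j s \<alpha>))"
proof -
  let ?f = "\<lambda>s. Poly_Mapping.single (transfer s j (Suc j) \<alpha>) (q powi (2 * weight j s \<alpha>) * row_coeff j s \<alpha>)"
  have "app (E_op j) (Poly_Mapping.single \<alpha> 1) = (\<Sum>s<Suc j. ?f s)"
    by (simp only: E_op_def E_upto_def app_sum app_row_op mult_1)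
  also have "{..<Suc j} = {..<i} \<union> {i..j}"
    using assms(1) by auto
  also have "sum ?f \<dots> = (\<Sum>s<i. ?f s) + (\<Sum>s\<in>{i..j}. ?f s)"
    by (rule sum.union_disjoint) auto
  also have "(\<Sum>s<i. ?f s) = 0"
    using assms by (intro sum.neutral) (simp add: row_coeff_def)
  also have "{i..j} = insert i {i<..j}"
    using assms(1) by auto
  also have "weight j i \<alpha> = 0"
    unfolding weight_def using assms by (intro sum.neutral) simp
  then have "sum ?f (insert i {i<..j}) =
      Poly_Mapping.single (transfer i j (Suc j) \<alpha>) (row_coeff j i \<alpha>) + sum ?f {i<..j}"
    by (subst sum.insert) auto
  finally show ?thesis
    by simp
qed

text \<open>If no factor before x_{i,i+k+1} is present, multiplication by it on the left is already
  in order and should just record one more factor. The operator is however defined by q-brackets,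
  whence the induction on k.\<close>

lemma app_x_op:
  assumes "\<And>a b. a < b \<Longrightarrow> a < i \<or> a = i \<and> b < Suc (i + k) \<Longrightarrow> \<alpha> a b = 0"
  shows "app (x_op i k) (Poly_Mapping.single \<alpha> 1) = Poly_Mapping.single (transfer i i (Suc (i + k)) \<alpha>) 1"
  using assms
proof (induction k arbitrary: \<alpha>)
  case 0
  have "\<alpha> a b = 0" if "a < b" "a < i \<or> a = i \<and> b < i" for a b
    using that by (intro 0) auto
  from app_E_op[OF order_refl this] show ?case
    by (simp add: x_op_def row_coeff_def)
next
  case (Suc k)
  define j where "j = Suc (i + k)"
  define T where "T = transfer i i j"
  let ?c = "\<lambda>s \<beta>. q powi (2 * weight j s \<beta>) * row_coeff j s \<beta>"
  have 0: "\<alpha> a b = 0" if "a < b" "a < i \<or> a = i \<and> b \<le> j" for a b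
    using Suc.prems[of a b] that by (auto simp: j_def)
  have x: "app (x_op i k) (Poly_Mapping.single \<beta> c) = Poly_Mapping.single (T \<beta>) c"
    if "\<And>a b. a < b \<Longrightarrow> a < i \<or> a = i \<and> b < j \<Longrightarrow> \<beta> a b = 0" for \<beta> c
    using Suc.IH[of \<beta>] that app_scale[of "x_op i k" c "Poly_Mapping.single \<beta> 1"]
    by (simp add: scale_single j_def T_def)
  \<comment> \<open>Row i contains no factor x_{i,j} yet, so its coefficient is -q [0] = 0 and only
    later rows contribute.\<close>
  have "app (E_op j) (Poly_Mapping.single \<alpha> 1) =
      (\<Sum>s\<in>{i<..j}. Poly_Mapping.single (transfer s j (Suc j) \<alpha>) (?c s \<alpha>))"
    using 0 by (subst app_E_op[of i]) (auto simp: row_coeff_def j_def)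
  then have "app (x_op i k) (app (E_op j) (Poly_Mapping.single \<alpha> 1)) =
      (\<Sum>s\<in>{i<..j}. Poly_Mapping.single (T (transfer s j (Suc j) \<alpha>)) (?c s \<alpha>))"
    using 0 by (simp add: app_sum_right) (intro sum.cong refl x, auto simp: transfer_def)
  \<comment> \<open>Row i now contains exactly one factor x_{i,j}, which turns into x_{i,j+1} with
    the coefficient -q [1] = -q, and it contributes q^2 to the weight seen by each later
    row.\<close>
  moreover have "app (E_op j) (Poly_Mapping.single (T \<alpha>) 1) =
      Poly_Mapping.single (transfer i i (Suc j) \<alpha>) (- q) +
      (\<Sum>s\<in>{i<..j}. Poly_Mapping.single (T (transfer s j (Suc j) \<alpha>)) (q * q * ?c s \<alpha>))"
  proof -
    have "transfer i j (Suc j) (T \<alpha>) = transfer i i (Suc j) \<alpha>" "row_coeff j i (T \<alpha>) = - q"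
      using 0[of i j] by (auto simp: T_def transfer_def row_coeff_def j_def fun_eq_iff)
    moreover have "?c s (T \<alpha>) = q * q * ?c s \<alpha>" if "i < s" for s
      using that q_nz by (simp add: T_def weight_transfer_below row_coeff_transfer power_int_add
          distrib_left power2_eq_square j_def)
    ultimately show ?thesis
      using 0 by (subst app_E_op[of i])
        (auto simp: T_def transfer_def transfer_commute[of i i] j_def intro!: sum.cong)
  qed
  moreover have "app (x_op i k) (Poly_Mapping.single \<alpha> 1) = Poly_Mapping.single (T \<alpha>) 1"
    using 0 by (intro x) auto
  moreover have "x_op i (Suc k) = endo_scalar q * x_op i k * E_op j - endo_scalar (inverse q) * E_op j * x_op i k"
    by (simp add: x_op_def j_def)
  \<comment> \<open>In the bracket the later rows cancel, since q = q^-1 q^2; row i leaves -q^-1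
    (-q) = 1.\<close>
  moreover have "scale q (\<Sum>s\<in>{i<..j}. Poly_Mapping.single (T (transfer s j (Suc j) \<alpha>)) (?c s \<alpha>)) =
      scale (inverse q) (\<Sum>s\<in>{i<..j}. Poly_Mapping.single (T (transfer s j (Suc j) \<alpha>)) (q * q * ?c s \<alpha>))"
    using q_nz by (simp add: scale_sum scale_single mult.assoc flip: mult.assoc[of "inverse q"])
  ultimately have "app (x_op i (Suc k)) (Poly_Mapping.single \<alpha> 1) =
      - scale (inverse q) (Poly_Mapping.single (transfer i i (Suc j) \<alpha>) (- q))"
    by (simp add: app_diff app_mult scale_add)
  with q_nz show ?case
    by (simp add: scale_single j_def flip: single_uminus)
qed

fun word_label :: "(nat \<times> nat) list \<Rightarrow> (nat \<Rightarrow> nat \<Rightarrow> int)" where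
  "word_label [] = (\<lambda>a b. 0)"
| "word_label ((i, j) # ws) = transfer i i j (word_label ws)"

lemma word_label_count:
  "a < b \<Longrightarrow> (\<And>i j. (i, j) \<in> set ws \<Longrightarrow> i < j) \<Longrightarrow> word_label ws a b = int (count_list ws (a, b))"
proof (induction ws)
  case (Cons p ws)
  then show ?case
    by (cases p) (auto simp: transfer_def)
qed simp

text \<open>Factors act from the right end of the word; by sortedness \<open>app_x_op\<close>
  applies at every stage.\<close>

lemma app_x_op_word:
  assumes "\<And>i j. (i, j) \<in> set ws \<Longrightarrow> i < j"
    and "sorted_wrt (\<lambda>(i, j) (m, n). i < m \<or> i = m \<and> j \<le> n) ws"
  shows "app (prod_list (map (\<lambda>(i, j). x_op i (j - i - 1)) ws)) (Poly_Mapping.single (\<lambda>a b. 0) 1) =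
    Poly_Mapping.single (word_label ws) 1"
  using assms
proof (induction ws)
  case (Cons p ws)
  obtain i j where p: "p = (i, j)" by fastforce
  obtain k where k: "j = Suc (i + k)"
    using Cons.prems(1)[of i j] less_imp_Suc_add p by auto
  have "word_label ws a b = 0" if "a < b" "a < i \<or> a = i \<and> b < Suc (i + k)" for a b
  proof -
    have "(a, b) \<notin> set ws"
      using Cons.prems(2) that p k by auto
    then show ?thesis
      using word_label_count[of a b ws] Cons.prems(1) that by (simp add: count_list_0_iff)
  qed
  with Cons p k show ?case
    by (simp add: app_mult app_x_op)
qed simp

end

section \<open>The Verma module\<close>

definition serre_rel :: "'r::ring_1 \<Rightarrow> (nat \<Rightarrow> 'r) \<Rightarrow> nat \<Rightarrow> nat \<Rightarrow> 'r" where
  "serre_rel b e i j =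
     (if i = Suc j \<or> j = Suc i then serre_poly b (e i) (e j) else e i * e j - e j * e i)"

lemma (in scalars) subst_serre_rel:
  "subst g (serre_rel (const b) e i j) = serre_rel (sc b) (\<lambda>i. subst g (e i)) i j"
  by (simp add: serre_rel_def serre_poly_def subst_add subst_diff)

lemma (in scalars) subst_root_vector:
  "subst g (root_vector (const a) (const b) e i k) = root_vector (sc a) (sc b) (\<lambda>i. subst g (e i)) i k"
  by (induction k) (simp_all add: subst_diff)

lemma (in scalars) subst_subst: "subst g (const.subst h p) = subst (\<lambda>x. subst g (h x)) p"
  by (induction p rule: ncpoly_induct)
     (simp_all add: subst_add const.subst_add subst_scale const.subst_scale)

lemma root_poly_eq_root_vector: "root_poly q i k = root_vector (const q) (const (inverse q)) gE i k"
  by (induction k) simp_all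

lemma left_mult_eq_subst: "left_mult p = endo.subst (\<lambda>i. left_mult (gen i)) p"
  by (rule endo_eqI) simp

context quantum_parameter
begin

text \<open>The only nontrivial coefficient is the binomial 2 over 1 at t = q^2, namely (t^2 - t^-2)
  / (t - t^-1) = t + t^-1 = \<open>B\<close>.\<close>

lemma serre_eq_serre_rel: assumes "i \<noteq> j" shows "serre q Y i j = serre_rel (const B) Y i j"
proof (cases "i = Suc j \<or> j = Suc i")
  case True
  have d: "q ^ 2 - inverse q ^ 2 \<noteq> 0"
    using denom_nz by (simp add: power_int_minus power_inverse)
  have "qbinomial (q ^ 2) 2 1 = ((q ^ 2) ^ 2 - inverse (q ^ 2) ^ 2) / (q ^ 2 - inverse (q ^ 2))"
    by (simp add: qbinomial_def power_int_minus power_inverse)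
  also have "(q ^ 2) ^ 2 - inverse (q ^ 2) ^ 2 = B * (q ^ 2 - inverse (q ^ 2))"
    by (simp add: B_def power2_eq_square algebra_simps)
  finally have b: "qbinomial (q ^ 2) 2 1 = B"
    using d by (simp add: power_inverse)
  have b': "qbinomial t n 0 = 1" "qbinomial t n n = 1" for t :: 'k and n
    by (simp_all add: qbinomial_def)
  have "cartan i j = - 1"
    using True by (auto simp: cartan_def)
  then have "serre q Y i j = Y i ^ 2 * Y j + const (- B) * Y i * Y j * Y i + Y j * Y i ^ 2"
    using b b'[of _ 2] by (simp add: serre_def eval_nat_numeral sum.atLeast0_atMost_Suc const.sc_one)
  then show ?thesis
    using True by (simp add: serre_rel_def serre_poly_def const.sc_minus power2_eq_square mult.assoc)
next
  case False
  then have "cartan i j = 0"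
    using assms by (auto simp: cartan_def)
  then show ?thesis
    using False by (simp add: serre_def serre_rel_def qbinomial_def const.sc_minus const.sc_one)
qed

text \<open>Scalars and signs can be absorbed into the left factor a, so sums of such products form
  the ideal; the inductive form lets linear statements be checked on generators.\<close>

inductive_set serre_ideal :: "(nat, 'k) ncpoly set" where
  zero: "0 \<in> serre_ideal"
| relation: "i \<noteq> j \<Longrightarrow> a * serre_rel (const B) gen i j * b \<in> serre_ideal"
| add: "x \<in> serre_ideal \<Longrightarrow> y \<in> serre_ideal \<Longrightarrow> x + y \<in> serre_ideal"

sublocale serre: two_sided_ideal serre_ideal
proof
  fix x z :: "(nat, 'k) ncpoly"
  assume "x \<in> serre_ideal"
  then show "z * x \<in> serre_ideal"
    by induction (auto simp: distrib_left intro: serre_ideal.intros, metis mult.assoc relation)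
  from \<open>x \<in> serre_ideal\<close> show "x * z \<in> serre_ideal"
    by induction (auto simp: distrib_right mult.assoc intro: serre_ideal.intros,
        metis mult.assoc relation)
qed (auto intro: serre_ideal.intros)

lemma scale_serre_ideal: "x \<in> serre_ideal \<Longrightarrow> scale c x \<in> serre_ideal"
  using serre.mult_left_mem[of x "const c"] by (simp add: const_eq_scale)

lemma subst_E_op_serre_ideal: "p \<in> serre_ideal \<Longrightarrow> endo.subst E_op p = 0"
proof (induction rule: serre_ideal.induct)
  case (relation i j a b)
  have "serre_rel (endo_scalar B) E_op i j = 0"
  proof (cases "i = Suc j \<or> j = Suc i")
    case False
    with relation have "Suc i < j \<or> Suc j < i"
      by linarith
    with False show ?thesis
      using E_op_commute[of i j] E_op_commute[of j i] by (auto simp: serre_rel_def)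
  qed (auto simp: serre_rel_def E_op_serre)
  then show ?case
    by (simp add: endo.subst_serre_rel)
qed (simp_all add: endo.subst_add)

text \<open>The algebra \<^const>\<open>Uq\<close> acts on the free algebra in the \<open>E\<^sub>i\<close> modulo its Serre ideal as on
  a lowest weight Verma module: \<open>E\<^sub>i\<close> is left multiplication, \<open>K\<^sub>i\<close> is a diagonal
  automorphism and \<open>F\<^sub>i\<close> kills the unit and is determined by its commutator with the \<open>E\<^sub>j\<close>.\<close>

definition K_aut :: "int \<Rightarrow> nat \<Rightarrow> (nat, 'k) ncpoly \<Rightarrow> (nat, 'k) ncpoly" where
  "K_aut s i = const.subst (\<lambda>j. scale (q powi (s * cartan i j)) (gen j))"

text \<open>The argument s is the exponent of K_i: the values 1 and -1 give the generators, 2 and -2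
  the squares occurring in the commutator of E_i and F_i.\<close>

definition K_op :: "int \<Rightarrow> nat \<Rightarrow> (nat word, 'k) endo" where
  "K_op s i = Endo (\<lambda>w. K_aut s i (Poly_Mapping.single w 1))"

lemma app_K_op: "app (K_op s i) p = K_aut s i p"
  unfolding K_op_def K_aut_def
  by (rule app_Endo_unique) (simp_all add: const.subst_scale const.subst_add const_eq_scale)

lemma app_K_op_one [simp]: "app (K_op s i) 1 = 1"
  by (simp add: app_K_op K_aut_def)

lemma app_K_op_gen: "app (K_op s i) (gen j * p) = scale (q powi (s * cartan i j)) (gen j * app (K_op s i) p)"
  by (simp add: app_K_op K_aut_def scale_mult_left)

lemma K_op_mult: "K_op s i * K_op t i = K_op (s + t) i"
  by (rule endo_word_eqI)
     (use q_nz in \<open>simp_all add: app_mult app_K_op_gen app_scale scale_scale distrib_right power_int_add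
        mult.commute[of "q powi (t * _)"]\<close>)

lemma K_op_0: "K_op 0 i = 1"
  by (rule endo_word_eqI) (simp_all add: app_K_op_gen)

lemma K_op_commute: "K_op s i * K_op t j = K_op t j * K_op s i"
  by (rule endo_word_eqI) (simp_all add: app_mult app_K_op_gen app_scale scale_scale mult.commute)

lemma K_op_left_mult:
  "K_op s i * left_mult (gen j) = endo_scalar (q powi (s * cartan i j)) * (left_mult (gen j) * K_op s i)"
  by (rule endo_eqI) (simp add: app_mult app_K_op_gen)

definition d where "d = 1 / (q powi 2 - q powi - 2)"

text \<open>The operator by which the commutator of E_i and F_i has to act.\<close>

definition H_op :: "nat \<Rightarrow> (nat word, 'k) endo" where
  "H_op i = endo_scalar d * (K_op 2 i - K_op (- 2) i)"

lemma K_op_H_op: "K_op s i * H_op j = H_op j * K_op s i"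
  unfolding H_op_def
  by (simp add: right_diff_distrib left_diff_distrib K_op_commute[of s i] endo.sc_comm[of "K_op s i"] mult.assoc
      flip: mult.assoc[of "K_op s i" "endo_scalar d"])

fun F_word :: "nat \<Rightarrow> nat list \<Rightarrow> (nat, 'k) ncpoly" where
  "F_word i [] = 0"
| "F_word i (j # w) = gen j * F_word i w - (if i = j then app (H_op i) (monom w) else 0)"

definition F_op :: "nat \<Rightarrow> (nat word, 'k) endo" where
  "F_op i = Endo (\<lambda>w. F_word i (letters w))"

lemma app_F_op_monom: "app (F_op i) (monom w) = F_word i w"
  by (simp add: monom_def app_single F_op_def)

lemma app_F_op_one [simp]: "app (F_op i) 1 = 0"
  using app_F_op_monom[of i "[]"] by (simp add: monom_Nil)

lemma app_F_op_gen:
  "app (F_op i) (gen j * p) = gen j * app (F_op i) p - (if i = j then app (H_op i) p else 0)"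
proof (induction p rule: poly_mapping_scale_induct)
  case (2 w)
  then show ?case
    by (simp add: monom_letters app_F_op_monom flip: monom_Cons)
qed (auto simp: scale_mult_right app_scale scale_diff app_add_right distrib_left)

lemma F_op_left_mult:
  "F_op i * left_mult (gen j) = left_mult (gen j) * F_op i - (if i = j then H_op i else 0)"
  by (rule endo_eqI) (simp add: app_mult app_diff app_F_op_gen)

lemma K_op_F_op: "K_op s i * F_op j = endo_scalar (q powi (- (s * cartan i j))) * (F_op j * K_op s i)"
proof (rule endo_word_eqI)
  fix g p
  assume "app (K_op s i * F_op j) p = app (endo_scalar (q powi (- (s * cartan i j))) * (F_op j * K_op s i)) p"
  then have IH: "app (K_op s i) (app (F_op j) p) = scale (q powi (- (s * cartan i j))) (app (F_op j) (app (K_op s i) p))"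
    by (simp add: app_mult)
  have KH: "app (K_op s i) (app (H_op j) p) = app (H_op j) (app (K_op s i) p)"
    by (metis K_op_H_op app_mult)
  have "q powi (- (s * cartan i j)) * q powi (s * cartan i j) = 1"
    using q_nz by (simp flip: power_int_add)
  then show "app (K_op s i * F_op j) (gen g * p) =
      app (endo_scalar (q powi (- (s * cartan i j))) * (F_op j * K_op s i)) (gen g * p)"
    using IH KH by (cases "j = g") (simp_all add: app_mult app_F_op_gen app_diff_right app_K_op_gen
        app_scale scale_diff scale_scale scale_mult_right mult.commute)
qed (simp add: app_mult)

section \<open>Compatibility of the operators with the Serre relations\<close>

text \<open>Stated for abstract families because it serves twice: for F_m against the Serre elements
  in the E_i and, with k and l exchanged, for E_m against those in the F_i.\<close>

lemma serre_rel_commutator: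
  fixes f x k l :: "nat \<Rightarrow> (nat word, 'k) endo"
  assumes fx: "\<And>m i. f m * x i = x i * f m - (if m = i then endo_scalar d * (k i - l i) else 0)"
    and kx: "\<And>m i. k m * x i = endo_scalar (q powi (2 * cartan m i)) * (x i * k m)"
    and lx: "\<And>m i. l m * x i = endo_scalar (q powi (- 2 * cartan m i)) * (x i * l m)"
    and "i \<noteq> j"
  shows "f m * serre_rel (endo_scalar B) x i j = serre_rel (endo_scalar B) x i j * f m"
proof (cases "i = Suc j \<or> j = Suc i")
  case True
  then have c: "cartan i j = - 1" "cartan j i = - 1" "cartan i i = 2"
    by (auto simp: cartan_def)
  note left = central_unit.serre_poly_commutator_left[OF central, folded endo_scalar_B]
  note right = central_unit.serre_poly_commutator_right[OF central, folded endo_scalar_B]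
  have w: "q powi (2 * cartan i i) = q * q * (q * q)" "q powi (- 2 * cartan i i) = inverse (q * q) * inverse (q * q)"
    "q powi (2 * cartan i j) = inverse (q * q)" "q powi (- 2 * cartan i j) = q * q"
    "q powi (2 * cartan j i) = inverse (q * q)" "q powi (- 2 * cartan j i) = q * q"
    by (simp_all add: c power_int_minus eval_nat_numeral)
  consider "m = i" | "m = j" | "m \<noteq> i" "m \<noteq> j" by blast
  then have "f m * serre_poly (endo_scalar B) (x i) (x j) = serre_poly (endo_scalar B) (x i) (x j) * f m"
  proof cases
    case 1
    show ?thesis
      unfolding 1
    proof (rule left)
      show "f i * x i = x i * f i - endo_scalar d * (k i - l i)" "f i * x j = x j * f i"
        using fx[of i i] fx[of i j] \<open>i \<noteq> j\<close> by simp_all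
      show "z * endo_scalar d = endo_scalar d * z" for z :: "(nat word, 'k) endo"
        by (rule endo.sc_comm)
    qed (simp_all only: kx lx w endo.sc_mult)
  next
    case 2
    show ?thesis
      unfolding 2
    proof (rule right)
      show "f j * x j = x j * f j - endo_scalar d * (k j - l j)" "f j * x i = x i * f j"
        using fx[of j j] fx[of j i] \<open>i \<noteq> j\<close> by simp_all
      show "z * endo_scalar d = endo_scalar d * z" for z :: "(nat word, 'k) endo"
        by (rule endo.sc_comm)
    qed (simp_all only: kx lx w)
  next
    case 3
    \<comment> \<open>The vanishing commutator is written as \<open>0 * (0 - 0)\<close> to match
      \<open>right\<close>, with all of d, k and l equal to zero.\<close>
    then have "f m * x i = x i * f m" "f m * x j = x j * f m - 0 * (0 - 0)"
      using fx[of m i] fx[of m j] by simp_all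
    then show ?thesis
      by (rule right) simp_all
  qed
  with True show ?thesis
    by (simp add: serre_rel_def)
next
  case False
  then have "cartan i j = 0" "cartan j i = 0"
    using \<open>i \<noteq> j\<close> by (auto simp: cartan_def)
  \<comment> \<open>For Cartan entry 0 the corrections produced by x i and x j commute with the
    other generator, so that they cancel in the commutator.\<close>
  then have kl: "(k i - l i) * x j = x j * (k i - l i)" "(k j - l j) * x i = x i * (k j - l j)"
    by (simp_all add: kx lx endo.sc_one left_diff_distrib right_diff_distrib)
  have scalar: "endo_scalar d * y * z = z * (endo_scalar d * y)" if "y * z = z * y" for y z :: "(nat word, 'k) endo"
    using that endo.sc_comm[of z d] by (simp add: mult.assoc flip: mult.assoc[of z])
  define g where "g n = (if m = n then endo_scalar d * (k n - l n) else 0)" for n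
  have gx: "g i * x j = x j * g i" "g j * x i = x i * g j"
    by (auto simp: g_def scalar[OF kl(1)] scalar[OF kl(2)])
  have fx': "f m * x n = x n * f m - g n" for n
    by (simp add: fx g_def)
  have fx'': "f m * (x n * z) = x n * (f m * z) - g n * z" for n z
    by (simp add: fx' left_diff_distrib flip: mult.assoc)
  have "f m * (x i * x j - x j * x i) = (x i * x j - x j * x i) * f m"
    by (simp only: right_diff_distrib left_diff_distrib fx' fx'' mult.assoc gx) simp
  with False show ?thesis
    by (simp add: serre_rel_def)
qed

text \<open>The Serre element in the F_i kills 1 and commutes with every left multiplication, hence
  kills every word. These relations hold on the free algebra even before the Serre ideal is divided
  out.\<close>

lemma serre_rel_F_op: assumes "i \<noteq> j" shows "serre_rel (endo_scalar B) F_op i j = 0"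
proof (rule endo_word_eqI)
  have comm: "left_mult (gen m) * serre_rel (endo_scalar B) F_op i j =
      serre_rel (endo_scalar B) F_op i j * left_mult (gen m)" for m
  proof (rule serre_rel_commutator[where k = "K_op (- 2)" and l = "K_op 2"])
    show "left_mult (gen m) * F_op i = F_op i * left_mult (gen m)
        - (if m = i then endo_scalar d * (K_op (- 2) i - K_op 2 i) else 0)" for m i
      using F_op_left_mult[of i m] by (auto simp: H_op_def right_diff_distrib)
  qed (simp_all add: K_op_F_op assms)
  fix g p
  assume "app (serre_rel (endo_scalar B) F_op i j) p = app 0 p"
  then show "app (serre_rel (endo_scalar B) F_op i j) (gen g * p) = app 0 (gen g * p)"
    using comm[of g] by (metis app_left_mult app_mult app_zero mult_zero_right)
qed (simp add: serre_rel_def serre_poly_def app_add app_diff app_mult)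

lemma F_op_commutes_serre_rel:
  assumes "i \<noteq> j"
  shows "app (F_op m) (serre_rel (const B) gen i j * b) = serre_rel (const B) gen i j * app (F_op m) b"
proof -
  define E where "E i = left_mult (gen i :: (nat, 'k) ncpoly)" for i
  have "F_op m * serre_rel (endo_scalar B) E i j = serre_rel (endo_scalar B) E i j * F_op m"
  proof (rule serre_rel_commutator[where k = "K_op 2" and l = "K_op (- 2)"])
    show "F_op m * E i = E i * F_op m
        - (if m = i then endo_scalar d * (K_op 2 i - K_op (- 2) i) else 0)" for m i
      by (simp add: E_def F_op_left_mult H_op_def)
  qed (simp_all add: E_def K_op_left_mult assms)
  moreover have "serre_rel (endo_scalar B) E i j = left_mult (serre_rel (const B) gen i j)"
    unfolding left_mult_eq_subst[of "serre_rel _ _ _ _"] endo.subst_serre_rel by (simp add: E_def[abs_def])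
  ultimately show ?thesis
    by (metis app_left_mult app_mult)
qed

text \<open>Serre elements are homogeneous in each generator, hence eigenvectors of the diagonal
  automorphism.\<close>

lemma K_op_serre_ideal: "p \<in> serre_ideal \<Longrightarrow> app (K_op s m) p \<in> serre_ideal"
proof (induction rule: serre_ideal.induct)
  case (relation i j a b)
  define c where "c i = q powi (s * cartan m i)" for i
  have "K_aut s m (serre_rel (const B) gen i j) = serre_rel (const B) (\<lambda>i. scale (c i) (gen i)) i j"
    by (simp add: K_aut_def const.subst_serre_rel c_def)
  also have "\<exists>e. \<dots> = scale e (serre_rel (const B) gen i j)"
  proof (cases "i = Suc j \<or> j = Suc i")
    case True
    then have "serre_rel (const B) (\<lambda>i. scale (c i) (gen i)) i j =
        scale (c i * c i * c j) (serre_rel (const B) gen i j)"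
      by (simp add: serre_rel_def serre_poly_def scale_mult_left scale_mult_right scale_scale
          scale_add scale_diff const_eq_scale mult_ac)
    then show ?thesis ..
  next
    case False
    then have "serre_rel (const B) (\<lambda>i. scale (c i) (gen i)) i j =
        scale (c i * c j) (serre_rel (const B) gen i j)"
      by (simp add: serre_rel_def scale_mult_left scale_mult_right scale_scale scale_diff mult.commute)
    then show ?thesis ..
  qed
  finally obtain e where "K_aut s m (serre_rel (const B) gen i j) = scale e (serre_rel (const B) gen i j)"
    by blast
  moreover have "K_aut s m (x * y) = K_aut s m x * K_aut s m y" for x y
    by (simp add: K_aut_def)
  ultimately have "app (K_op s m) (a * serre_rel (const B) gen i j * b) =
      scale e (K_aut s m a * serre_rel (const B) gen i j * K_aut s m b)"
    by (simp add: app_K_op scale_mult_left scale_mult_right)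
  with relation show ?case
    by (simp add: scale_serre_ideal serre_ideal.relation)
qed (simp_all add: app_add_right serre_ideal.zero serre_ideal.add)

text \<open>F_m is moved through the left factor a letter by letter. The terms with H_m stay in the
  ideal since the K operators preserve it; at a = 1 the Serre element commutes with F_m.\<close>

lemma F_op_serre_ideal: "p \<in> serre_ideal \<Longrightarrow> app (F_op m) p \<in> serre_ideal"
proof (induction rule: serre_ideal.induct)
  case (relation i j a b)
  have H: "app (H_op m) x \<in> serre_ideal" if "x \<in> serre_ideal" for x
    using that by (simp add: H_op_def app_mult app_diff scale_serre_ideal serre.diff_mem K_op_serre_ideal)
  show ?case
  proof (induction a rule: ncpoly_induct)
    case one
    then show ?case
      using serre_ideal.relation[OF relation, of 1] by (simp add: F_op_commutes_serre_rel relation)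
  next
    case (gen g p)
    then show ?case
      using H[OF serre_ideal.relation[OF relation, of p b]]
      by (auto simp: mult.assoc app_F_op_gen intro!: serre.diff_mem serre.mult_left_mem)
  qed (simp_all add: scale_mult_left app_scale scale_serre_ideal distrib_right app_add_right serre_ideal.add)
qed (simp_all add: app_add_right serre_ideal.zero serre_ideal.add)

fun gen_op :: "qgen \<Rightarrow> (nat word, 'k) endo" where
  "gen_op (GenE i) = left_mult (gen i)"
| "gen_op (GenK i) = K_op 1 i"
| "gen_op (GenKinv i) = K_op (- 1) i"
| "gen_op (GenF i) = F_op i"

definition verma :: "(qgen, 'k) ncpoly \<Rightarrow> (nat word, 'k) endo" where
  "verma = endo.subst gen_op"

lemma verma_serre_ideal: "v \<in> serre_ideal \<Longrightarrow> app (verma p) v \<in> serre_ideal"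
proof (induction p rule: ncpoly_induct)
  case (gen g p)
  then show ?case
    by (cases g) (simp_all add: verma_def app_mult serre.mult_left_mem K_op_serre_ideal F_op_serre_ideal)
qed (simp_all add: verma_def endo.subst_scale endo.subst_add app_mult app_add scale_serre_ideal serre_ideal.add)

lemma verma_hom:
  "verma (p * r) = verma p * verma r" "verma (p - r) = verma p - verma r" "verma 1 = 1" "verma 0 = 0"
  "verma (const c) = endo_scalar c" "verma (gen g) = gen_op g" "verma (p ^ n) = verma p ^ n"
  by (simp_all add: verma_def endo.subst_diff endo.subst_power)

lemma verma_serre_rel: "verma (serre_rel (const B) Y i j) = serre_rel (endo_scalar B) (\<lambda>i. verma (Y i)) i j"
  by (simp add: verma_def endo.subst_serre_rel)

text \<open>Only the Serre relations in the E_i need the quotient; every other relation already acts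
  as zero on the free algebra.\<close>

lemma verma_relation:
  assumes "p \<in> Uq_relations N q" shows "app (verma p) v \<in> serre_ideal"
proof -
  have K: "K_op s i * K_op t i = 1" if "s + t = 0" for s t i
    using that by (simp add: K_op_mult K_op_0)
  have KE: "left_mult (gen j) * K_op s i = endo_scalar c * K_op s i * left_mult (gen j)"
    if "c = q powi (- (s * cartan i j))" for s i j c
  proof -
    have "c * q powi (s * cartan i j) = 1"
      using q_nz by (simp add: that flip: power_int_add)
    moreover have "endo_scalar c * K_op s i * left_mult (gen j) =
        endo_scalar (c * q powi (s * cartan i j)) * (left_mult (gen j) * K_op s i)"
      by (simp only: endo.sc_mult mult.assoc K_op_left_mult)
    ultimately show ?thesis
      by (simp add: endo.sc_one)
  qed
  have KF: "K_op s i * F_op j = endo_scalar c * F_op j * K_op s i"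
    if "c = q powi (- (s * cartan i j))" for s i j c
    by (simp add: K_op_F_op that mult.assoc)
  have R: "verma (gK i * gKi i - 1) = 0" "verma (gKi i * gK i - 1) = 0"
    "verma (gK i * gK j - gK j * gK i) = 0"
    "verma (gE j * gK i - const (q powi (- cartan i j)) * gK i * gE j) = 0"
    "verma (gE j * gKi i - const (q powi cartan i j) * gKi i * gE j) = 0"
    "verma (gK i * gF j - const (q powi (- cartan i j)) * gF j * gK i) = 0"
    "verma (gKi i * gF j - const (q powi cartan i j) * gF j * gKi i) = 0"
    "verma (gE i * gF j - gF j * gE i - (if i = j then const (1 / (q powi 2 - q powi - 2)) *
       (gK i ^ 2 - gKi i ^ 2) else 0)) = 0" for i j
    unfolding verma_hom gen_op.simps right_minus_eq if_distrib[of verma]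
    by (rule K KE KF K_op_commute | simp)+
      (simp add: F_op_left_mult H_op_def d_def power2_eq_square K_op_mult)
  have "verma p = 0 \<or> (\<exists>i j. i \<noteq> j \<and> (p = serre q gE i j \<or> p = serre q gF i j))"
    using assms unfolding Uq_relations_def
    apply (elim UnE UN_E)
      apply (elim insertE emptyE; simp only: R simp_thms)
     apply (elim insertE emptyE; simp only: R simp_thms)
    apply (elim insertE emptyE; rule disjI2; metis DiffD2 singletonI)
    done
  moreover have "app (verma (serre q gE i j)) v \<in> serre_ideal" if "i \<noteq> j" for i j
  proof -
    have "verma (serre q gE i j) = left_mult (serre_rel (const B) gen i j)"
      unfolding left_mult_eq_subst[of "serre_rel _ _ _ _"] endo.subst_serre_rel
      by (simp add: serre_eq_serre_rel that verma_serre_rel verma_hom)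
    then show ?thesis
      using serre_ideal.relation[OF that, of 1 v] by simp
  qed
  moreover have "verma (serre q gF i j) = 0" if "i \<noteq> j" for i j
    using serre_rel_F_op[OF that] by (simp add: serre_eq_serre_rel that verma_serre_rel verma_hom)
  ultimately show ?thesis
    using serre_ideal.zero by auto
qed

text \<open>Acting on the lowest weight vector 1 recovers a polynomial in the E_i, which is how
  relations in \<open>Uq\<close> are read back.\<close>

lemma verma_gE:
  "app (verma (const.subst gE p)) 1 = p"
  by (simp add: verma_def endo.subst_subst)

end

section \<open>Algebras, quotients and free algebras\<close>

lemma assoc_algebraI:
  fixes A :: "('k::field, 'a, 'm) module_scheme" (structure)
  assumes "ring A"
    and "\<And>c x. x \<in> carrier A \<Longrightarrow> c \<odot> x \<in> carrier A"
    and "\<And>b c x. x \<in> carrier A \<Longrightarrow> (b + c) \<odot> x = b \<odot> x \<oplus> c \<odot> x"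
    and "\<And>c x y. \<lbrakk> x \<in> carrier A; y \<in> carrier A \<rbrakk> \<Longrightarrow> c \<odot> (x \<oplus> y) = c \<odot> x \<oplus> c \<odot> y"
    and "\<And>b c x. x \<in> carrier A \<Longrightarrow> (b * c) \<odot> x = b \<odot> (c \<odot> x)"
    and "\<And>x. x \<in> carrier A \<Longrightarrow> 1 \<odot> x = x"
    and "\<And>c x y. \<lbrakk> x \<in> carrier A; y \<in> carrier A \<rbrakk> \<Longrightarrow> (c \<odot> x) \<otimes> y = c \<odot> (x \<otimes> y)"
    and "\<And>c x y. \<lbrakk> x \<in> carrier A; y \<in> carrier A \<rbrakk> \<Longrightarrow> x \<otimes> (c \<odot> y) = c \<odot> (x \<otimes> y)"
  shows "assoc_algebra A"
proof -
  interpret ring A by fact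
  have "module (ring_of_type_algebra :: 'k ring) A"
    by (rule moduleI) (use assms cring_from_type_algebra abelian_group_axioms in
        \<open>auto simp: ring_of_type_algebra_def\<close>)
  then show ?thesis
    by (intro assoc_algebra.intro assoc_algebra_axioms.intro ring_axioms assms)
qed

context assoc_algebra
begin

lemma scalar_simps [simp]:
  "x \<in> carrier A \<Longrightarrow> c \<odot> x \<in> carrier A" "x \<in> carrier A \<Longrightarrow> 1 \<odot> x = x"
  "x \<in> carrier A \<Longrightarrow> 0 \<odot> x = \<zero>" "c \<odot> \<zero> = \<zero>"
  using smult_closed smult_one smult_l_null smult_r_null by (simp_all add: ring_of_type_algebra_def)

lemma scalar_distrib:
  "x \<in> carrier A \<Longrightarrow> (b + c) \<odot> x = b \<odot> x \<oplus> c \<odot> x"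
  "x \<in> carrier A \<Longrightarrow> y \<in> carrier A \<Longrightarrow> c \<odot> (x \<oplus> y) = c \<odot> x \<oplus> c \<odot> y"
  "x \<in> carrier A \<Longrightarrow> b \<odot> (c \<odot> x) = (b * c) \<odot> x"
  using smult_l_distr smult_r_distr smult_assoc1 by (simp_all add: ring_of_type_algebra_def)

lemma scalar_minus: "x \<in> carrier A \<Longrightarrow> (- 1) \<odot> x = \<ominus> x"
  using scalar_distrib(1)[of x 1 "- 1"] minus_equality[of "(- 1) \<odot> x" x] by (simp add: a_comm)

lemma is_subalgebraI:
  assumes "T \<subseteq> carrier A" "\<one> \<in> T" "\<And>x y. x \<in> T \<Longrightarrow> y \<in> T \<Longrightarrow> x \<otimes> y \<in> T"
    "\<And>x y. x \<in> T \<Longrightarrow> y \<in> T \<Longrightarrow> x \<oplus> y \<in> T" "\<And>c x. x \<in> T \<Longrightarrow> c \<odot> x \<in> T"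
  shows "is_subalgebra A T"
proof -
  have "\<ominus> x \<in> T" if "x \<in> T" for x
    using assms(5)[OF that, of "- 1"] scalar_minus[of x] assms(1) that by auto
  then show ?thesis
    unfolding is_subalgebra_def using assms by (intro conjI subringI) auto
qed

lemma is_subalgebraD:
  assumes "is_subalgebra A T"
  shows "T \<subseteq> carrier A" "\<one> \<in> T" "\<And>x y. x \<in> T \<Longrightarrow> y \<in> T \<Longrightarrow> x \<otimes> y \<in> T"
    "\<And>x y. x \<in> T \<Longrightarrow> y \<in> T \<Longrightarrow> x \<oplus> y \<in> T" "\<And>c x. x \<in> T \<Longrightarrow> c \<odot> x \<in> T" "\<zero> \<in> T"
  using assms subringE[of T A] unfolding is_subalgebra_def by auto

lemma subalgebra_is_algebra:
  assumes "is_subalgebra A T" shows "assoc_algebra (A\<lparr>carrier := T\<rparr>)"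
proof (rule assoc_algebraI)
  show "ring (A\<lparr>carrier := T\<rparr>)"
    using assms subring_is_ring by (simp add: is_subalgebra_def)
qed (simp_all add: is_subalgebraD(5)[OF assms] scalar_distrib smult_mult_left smult_mult_right
      subsetD[OF is_subalgebraD(1)[OF assms]])

lemma is_subalgebra_carrier: "is_subalgebra A (carrier A)"
  by (rule is_subalgebraI) auto

lemma is_subalgebra_Inter:
  assumes "S \<noteq> {}" "\<And>T. T \<in> S \<Longrightarrow> is_subalgebra A T" shows "is_subalgebra A (\<Inter>S)"
proof (rule is_subalgebraI)
  show "\<Inter>S \<subseteq> carrier A"
    using assms is_subalgebraD(1) by (meson Inter_subset)
qed (use assms(2) is_subalgebraD(2-5) in \<open>simp_all add: Inter_iff\<close>)

lemma generated_is_subalgebra: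
  assumes "S \<subseteq> carrier A" shows "is_subalgebra A (carrier (generated_subalgebra A S))"
proof -
  have "is_subalgebra A (\<Inter>{T. is_subalgebra A T \<and> S \<subseteq> T})"
    by (rule is_subalgebra_Inter) (use assms is_subalgebra_carrier in auto)
  then show ?thesis
    by (simp add: generated_subalgebra_def)
qed

lemma generated_subalgebra_eq: "generated_subalgebra A S = A\<lparr>carrier := carrier (generated_subalgebra A S)\<rparr>"
  by (simp add: generated_subalgebra_def)

lemma generated_subset: "S \<subseteq> carrier (generated_subalgebra A S)"
  by (auto simp: generated_subalgebra_def)

lemma generated_minimal: "is_subalgebra A T \<Longrightarrow> S \<subseteq> T \<Longrightarrow> carrier (generated_subalgebra A S) \<subseteq> T"
  by (auto simp: generated_subalgebra_def)

lemma is_subalgebra_trans: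
  assumes "is_subalgebra A C" "is_subalgebra (A\<lparr>carrier := C\<rparr>) T" shows "is_subalgebra A T"
  using is_subalgebraD[OF assms(1)] assoc_algebra.is_subalgebraD[OF subalgebra_is_algebra[OF assms(1)] assms(2)]
  by (intro is_subalgebraI) auto

text \<open>Generation inside the subalgebra is not literally generation in the ambient algebra; the
  two notions are linked by transitivity of being a subalgebra.\<close>

lemma generated_generated:
  assumes "S \<subseteq> carrier A" "S \<subseteq> T" "T \<subseteq> carrier (generated_subalgebra A S)"
  shows "carrier (generated_subalgebra (generated_subalgebra A S) T) = carrier (generated_subalgebra A S)"
proof -
  define C where "C = carrier (generated_subalgebra A S)"
  have C: "is_subalgebra A C"
    unfolding C_def using assms(1) by (rule generated_is_subalgebra)
  have eq: "generated_subalgebra A S = A\<lparr>carrier := C\<rparr>"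
    unfolding C_def by (rule generated_subalgebra_eq)
  interpret C: assoc_algebra "A\<lparr>carrier := C\<rparr>"
    using C by (rule subalgebra_is_algebra)
  have "T \<subseteq> carrier (A\<lparr>carrier := C\<rparr>)"
    using assms(3) by (simp add: C_def)
  then have "is_subalgebra (A\<lparr>carrier := C\<rparr>) (carrier (generated_subalgebra (A\<lparr>carrier := C\<rparr>) T))"
    by (rule C.generated_is_subalgebra)
  moreover from this have "is_subalgebra A (carrier (generated_subalgebra (A\<lparr>carrier := C\<rparr>) T))"
    by (rule is_subalgebra_trans[OF C])
  moreover have "S \<subseteq> carrier (generated_subalgebra (A\<lparr>carrier := C\<rparr>) T)"
    using assms(2) C.generated_subset by blast
  ultimately have "carrier (generated_subalgebra A S) \<subseteq> carrier (generated_subalgebra (A\<lparr>carrier := C\<rparr>) T)"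
    by (intro generated_minimal)
  moreover have "carrier (generated_subalgebra (A\<lparr>carrier := C\<rparr>) T) \<subseteq> carrier (A\<lparr>carrier := C\<rparr>)"
    by (intro C.is_subalgebraD(1)) fact
  ultimately show ?thesis
    unfolding eq by auto
qed

end

locale algebra_ideal = assoc_algebra A + ideal I A
  for I and A :: "('k::field, 'a, 'm) module_scheme" (structure)
begin

abbreviation Q where "Q \<equiv> quotient_algebra A I"

lemma coset_eq_iff: "x \<in> carrier A \<Longrightarrow> y \<in> carrier A \<Longrightarrow> I +> x = I +> y \<longleftrightarrow> x \<ominus> y \<in> I"
  by (metis a_rcos_module_minus a_rcos_self a_repr_independence' ring_axioms)

lemma scalar_mem: "h \<in> I \<Longrightarrow> c \<odot> h \<in> I"
  using I_l_closed[of h "c \<odot> \<one>"] by (simp add: smult_mult_left a_Hcarr)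

lemma Q_simps:
  "carrier Q = (+>) I ` carrier A" "\<one>\<^bsub>Q\<^esub> = I +> \<one>" "\<zero>\<^bsub>Q\<^esub> = I +> \<zero>"
  "x \<in> carrier A \<Longrightarrow> y \<in> carrier A \<Longrightarrow> (I +> x) \<otimes>\<^bsub>Q\<^esub> (I +> y) = I +> (x \<otimes> y)"
  "x \<in> carrier A \<Longrightarrow> y \<in> carrier A \<Longrightarrow> (I +> x) \<oplus>\<^bsub>Q\<^esub> (I +> y) = I +> (x \<oplus> y)"
  "x \<in> carrier A \<Longrightarrow> c \<odot>\<^bsub>Q\<^esub> (I +> x) = I +> (c \<odot> x)"
proof -
  show "carrier Q = (+>) I ` carrier A"
    by (simp add: quotient_algebra_def FactRing_simps UNION_singleton_eq_range)
  show "\<one>\<^bsub>Q\<^esub> = I +> \<one>" "\<zero>\<^bsub>Q\<^esub> = I +> \<zero>"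
    using a_coset_add_zero[OF a_subset] by (simp_all add: quotient_algebra_def FactRing_def)
  assume x: "x \<in> carrier A"
  show "(I +> x) \<otimes>\<^bsub>Q\<^esub> (I +> y) = I +> (x \<otimes> y)" "(I +> x) \<oplus>\<^bsub>Q\<^esub> (I +> y) = I +> (x \<oplus> y)"
    if "y \<in> carrier A"
    using x that by (simp_all add: quotient_algebra_def FactRing_def rcoset_mult_add a_rcos_sum)
  \<comment> \<open>Every representative gives the same coset, so the union in the definition of
    scalar multiplication collapses.\<close>
  have "I +> (c \<odot> z) = I +> (c \<odot> x)" if z: "z \<in> I +> x" for z
  proof -
    obtain h where h: "h \<in> I" "z = h \<oplus> x"
      using z by (auto simp: a_r_coset_def')
    then have hA: "h \<in> carrier A"
      using a_Hcarr by blast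
    have "c \<odot> z \<ominus> c \<odot> x = c \<odot> h \<oplus> (c \<odot> x \<oplus> \<ominus> (c \<odot> x))"
      using x hA unfolding h(2) minus_eq scalar_distrib(2)[OF hA x] by (intro a_assoc) simp_all
    also have "\<dots> = c \<odot> h"
      using x hA by (simp only: r_neg scalar_simps(1) r_zero)
    finally show ?thesis
      using h x hA scalar_mem[OF h(1)] coset_eq_iff[of "c \<odot> z" "c \<odot> x"] by simp
  qed
  then show "c \<odot>\<^bsub>Q\<^esub> (I +> x) = I +> (c \<odot> x)"
    using a_rcos_self[OF x] unfolding quotient_algebra_def module.simps by blast
qed

lemma quotient_algebra: "assoc_algebra Q"
proof (rule assoc_algebraI)
  show "ring Q"
  proof (rule ringI)
    show "abelian_group Q"
    proof (rule abelian_groupI)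
      fix C
      assume "C \<in> carrier Q"
      then obtain x where x: "x \<in> carrier A" "C = I +> x"
        by (auto simp: Q_simps)
      then show "\<exists>D\<in>carrier Q. D \<oplus>\<^bsub>Q\<^esub> C = \<zero>\<^bsub>Q\<^esub>"
        by (intro bexI[of _ "I +> \<ominus> x"]) (auto simp: Q_simps l_neg)
    qed (auto simp: Q_simps a_ac)
    show "monoid Q"
      by (rule monoidI) (auto simp: Q_simps m_assoc)
  qed (auto simp: Q_simps l_distr r_distr)
qed (auto simp: Q_simps scalar_distrib smult_mult_left smult_mult_right)

end

lemma free_algebra_sel [simp]:
  "one (free_algebra G) = 1" "ring.zero (free_algebra G) = 0" "monoid.mult (free_algebra G) = (*)"
  "add (free_algebra G) = (+)" "module.smult (free_algebra G) c p = scale c p"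
  by (simp_all add: free_algebra_def const_eq_scale)

lemma free_carrier: "p \<in> carrier (free_algebra G) \<longleftrightarrow> (\<forall>w\<in>Poly_Mapping.keys p. set (letters w) \<subseteq> G)"
  by (simp add: free_algebra_def)

lemma free_closed:
  "0 \<in> carrier (free_algebra G)" "1 \<in> carrier (free_algebra G)"
  "p \<in> carrier (free_algebra G) \<Longrightarrow> r \<in> carrier (free_algebra G) \<Longrightarrow> p + r \<in> carrier (free_algebra G)"
  "p \<in> carrier (free_algebra G) \<Longrightarrow> r \<in> carrier (free_algebra G) \<Longrightarrow> p * r \<in> carrier (free_algebra G)"
  "p \<in> carrier (free_algebra G) \<Longrightarrow> scale c p \<in> carrier (free_algebra G)"
  "g \<in> G \<Longrightarrow> gen g \<in> carrier (free_algebra G)"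
proof -
  show "p + r \<in> carrier (free_algebra G)" if "p \<in> carrier (free_algebra G)" "r \<in> carrier (free_algebra G)"
    using that keys_add[of p r] unfolding free_carrier by blast
  show "p * r \<in> carrier (free_algebra G)" if "p \<in> carrier (free_algebra G)" "r \<in> carrier (free_algebra G)"
    unfolding free_carrier
  proof
    fix w
    assume "w \<in> Poly_Mapping.keys (p * r)"
    then obtain u v where "w = u + v" "u \<in> Poly_Mapping.keys p" "v \<in> Poly_Mapping.keys r"
      using keys_mult[of p r] by blast
    with that show "set (letters w) \<subseteq> G"
      by (auto simp: free_carrier plus_word_def)
  qed
qed (auto simp: free_carrier gen_def zero_word_def in_keys_iff)

lemma free_closed':
  "p \<in> carrier (free_algebra G) \<Longrightarrow> - p \<in> carrier (free_algebra G)"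
  "p \<in> carrier (free_algebra G) \<Longrightarrow> r \<in> carrier (free_algebra G) \<Longrightarrow> p - r \<in> carrier (free_algebra G)"
  "const c \<in> carrier (free_algebra G)"
  "p \<in> carrier (free_algebra G) \<Longrightarrow> p ^ n \<in> carrier (free_algebra G)"
proof -
  have m: "- p \<in> carrier (free_algebra G)" if "p \<in> carrier (free_algebra G)" for p :: "('a, 'b) ncpoly"
    using that by (auto simp: free_carrier in_keys_iff)
  show "p \<in> carrier (free_algebra G) \<Longrightarrow> - p \<in> carrier (free_algebra G)"
    by (rule m)
  show "p \<in> carrier (free_algebra G) \<Longrightarrow> r \<in> carrier (free_algebra G) \<Longrightarrow> p - r \<in> carrier (free_algebra G)"
    using free_closed(3)[of p G "- r"] m[of r] by simp
  show "const c \<in> carrier (free_algebra G)"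
    using free_closed(5)[OF free_closed(2), of c G] by (simp flip: const_eq_scale)
  show "p \<in> carrier (free_algebra G) \<Longrightarrow> p ^ n \<in> carrier (free_algebra G)"
    by (induction n) (simp_all add: free_closed)
qed

lemma free_algebra: "assoc_algebra (free_algebra G :: ('k::field, ('g, 'k) ncpoly) module)"
proof (rule assoc_algebraI)
  show "ring (free_algebra G :: ('k, ('g, 'k) ncpoly) module)"
  proof (rule ringI)
    show "abelian_group (free_algebra G :: ('k, ('g, 'k) ncpoly) module)"
      by (rule abelian_groupI) (auto simp: free_closed ac_simps intro: bexI[of _ "- _"] free_closed')
    show "monoid (free_algebra G :: ('k, ('g, 'k) ncpoly) module)"
      by (rule monoidI) (auto simp: free_closed mult.assoc)
  qed (auto simp: distrib_left distrib_right)
qed (auto simp: free_closed scale_add_left scale_add scale_scale scale_mult_left scale_mult_right)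

section \<open>Straightening implies solvability\<close>

definition letter_count :: "nat list \<Rightarrow> nat \<Rightarrow> nat" where
  "letter_count w = count (mset w)"

definition sorted_word :: "nat \<Rightarrow> (nat \<Rightarrow> nat) \<Rightarrow> nat list" where
  "sorted_word n \<alpha> = concat (map (\<lambda>i. replicate (\<alpha> i) i) [0..<n])"

definition lexless :: "(nat \<Rightarrow> nat) \<Rightarrow> (nat \<Rightarrow> nat) \<Rightarrow> bool" where
  "lexless \<alpha> \<beta> \<longleftrightarrow> (\<exists>k. \<alpha> k < \<beta> k \<and> (\<forall>l<k. \<alpha> l = \<beta> l))"

lemma letter_count_exponents: "set w \<subseteq> {..<n} \<Longrightarrow> letter_count w \<in> exponents n"
  by (auto simp: letter_count_def exponents_def count_eq_zero_iff)

lemma sorted_word_subset: "set (sorted_word n \<alpha>) \<subseteq> {..<n}"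
  by (auto simp: sorted_word_def)

lemma sorted_sorted_word: "sorted (sorted_word n \<alpha>)"
  by (induction n) (use sorted_word_subset in \<open>force simp: sorted_word_def sorted_append\<close>)+

lemma letter_count_sorted_word: assumes "\<alpha> \<in> exponents n" shows "letter_count (sorted_word n \<alpha>) = \<alpha>"
proof -
  have "count (mset (sorted_word n \<alpha>)) k = (if k < n then \<alpha> k else 0)" for k
    by (induction n) (auto simp: sorted_word_def)
  with assms show ?thesis
    by (auto simp: letter_count_def exponents_def fun_eq_iff)
qed

lemma sorted_word_letter_count: assumes "sorted w" "set w \<subseteq> {..<n}" shows "sorted_word n (letter_count w) = w"
proof -
  have "letter_count (sorted_word n (letter_count w)) = letter_count w"
    using assms by (intro letter_count_sorted_word letter_count_exponents)
  then have "mset (sorted_word n (letter_count w)) = mset w"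
    by (simp add: letter_count_def count_inject)
  with assms sorted_sorted_word show ?thesis
    by (metis properties_for_sort)
qed

lemma lexless_irrefl: "\<not> lexless \<alpha> \<alpha>"
  by (simp add: lexless_def)

lemma lexless_trans: assumes "lexless \<alpha> \<beta>" "lexless \<beta> \<gamma>" shows "lexless \<alpha> \<gamma>"
proof -
  obtain k l where "\<alpha> k < \<beta> k" "\<forall>i<k. \<alpha> i = \<beta> i" "\<beta> l < \<gamma> l" "\<forall>i<l. \<beta> i = \<gamma> i"
    using assms by (auto simp: lexless_def)
  then have "\<alpha> (min k l) < \<gamma> (min k l) \<and> (\<forall>i<min k l. \<alpha> i = \<gamma> i)"
    by (cases k l rule: linorder_cases) (auto simp: min_def)
  then show ?thesis
    by (auto simp: lexless_def)
qed

lemma first_difference: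
  assumes "\<alpha> \<noteq> (\<beta> :: nat \<Rightarrow> nat)" obtains k where "\<alpha> k \<noteq> \<beta> k" "\<forall>l<k. \<alpha> l = \<beta> l"
  using assms exists_least_iff[of "\<lambda>k. \<alpha> k \<noteq> \<beta> k"] by (auto simp: fun_eq_iff)

lemma lexless_total: "\<alpha> \<noteq> \<beta> \<Longrightarrow> lexless \<alpha> \<beta> \<or> lexless \<beta> \<alpha>"
  by (erule first_difference) (auto simp: lexless_def neq_iff)

lemma lexless_pointwise: "\<alpha> \<noteq> \<beta> \<Longrightarrow> (\<And>k. \<alpha> k \<le> \<beta> k) \<Longrightarrow> lexless \<alpha> \<beta>"
  by (erule first_difference) (auto simp: lexless_def order.strict_iff_order)

lemma lexless_add: "lexless \<alpha> \<beta> \<Longrightarrow> lexless (\<lambda>k. \<gamma> k + \<alpha> k + \<eta> k) (\<lambda>k. \<gamma> k + \<beta> k + \<eta> k)"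
  by (auto simp: lexless_def)

text \<open>Lexicographic descent is bounded because the vectors have fixed length n: they embed
  into lists of equal length, which \<open>lex\<close> compares in a well-founded way.\<close>

lemma wf_lexless: "wf {(\<alpha>, \<beta>). \<alpha> \<in> exponents n \<and> \<beta> \<in> exponents n \<and> lexless \<alpha> \<beta>}"
proof (rule wf_subset[OF wf_inv_image[OF wf_lex[OF wf_less_than], of "\<lambda>\<alpha>. map \<alpha> [0..<n]"]])
  show "{(\<alpha>, \<beta>). \<alpha> \<in> exponents n \<and> \<beta> \<in> exponents n \<and> lexless \<alpha> \<beta>}
    \<subseteq> inv_image (lex less_than) (\<lambda>\<alpha>. map \<alpha> [0..<n])"
  proof (clarsimp simp: lexless_def)
    fix \<alpha> \<beta> :: "nat \<Rightarrow> nat" and k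
    assume *: "\<beta> \<in> exponents n" "\<alpha> k < \<beta> k" "\<forall>l<k. \<alpha> l = \<beta> l"
    then have "k < n"
      by (auto simp: exponents_def not_le[symmetric])
    then have "[0..<n] = [0..<k] @ k # [Suc k..<n]"
      using upt_add_eq_append[of 0 k "n - k"] by (simp add: upt_conv_Cons)
    with * show "(map \<alpha> [0..<n], map \<beta> [0..<n]) \<in> lex less_than"
      by (auto simp: lex_conv intro!: exI[of _ "map \<beta> [0..<k]"])
  qed
qed

text \<open>Rearrangement by bubbling letters into place. As \<open>swap\<close> is assumed for both
  orders of i and j, the preorder R need not be symmetric.\<close>

lemma adjacent_swaps:
  assumes refl: "\<And>w. R w w" and trans: "\<And>u v w. R u v \<Longrightarrow> R v w \<Longrightarrow> R u w"
    and swap: "\<And>u i j v. mset (u @ i # j # v) = M \<Longrightarrow> R (u @ i # j # v) (u @ j # i # v)"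
    and "mset xs = M" "mset ys = M"
  shows "R xs ys"
proof -
  have move: "R (u @ x # a @ b) (u @ a @ x # b)" if "mset (u @ x # a @ b) = M" for u x a b
    using that
  proof (induction a arbitrary: u)
    case (Cons y a)
    then have "R (u @ x # y # a @ b) (u @ y # x # a @ b)"
      by (intro swap) simp
    moreover have "R ((u @ [y]) @ x # a @ b) ((u @ [y]) @ a @ x # b)"
      using Cons.prems by (intro Cons.IH) (simp add: add_mset_commute)
    ultimately show ?case
      using trans by simp
  qed (simp add: refl)
  have "R (u @ xs) (u @ ys)" if "mset xs = mset ys" "mset (u @ xs) = M" for u
    using that
  proof (induction xs arbitrary: u ys)
    case (Cons x xs)
    then have "x \<in> set ys"
      by (metis list.set_intros(1) mset_eq_setD)
    then obtain a b where ys: "ys = a @ x # b"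
      by (meson split_list)
    with Cons.prems have "R ((u @ [x]) @ xs) ((u @ [x]) @ a @ b)"
      by (intro Cons.IH) simp_all
    moreover have "R (u @ x # a @ b) (u @ a @ x # b)"
      using Cons.prems ys by (intro move) simp
    ultimately show ?case
      using trans ys by simp
  qed (simp add: refl)
  from this[of "[]"] assms(4,5) show ?thesis
    by simp
qed

lemma (in assoc_algebra) std_monomial_eq_foldr:
  assumes "set as \<subseteq> carrier A"
  shows "std_monomial A as \<alpha> = foldr (\<lambda>i m. as ! i \<otimes> m) (sorted_word (length as) \<alpha>) \<one>"
proof -
  have nth: "as ! i \<in> carrier A" if "i < length as" for i
    using assms that by auto
  have closed: "foldr (\<lambda>i m. as ! i \<otimes> m) w \<one> \<in> carrier A" if "set w \<subseteq> {..<length as}" for w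
    using that by (induction w) (auto simp: nth)
  have rep: "foldr (\<lambda>i m. as ! i \<otimes> m) (replicate k i) z = as ! i [^] k \<otimes> z"
    if "as ! i \<in> carrier A" "z \<in> carrier A" for i k z
  proof (induction k)
    case (Suc k)
    have "as ! i [^] Suc k \<otimes> z = as ! i \<otimes> (as ! i [^] k \<otimes> z)"
      unfolding nat_pow_Suc2[OF that(1)] using that by (simp only: m_assoc nat_pow_closed)
    with Suc show ?case
      by (simp del: foldr_replicate nat_pow_Suc)
  qed (use that in simp)
  have "foldr (\<lambda>i m. as ! i [^] \<alpha> i \<otimes> m) xs \<one> =
      foldr (\<lambda>i m. as ! i \<otimes> m) (concat (map (\<lambda>i. replicate (\<alpha> i) i) xs)) \<one>"
    if "set xs \<subseteq> {..<length as}" for xs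
    using that
  proof (induction xs)
    case (Cons x xs)
    have "set (concat (map (\<lambda>i. replicate (\<alpha> i) i) xs)) \<subseteq> {..<length as}"
      using Cons.prems by auto
    with Cons show ?case
      by (simp add: rep nth closed del: foldr_replicate set_concat set_map)
  qed simp
  from this[of "[0..<length as]"] show ?thesis
    by (simp add: std_monomial_def sorted_word_def atLeast0LessThan)
qed

text \<open>The letters of w lie strictly after i, which drives the lexicographic descent; the
  functionals \<open>coord\<close> stand for linear independence of the ordered monomials.\<close>

locale straightening = assoc_algebra A
  for A :: "('k::field, 'a, 'm) module_scheme" (structure) +
  fixes as :: "'a list" and coord :: "(nat \<Rightarrow> nat) \<Rightarrow> 'a \<Rightarrow> 'k"
  assumes as_closed: "set as \<subseteq> carrier A"
    and generates: "carrier (generated_subalgebra A (set as)) = carrier A"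
    and straighten: "\<lbrakk> i < j; j < length as \<rbrakk> \<Longrightarrow> \<exists>l c w. l \<noteq> 0 \<and> set w \<subseteq> {i<..<length as} \<and>
          as ! j \<otimes> as ! i = l \<odot> (as ! i \<otimes> as ! j) \<oplus> c \<odot> foldr (\<lambda>i m. as ! i \<otimes> m) w \<one>"
    and coord_add: "\<lbrakk> x \<in> carrier A; y \<in> carrier A \<rbrakk> \<Longrightarrow> coord \<alpha> (x \<oplus> y) = coord \<alpha> x + coord \<alpha> y"
    and coord_smult: "x \<in> carrier A \<Longrightarrow> coord \<alpha> (c \<odot> x) = c * coord \<alpha> x"
    and coord_monomial: "\<lbrakk> \<alpha> \<in> exponents (length as); \<beta> \<in> exponents (length as) \<rbrakk> \<Longrightarrow>
          coord \<alpha> (std_monomial A as \<beta>) = (if \<alpha> = \<beta> then 1 else 0)"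
begin

abbreviation n where "n \<equiv> length as"
abbreviation mon where "mon \<equiv> std_monomial A as"

definition W :: "nat list \<Rightarrow> 'a" where "W w = foldr (\<lambda>i m. as ! i \<otimes> m) w \<one>"

lemma nth_closed: "i < n \<Longrightarrow> as ! i \<in> carrier A"
  using as_closed by auto

lemma W_Nil: "W [] = \<one>" and W_Cons: "W (i # w) = as ! i \<otimes> W w"
  by (simp_all add: W_def)

lemma W_closed: "set w \<subseteq> {..<n} \<Longrightarrow> W w \<in> carrier A"
  by (induction w) (auto simp: W_Nil W_Cons nth_closed)

lemma W_append: "set u \<subseteq> {..<n} \<Longrightarrow> set v \<subseteq> {..<n} \<Longrightarrow> W (u @ v) = W u \<otimes> W v"
  by (induction u) (auto simp: W_Nil W_Cons nth_closed W_closed m_assoc)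

lemma mon_eq_W: "mon \<alpha> = W (sorted_word n \<alpha>)"
  unfolding W_def using as_closed by (rule std_monomial_eq_foldr)

lemma mon_closed [simp]: "mon \<alpha> \<in> carrier A"
  by (simp add: mon_eq_W W_closed sorted_word_subset)

inductive_set mon_span :: "(nat \<Rightarrow> nat) set \<Rightarrow> 'a set" for S where
  span_zero: "\<zero> \<in> mon_span S"
| span_step: "\<gamma> \<in> S \<Longrightarrow> f \<in> mon_span S \<Longrightarrow> c \<odot> mon \<gamma> \<oplus> f \<in> mon_span S"

lemma span_closed: "f \<in> mon_span S \<Longrightarrow> f \<in> carrier A"
  by (induction rule: mon_span.induct) auto

lemma span_add: "f \<in> mon_span S \<Longrightarrow> g \<in> mon_span S \<Longrightarrow> f \<oplus> g \<in> mon_span S"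
  by (induction rule: mon_span.induct) (auto simp: span_closed a_assoc intro: span_step)

lemma span_smult: "f \<in> mon_span S \<Longrightarrow> c \<odot> f \<in> mon_span S"
  by (induction rule: mon_span.induct) (auto simp: span_closed scalar_distrib intro: mon_span.intros)

lemma span_mono: "f \<in> mon_span S \<Longrightarrow> S \<subseteq> T \<Longrightarrow> f \<in> mon_span T"
  by (induction rule: mon_span.induct) (auto intro: mon_span.intros)

lemma coord_zero [simp]: "coord \<alpha> \<zero> = 0"
  using coord_smult[of \<zero> \<alpha> 0] by simp

lemma coord_span:
  assumes "f \<in> mon_span S" "S \<subseteq> exponents n" "\<alpha> \<in> exponents n" "coord \<alpha> f \<noteq> 0" shows "\<alpha> \<in> S"
  using assms
  by (induction rule: mon_span.induct) (auto simp: coord_add coord_smult coord_monomial span_closed split: if_splits)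

definition below :: "(nat \<Rightarrow> nat) \<Rightarrow> (nat \<Rightarrow> nat) set" where
  "below \<gamma> = {\<beta> \<in> exponents n. lexless \<beta> \<gamma>}"

text \<open>Well-founded induction on the exponent vector, with sorting by adjacent swaps inside:
  words with smaller exponent vector are already known to lie in the lower span. The nonzero
  coefficient c is what makes leading monomials of products computable.\<close>

lemma W_straighten:
  assumes "set w \<subseteq> {..<n}"
  shows "\<exists>c f. c \<noteq> 0 \<and> f \<in> mon_span (below (letter_count w)) \<and> W w = c \<odot> mon (letter_count w) \<oplus> f"
proof -
  have "\<forall>w. set w \<subseteq> {..<n} \<longrightarrow> letter_count w = \<gamma> \<longrightarrow>
      (\<exists>c f. c \<noteq> 0 \<and> f \<in> mon_span (below \<gamma>) \<and> W w = c \<odot> mon \<gamma> \<oplus> f)" for \<gamma>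
    using wf_lexless[of n]
  proof (induction \<gamma> rule: wf_induct_rule)
    case (less \<gamma>)
    have lower: "W w \<in> mon_span (below \<gamma>)" if w: "set w \<subseteq> {..<n}" "letter_count w \<in> below \<gamma>" "\<gamma> \<in> exponents n" for w
    proof -
      obtain c f where cf: "f \<in> mon_span (below (letter_count w))" "W w = c \<odot> mon (letter_count w) \<oplus> f"
        using less[of "letter_count w"] w unfolding below_def by blast
      have "below (letter_count w) \<subseteq> below \<gamma>"
        using w lexless_trans by (auto simp: below_def)
      with cf w show ?thesis
        by (auto intro: span_step span_mono)
    qed
    show ?case
    proof (intro allI impI)
      fix w
      assume w: "set w \<subseteq> {..<n}" "letter_count w = \<gamma>"
      then have \<gamma>: "\<gamma> \<in> exponents n"
        using letter_count_exponents by blast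
      \<comment> \<open>Proportionality with a nonzero factor, modulo lower monomials. The clause on
        letter sets carries the range condition to intermediate words in the transitivity
        step.\<close>
      define R where "R u v \<longleftrightarrow> (set u \<subseteq> {..<n} \<longrightarrow> set v \<subseteq> {..<n} \<longrightarrow>
        (\<exists>c f. c \<noteq> 0 \<and> f \<in> mon_span (below \<gamma>) \<and> W u = c \<odot> W v \<oplus> f)) \<and> set u = set v" for u v
      have "R w (sorted_word n \<gamma>)"
      proof (rule adjacent_swaps[of R])
        show "R u u" for u
          unfolding R_def by (force intro: exI[of _ 1] exI[of _ \<zero>] span_zero simp: W_closed)
        show "R u v" if "R u u'" "R u' v" for u u' v
        proof -
          have "\<exists>c f. c \<noteq> 0 \<and> f \<in> mon_span (below \<gamma>) \<and> W u = c \<odot> W v \<oplus> f"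
            if *: "set u \<subseteq> {..<n}" "set v \<subseteq> {..<n}"
          proof -
            obtain c f d g where cf: "c \<noteq> 0" "f \<in> mon_span (below \<gamma>)" "W u = c \<odot> W u' \<oplus> f"
              "d \<noteq> 0" "g \<in> mon_span (below \<gamma>)" "W u' = d \<odot> W v \<oplus> g"
              using * \<open>R u u'\<close> \<open>R u' v\<close> by (auto simp: R_def)
            then have "W u = (c * d) \<odot> W v \<oplus> (c \<odot> g \<oplus> f)"
              using * by (simp add: scalar_distrib W_closed span_closed a_assoc)
            with cf show ?thesis
              by (intro exI[of _ "c * d"] exI[of _ "c \<odot> g \<oplus> f"]) (auto intro: span_add span_smult)
          qed
          with that show ?thesis
            by (auto simp: R_def)
        qed
        show "R (u @ i # j # v) (u @ j # i # v)" if mw: "mset (u @ i # j # v) = mset w" for u i j v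
        proof -
          have 1: "\<exists>c f. c \<noteq> 0 \<and> f \<in> mon_span (below \<gamma>) \<and> W (u @ j # i # v) = c \<odot> W (u @ i # j # v) \<oplus> f"
            if ij: "i < j" and m: "mset (u @ i # j # v) = mset w" for i j
          proof -
            have "set (u @ i # j # v) = set w"
              using m by (metis set_mset_mset)
            then have s: "set u \<subseteq> {..<n}" "set v \<subseteq> {..<n}" "i < n" "j < n"
              using w by auto
            obtain l c x where x: "l \<noteq> 0" "set x \<subseteq> {i<..<n}"
              "as ! j \<otimes> as ! i = l \<odot> (as ! i \<otimes> as ! j) \<oplus> c \<odot> W x"
              using straighten[OF ij] s by (auto simp: W_def)
            have x': "set x \<subseteq> {..<n}"
              using x by auto
            have "W (u @ j # i # v) = W u \<otimes> (as ! j \<otimes> as ! i) \<otimes> W v"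
              using s by (simp add: W_append W_Cons nth_closed W_closed m_assoc)
            also have "\<dots> = l \<odot> (W u \<otimes> (as ! i \<otimes> as ! j) \<otimes> W v) \<oplus> c \<odot> (W u \<otimes> W x \<otimes> W v)"
              using s x' by (simp add: x nth_closed W_closed r_distr l_distr smult_mult_left smult_mult_right)
            also have "W u \<otimes> (as ! i \<otimes> as ! j) \<otimes> W v = W (u @ i # j # v)"
              using s by (simp add: W_append W_Cons nth_closed W_closed m_assoc)
            also have "W u \<otimes> W x \<otimes> W v = W (u @ x @ v)"
              using s x' by (simp add: W_append W_closed m_assoc)
            finally have "W (u @ j # i # v) = l \<odot> W (u @ i # j # v) \<oplus> c \<odot> W (u @ x @ v)" .
            \<comment> \<open>The exchange removes one letter i, and all letters of x as well as j
              exceed i; so the count drops at i and is unchanged before i.\<close>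
            moreover have "lexless (letter_count (u @ x @ v)) \<gamma>"
            proof -
              have "letter_count (u @ x @ v) k < \<gamma> k" if "k = i" for k
                using x ij that by (auto simp: letter_count_def simp flip: w(2) m count_mset_0_iff)
              moreover have "letter_count (u @ x @ v) k = \<gamma> k" if "k < i" for k
                using x ij that by (auto simp: letter_count_def simp flip: w(2) m count_mset_0_iff)
              ultimately show ?thesis
                by (auto simp: lexless_def)
            qed
            then have "W (u @ x @ v) \<in> mon_span (below \<gamma>)"
              using s x' by (intro lower \<gamma>) (auto simp: below_def intro!: letter_count_exponents)
            ultimately show ?thesis
              using x by (blast intro: span_smult)
          qed
          have s: "set (u @ i # j # v) \<subseteq> {..<n}"
            using w mw by (metis set_mset_mset)
          consider "i = j" | "i < j" | "j < i" by linarith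
          then show ?thesis
          proof cases
            case 1
            then show ?thesis
              unfolding R_def by (force intro: exI[of _ 1] exI[of _ \<zero>] span_zero simp: W_closed)
          next
            case 2
            obtain c f where cf: "c \<noteq> 0" "f \<in> mon_span (below \<gamma>)" "W (u @ j # i # v) = c \<odot> W (u @ i # j # v) \<oplus> f"
              using 1[OF 2 mw] by blast
            \<comment> \<open>The given relation rewrites j i into i j; as c is nonzero it can be
              solved for the opposite direction.\<close>
            have "(1 / c) \<odot> W (u @ j # i # v) = W (u @ i # j # v) \<oplus> (1 / c) \<odot> f"
              unfolding cf using s cf by (simp add: scalar_distrib W_closed span_closed)
            then have "W (u @ i # j # v) = (1 / c) \<odot> W (u @ j # i # v) \<oplus> (- 1) \<odot> ((1 / c) \<odot> f)"
              using s cf by (simp add: scalar_minus W_closed span_closed a_assoc r_neg)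
            then show ?thesis
              unfolding R_def using cf
              by (auto intro!: exI[of _ "1 / c"] exI[of _ "(- 1) \<odot> ((1 / c) \<odot> f)"] span_smult)
          next
            case 3
            then show ?thesis
              using 1[OF 3] mw by (auto simp: R_def add_mset_commute)
          qed
        qed
        show "mset (sorted_word n \<gamma>) = mset w"
          using letter_count_sorted_word[OF \<gamma>] w(2) by (metis count_inject letter_count_def)
      qed simp
      then show "\<exists>c f. c \<noteq> 0 \<and> f \<in> mon_span (below \<gamma>) \<and> W w = c \<odot> mon \<gamma> \<oplus> f"
        using w by (simp add: R_def mon_eq_W)
    qed
  qed
  with assms show ?thesis
    by blast
qed

lemma W_in_span: assumes "set w \<subseteq> {..<n}" shows "W w \<in> mon_span (exponents n)"
proof -
  obtain c f where f: "f \<in> mon_span (below (letter_count w))" "W w = c \<odot> mon (letter_count w) \<oplus> f"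
    using W_straighten[OF assms] by blast
  moreover have "below (letter_count w) \<subseteq> exponents n"
    by (auto simp: below_def)
  ultimately show ?thesis
    using letter_count_exponents[OF assms] by (auto intro: span_step span_mono)
qed

lemma span_mult:
  assumes "f \<in> mon_span (exponents n)" "g \<in> mon_span (exponents n)"
  shows "f \<otimes> g \<in> mon_span (exponents n)"
  using assms(1)
proof induction
  case (span_step \<gamma> f c)
  have "mon \<gamma> \<otimes> g \<in> mon_span (exponents n)"
    using assms(2)
  proof induction
    case (span_step \<delta> g d)
    have "mon \<gamma> \<otimes> mon \<delta> \<in> mon_span (exponents n)"
      unfolding mon_eq_W W_append[symmetric, OF sorted_word_subset sorted_word_subset]
      using sorted_word_subset by (intro W_in_span) auto
    with span_step show ?case
      by (simp add: r_distr smult_mult_right span_closed) (intro span_add span_smult)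
  qed (simp add: span_zero)
  with span_step assms(2) show ?case
    by (simp add: l_distr smult_mult_left span_closed) (intro span_add span_smult)
qed (use assms(2) in \<open>simp add: span_closed span_zero\<close>)

lemma span_eq_carrier: "mon_span (exponents n) = carrier A"
proof -
  have "subring (mon_span (exponents n)) A"
  proof (rule subringI)
    show "\<one> \<in> mon_span (exponents n)"
      using W_in_span[of "[]"] by (simp add: W_Nil)
    show "\<ominus> f \<in> mon_span (exponents n)" if "f \<in> mon_span (exponents n)" for f
      using span_smult[OF that, of "- 1"] scalar_minus[OF span_closed[OF that]] by simp
    show "mon_span (exponents n) \<subseteq> carrier A"
      using span_closed by blast
    show "f \<otimes> g \<in> mon_span (exponents n)" "f \<oplus> g \<in> mon_span (exponents n)"
      if "f \<in> mon_span (exponents n)" "g \<in> mon_span (exponents n)" for f g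
      using that by (rule span_mult span_add)+
  qed
  then have "is_subalgebra A (mon_span (exponents n))"
    unfolding is_subalgebra_def using span_smult by blast
  moreover have "as ! i \<in> mon_span (exponents n)" if "i < n" for i
  proof -
    have "W [i] \<in> mon_span (exponents n)"
      using that by (intro W_in_span) simp
    then show ?thesis
      by (simp only: W_Cons W_Nil r_one[OF nth_closed[OF that]])
  qed
  then have "set as \<subseteq> mon_span (exponents n)"
    by (auto simp: in_set_conv_nth)
  ultimately have "mon_span (exponents n) \<in> {T. is_subalgebra A T \<and> set as \<subseteq> T}"
    by blast
  then have "\<Inter>{T. is_subalgebra A T \<and> set as \<subseteq> T} \<subseteq> mon_span (exponents n)"
    by (rule Inter_lower)
  then have "carrier (generated_subalgebra A (set as)) \<subseteq> mon_span (exponents n)"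
    unfolding generated_subalgebra_def by simp
  then have "carrier A \<subseteq> mon_span (exponents n)"
    unfolding generates .
  then show ?thesis
    using span_closed[of _ "exponents n"] by blast
qed

section \<open>Basis, leading monomials and the ordering\<close>

abbreviation MON where "MON \<equiv> std_monomials A as"

lemma mon_inject: "\<alpha> \<in> exponents n \<Longrightarrow> \<beta> \<in> exponents n \<Longrightarrow> mon \<alpha> = mon \<beta> \<longleftrightarrow> \<alpha> = \<beta>"
  using coord_monomial[of \<alpha> \<alpha>] coord_monomial[of \<alpha> \<beta>] by (auto split: if_splits)

lemma MON_closed: "MON \<subseteq> carrier A"
  by (auto simp: std_monomials_def)

lemma coord_finsum:
  assumes "finite S" "S \<subseteq> MON" "\<alpha> \<in> exponents n"
  shows "coord \<alpha> (\<Oplus>b\<in>S. c b \<odot> b) = (if mon \<alpha> \<in> S then c (mon \<alpha>) else 0)"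
  using assms(1,2)
proof (induction S)
  case (insert b S)
  then obtain \<beta> where \<beta>: "\<beta> \<in> exponents n" "b = mon \<beta>"
    by (auto simp: std_monomials_def)
  have "(\<Oplus>b\<in>insert b S. c b \<odot> b) = c b \<odot> b \<oplus> (\<Oplus>b\<in>S. c b \<odot> b)"
    using insert MON_closed by (intro finsum_insert) auto
  moreover have "(\<Oplus>b\<in>S. c b \<odot> b) \<in> carrier A"
    using insert MON_closed by (intro finsum_closed) auto
  ultimately show ?case
    using insert \<beta> assms(3) by (auto simp: coord_add coord_smult coord_monomial mon_inject)
qed simp

lemma is_coeffs_coord:
  assumes "is_coeffs A MON f c" "\<alpha> \<in> exponents n" shows "c (mon \<alpha>) = coord \<alpha> f"
proof -
  have "coord \<alpha> f = (if mon \<alpha> \<in> {b. c b \<noteq> 0} then c (mon \<alpha>) else 0)"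
    using assms coord_finsum[of "{b. c b \<noteq> 0}" \<alpha> c] by (simp add: is_coeffs_def)
  then show ?thesis
    by (auto split: if_splits)
qed

lemma is_coeffs_outside: "is_coeffs A MON f c \<Longrightarrow> b \<notin> MON \<Longrightarrow> c b = 0"
  by (auto simp: is_coeffs_def)

lemma is_coeffs_unique:
  assumes "is_coeffs A MON f c" "is_coeffs A MON f d" shows "c = d"
proof
  fix b
  show "c b = d b"
    using is_coeffs_coord[OF assms(1)] is_coeffs_coord[OF assms(2)]
      is_coeffs_outside[OF assms(1), of b] is_coeffs_outside[OF assms(2), of b]
    by (cases "b \<in> MON") (auto simp: std_monomials_def)
qed

lemma is_coeffs_exists: assumes "f \<in> carrier A" shows "\<exists>c. is_coeffs A MON f c"
proof -
  have "\<exists>S c. finite S \<and> S \<subseteq> MON \<and> f = (\<Oplus>b\<in>S. c b \<odot> b)"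
    using assms unfolding span_eq_carrier[symmetric]
  proof induction
    case span_zero
    show ?case
      by (intro exI[of _ "{}"]) simp
  next
    case (span_step \<gamma> f a)
    then obtain S c where S: "finite S" "S \<subseteq> MON" and f: "f = (\<Oplus>b\<in>S. c b \<odot> b)"
      by blast
    define m where "m = mon \<gamma>"
    define c' where "c' = c(m := if m \<in> S then c m + a else a)"
    have m: "m \<in> MON" "m \<in> carrier A"
      using span_step by (simp_all add: m_def std_monomials_def)
    have S': "S - {m} \<subseteq> carrier A"
      using S MON_closed by auto
    define g where "g = (\<Oplus>b\<in>S - {m}. c b \<odot> b)"
    have g: "g \<in> carrier A"
      unfolding g_def using S' by (intro finsum_closed) auto
    have "(\<Oplus>b\<in>insert m (S - {m}). c' b \<odot> b) = c' m \<odot> m \<oplus> (\<Oplus>b\<in>S - {m}. c' b \<odot> b)"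
      using S S' m by (intro finsum_insert) auto
    also have "(\<Oplus>b\<in>S - {m}. c' b \<odot> b) = g"
      unfolding g_def using S' by (intro finsum_cong') (auto simp: c'_def)
    also have "c' m \<odot> m \<oplus> g = a \<odot> m \<oplus> f"
    proof (cases "m \<in> S")
      case True
      then have "f = (\<Oplus>b\<in>insert m (S - {m}). c b \<odot> b)"
        by (simp add: f insert_absorb)
      also have "\<dots> = c m \<odot> m \<oplus> g"
        unfolding g_def using S S' m by (intro finsum_insert) auto
      finally show ?thesis
        using True m g by (simp add: c'_def scalar_distrib a_assoc add.commute[of "c m"])
    next
      case False
      then show ?thesis
        by (simp add: c'_def f g_def)
    qed
    finally have "a \<odot> mon \<gamma> \<oplus> f = (\<Oplus>b\<in>insert m (S - {m}). c' b \<odot> b)"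
      by (simp add: m_def)
    with S m show ?case
      by (intro exI[of _ "insert m (S - {m})"] exI[of _ c']) auto
  qed
  then obtain S c where S: "finite S" "S \<subseteq> MON" "f = (\<Oplus>b\<in>S. c b \<odot> b)"
    by blast
  define d where "d b = (if b \<in> S then c b else 0)" for b
  \<comment> \<open>Coefficients on S may cancel to zero, whereas \<open>is_coeffs\<close> sums over
    the exact support.\<close>
  have sub: "{b. d b \<noteq> 0} \<subseteq> S"
    by (auto simp: d_def)
  have "(\<Oplus>b\<in>{b. d b \<noteq> 0}. d b \<odot> b) = (\<Oplus>b\<in>S. c b \<odot> b)"
    using S sub MON_closed by (intro add.finprod_mono_neutral_cong_left) (auto simp: d_def)
  with S sub have "is_coeffs A MON f d"
    unfolding is_coeffs_def using finite_subset by auto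
  then show ?thesis
    by blast
qed

lemma is_coeffs_ex1: assumes "f \<in> carrier A" shows "\<exists>!c. is_coeffs A MON f c"
proof -
  obtain c where c: "is_coeffs A MON f c"
    using is_coeffs_exists[OF assms] by (elim exE)
  show ?thesis
  proof (rule ex1I)
    show "is_coeffs A MON f c"
      by (rule c)
  qed (rule is_coeffs_unique[OF _ c])
qed

lemma coeffs_wrt_is_coeffs: "f \<in> carrier A \<Longrightarrow> is_coeffs A MON f (coeffs_wrt A MON f)"
  unfolding coeffs_wrt_def by (rule theI'[where P = "is_coeffs A MON f"]) (rule is_coeffs_ex1)

lemma has_PBW_basis: "has_PBW_basis A as"
  unfolding has_PBW_basis_def is_basis_def
proof (intro conjI ballI)
  show "inj_on mon (exponents n)"
    by (rule inj_onI) (simp add: mon_inject)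
qed (fact MON_closed, rule is_coeffs_ex1)

definition mon_order :: "('a \<times> 'a) set" where
  "mon_order = {(mon \<alpha>, mon \<beta>) | \<alpha> \<beta>. \<alpha> \<in> exponents n \<and> \<beta> \<in> exponents n \<and> (\<alpha> = \<beta> \<or> lexless \<alpha> \<beta>)}"

lemma mon_order_iff: "\<alpha> \<in> exponents n \<Longrightarrow> \<beta> \<in> exponents n \<Longrightarrow>
    (mon \<alpha>, mon \<beta>) \<in> mon_order \<longleftrightarrow> \<alpha> = \<beta> \<or> lexless \<alpha> \<beta>"
  by (auto simp: mon_order_def mon_inject)

lemma strictly_below_mon: "\<alpha> \<in> exponents n \<Longrightarrow> \<beta> \<in> exponents n \<Longrightarrow>
    strictly_below mon_order (mon \<alpha>) (mon \<beta>) \<longleftrightarrow> lexless \<alpha> \<beta>"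
  by (auto simp: strictly_below_def mon_order_iff mon_inject lexless_irrefl)

lemma well_order_mon_order: "well_order_on MON mon_order"
proof -
  have "inv_into (exponents n) mon (mon \<alpha>) = \<alpha>" if "\<alpha> \<in> exponents n" for \<alpha>
    using that by (intro inv_into_f_f inj_onI) (simp_all add: mon_inject)
  then have "mon_order - Id \<subseteq> inv_image {(\<alpha>, \<beta>). \<alpha> \<in> exponents n \<and> \<beta> \<in> exponents n \<and> lexless \<alpha> \<beta>}
      (inv_into (exponents n) mon)"
    by (auto simp: mon_order_def)
  then have wf: "wf (mon_order - Id)"
    by (rule wf_subset[OF wf_inv_image[OF wf_lexless]])
  have in_MON: "x \<in> MON \<and> y \<in> MON" if "(x, y) \<in> mon_order" for x y
    using that by (auto simp: mon_order_def std_monomials_def)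
  have trans: "trans mon_order"
  proof (rule transI)
    fix x y z
    assume *: "(x, y) \<in> mon_order" "(y, z) \<in> mon_order"
    then have "x \<in> MON" "y \<in> MON" "z \<in> MON"
      using in_MON by blast+
    then obtain \<alpha> \<beta> \<gamma> where E: "\<alpha> \<in> exponents n" "\<beta> \<in> exponents n" "\<gamma> \<in> exponents n"
      and xyz: "x = mon \<alpha>" "y = mon \<beta>" "z = mon \<gamma>"
      unfolding std_monomials_def by blast
    from * E show "(x, z) \<in> mon_order"
      unfolding xyz mon_order_iff[OF E(1,2)] mon_order_iff[OF E(2,3)] mon_order_iff[OF E(1,3)]
      using lexless_trans by blast
  qed
  have antisym: "antisym mon_order"
  proof (rule antisymI)
    fix x y
    assume *: "(x, y) \<in> mon_order" "(y, x) \<in> mon_order"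
    then have "x \<in> MON" "y \<in> MON"
      using in_MON by blast+
    then obtain \<alpha> \<beta> where E: "\<alpha> \<in> exponents n" "\<beta> \<in> exponents n" and xy: "x = mon \<alpha>" "y = mon \<beta>"
      unfolding std_monomials_def by blast
    from * E have "\<alpha> = \<beta>"
      unfolding xy mon_order_iff[OF E] mon_order_iff[OF E(2,1)]
      using lexless_trans lexless_irrefl by blast
    then show "x = y"
      by (simp add: xy)
  qed
  have "total_on MON mon_order"
    unfolding total_on_def std_monomials_def using lexless_total by (auto simp: mon_order_iff)
  moreover have "refl_on MON mon_order"
    unfolding refl_on_def std_monomials_def by (auto simp: mon_order_iff)
  ultimately show ?thesis
    unfolding well_order_on_def order_on_defs using wf trans antisym in_MON by auto
qed

lemma LM_eq:
  assumes "\<gamma> \<in> exponents n" "c \<noteq> 0" "g \<in> mon_span (below \<gamma>)" "f = c \<odot> mon \<gamma> \<oplus> g"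
  shows "LM A MON mon_order f = mon \<gamma>"
proof -
  have f: "f \<in> carrier A"
    using assms by (simp add: span_closed)
  have g: "coord \<alpha> g = 0" if "\<alpha> \<in> exponents n" "\<not> lexless \<alpha> \<gamma>" for \<alpha>
    using coord_span[OF assms(3), of \<alpha>] that by (auto simp: below_def)
  have coord_f: "coord \<alpha> f = (if \<alpha> = \<gamma> then c else coord \<alpha> g)" if "\<alpha> \<in> exponents n" for \<alpha>
    using that assms g lexless_irrefl
    by (auto simp: coord_add coord_smult coord_monomial span_closed)
  have coeff: "coeffs_wrt A MON f (mon \<alpha>) = coord \<alpha> f" if "\<alpha> \<in> exponents n" for \<alpha>
    using is_coeffs_coord[OF coeffs_wrt_is_coeffs[OF f] that] .
  have upper: "(b, mon \<gamma>) \<in> mon_order" if b: "coeffs_wrt A MON f b \<noteq> 0" for b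
  proof -
    have "b \<in> MON"
      using b is_coeffs_outside[OF coeffs_wrt_is_coeffs[OF f]] by blast
    then obtain \<alpha> where "\<alpha> \<in> exponents n" "b = mon \<alpha>"
      by (auto simp: std_monomials_def)
    with b show ?thesis
      using coeff coord_f g assms(1) by (auto simp: mon_order_iff split: if_splits)
  qed
  have lead: "coeffs_wrt A MON f (mon \<gamma>) \<noteq> 0"
    using coeff coord_f assms by simp
  have "f \<noteq> \<zero>"
    using coord_f[OF assms(1)] assms(2) by auto
  moreover have "(THE b. coeffs_wrt A MON f b \<noteq> 0 \<and>
      (\<forall>b'. coeffs_wrt A MON f b' \<noteq> 0 \<longrightarrow> (b', b) \<in> mon_order)) = mon \<gamma>"
    using upper lead well_order_mon_order
    by (intro the_equality) (auto simp: well_order_on_def order_on_defs antisym_def)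
  ultimately show ?thesis
    by (simp add: LM_def)
qed

lemma LM_W: "set w \<subseteq> {..<n} \<Longrightarrow> c \<noteq> 0 \<Longrightarrow> LM A MON mon_order (c \<odot> W w) = mon (letter_count w)"
proof -
  assume w: "set w \<subseteq> {..<n}" and "c \<noteq> 0"
  obtain d f where f: "d \<noteq> 0" "f \<in> mon_span (below (letter_count w))" "W w = d \<odot> mon (letter_count w) \<oplus> f"
    using W_straighten[OF w] by blast
  then have "c \<odot> W w = (c * d) \<odot> mon (letter_count w) \<oplus> c \<odot> f"
    by (simp add: scalar_distrib span_closed)
  then show ?thesis
    using f w \<open>c \<noteq> 0\<close> by (intro LM_eq[OF letter_count_exponents _ span_smult]) auto
qed

lemma exponents_add: "\<alpha> \<in> exponents n \<Longrightarrow> \<beta> \<in> exponents n \<Longrightarrow> \<eta> \<in> exponents n \<Longrightarrow>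
    (\<lambda>k. \<alpha> k + \<beta> k + \<eta> k) \<in> exponents n"
  by (simp add: exponents_def)

text \<open>A product of three ordered monomials is one word, and its leading exponent vector just
  counts letters.\<close>

lemma LM_mult:
  assumes "\<alpha> \<in> exponents n" "\<beta> \<in> exponents n" "\<eta> \<in> exponents n"
  shows "LM A MON mon_order (mon \<alpha> \<otimes> mon \<beta> \<otimes> mon \<eta>) = mon (\<lambda>k. \<alpha> k + \<beta> k + \<eta> k)"
proof -
  define w where "w = sorted_word n \<alpha> @ sorted_word n \<beta> @ sorted_word n \<eta>"
  have w: "set w \<subseteq> {..<n}"
    using sorted_word_subset by (auto simp: w_def)
  have "letter_count w = (\<lambda>k. \<alpha> k + \<beta> k + \<eta> k)"
    using letter_count_sorted_word assms by (auto simp: w_def letter_count_def fun_eq_iff)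
  moreover have "mon \<alpha> \<otimes> mon \<beta> \<otimes> mon \<eta> = W w"
    using sorted_word_subset
    by (simp add: w_def mon_eq_W W_append W_closed m_assoc)
  ultimately show ?thesis
    using LM_W[OF w, of 1] w by (simp add: W_closed)
qed

text \<open>By \<open>LM_mult\<close> condition 2 compares a vector with one that dominates it
  pointwise, and condition 3 is translation invariance of the lexicographic order.\<close>

lemma monomial_ordering: "monomial_ordering A MON mon_order"
  unfolding monomial_ordering_def
proof (intro conjI ballI impI; (elim conjE)?)
  fix g a b h
  assume "g \<in> MON" "a \<in> MON" "b \<in> MON" "h \<in> MON"
  then obtain \<gamma> \<alpha> \<beta> \<eta> where E: "\<gamma> \<in> exponents n" "\<alpha> \<in> exponents n" "\<beta> \<in> exponents n" "\<eta> \<in> exponents n"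
    and [simp]: "g = mon \<gamma>" "a = mon \<alpha>" "b = mon \<beta>" "h = mon \<eta>"
    by (auto simp: std_monomials_def)
  show "strictly_below mon_order b g" if "b \<noteq> g" "g = LM A MON mon_order (a \<otimes> b \<otimes> h)"
  proof -
    have "\<gamma> = (\<lambda>k. \<alpha> k + \<beta> k + \<eta> k)"
      using that(2) E by (simp add: LM_mult mon_inject exponents_add)
    moreover have "\<beta> \<noteq> \<gamma>"
      using that(1) by auto
    ultimately have "lexless \<beta> \<gamma>"
      by (intro lexless_pointwise) auto
    then show ?thesis
      using E by (simp add: strictly_below_mon)
  qed
  show "strictly_below mon_order (LM A MON mon_order (g \<otimes> a \<otimes> h)) (LM A MON mon_order (g \<otimes> b \<otimes> h))"
    if "strictly_below mon_order a b"
    using that E by (simp add: LM_mult strictly_below_mon exponents_add lexless_add)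
qed (rule well_order_mon_order)

lemma nth_mult_eq_W: "i < n \<Longrightarrow> j < n \<Longrightarrow> as ! i \<otimes> as ! j = W [i, j]"
  by (simp add: W_Cons W_Nil nth_closed)

theorem solvable: "solvable_polynomial_algebra A as"
  unfolding solvable_polynomial_algebra_def
proof (intro conjI exI[of _ mon_order] allI impI)
  fix i j
  assume ij: "i < j" "j < n"
  then obtain l c w where w: "l \<noteq> 0" "set w \<subseteq> {i<..<n}"
    "as ! j \<otimes> as ! i = l \<odot> (as ! i \<otimes> as ! j) \<oplus> c \<odot> W w"
    using straighten[of i j] unfolding W_def by blast
  have ww: "set w \<subseteq> {..<n}"
    using w by auto
  have ij': "set [i, j] \<subseteq> {..<n}"
    using ij by auto
  have "lexless (letter_count w) (letter_count [i, j])"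
    unfolding lexless_def
  proof (intro exI[of _ i] conjI allI impI)
    show "letter_count w i < letter_count [i, j] i"
      using w ij by (auto simp: letter_count_def count_mset_0_iff)
    show "letter_count w k = letter_count [i, j] k" if "k < i" for k
      using w ij that by (auto simp: letter_count_def count_mset_0_iff)
  qed
  moreover have "as ! i \<otimes> as ! j = mon (letter_count [i, j])"
    using ij ij' sorted_word_letter_count[of "[i, j]" n] by (simp add: mon_eq_W nth_mult_eq_W)
  moreover have "c \<noteq> 0" if "c \<odot> W w \<noteq> \<zero>"
    using that ww by (auto simp: W_closed)
  ultimately show "\<exists>c f. c \<noteq> 0 \<and> f \<in> carrier A \<and> as ! j \<otimes> as ! i = c \<odot> (as ! i \<otimes> as ! j) \<oplus> f \<and>
      (f \<noteq> \<zero> \<longrightarrow> strictly_below mon_order (LM A MON mon_order f) (as ! i \<otimes> as ! j))"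
    using w ww ij' letter_count_exponents
    by (intro exI[of _ l] exI[of _ "c \<odot> W w"]) (auto simp: W_closed LM_W strictly_below_mon)
qed (use as_closed generates has_PBW_basis monomial_ordering assoc_algebra_axioms in auto)

end

section \<open>The relations of the quantum group\<close>

definition pair_less :: "nat \<times> nat \<Rightarrow> nat \<times> nat \<Rightarrow> bool" where
  "pair_less p r \<longleftrightarrow> fst p < fst r \<or> fst p = fst r \<and> snd p < snd r"

lemma set_Lambda_list: "(i, j) \<in> set (Lambda_list N) \<longleftrightarrow> 1 \<le> i \<and> i < j \<and> j \<le> N + 1"
  by (auto simp: Lambda_list_def image_iff simp del: upt_Suc intro!: bexI[of _ i])

lemma sorted_Lambda_list: "sorted_wrt pair_less (Lambda_list N)"
proof -
  have row: "sorted_wrt pair_less (map (Pair i) [a..<b])" for i a b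
    by (simp add: sorted_wrt_map pair_less_def)
  have rows: "sorted_wrt pair_less (concat (map (\<lambda>i. map (Pair i) [i + 1..<N + 2]) [1..<m]))" for m
  proof (induction m)
    case (Suc m)
    show ?case
    proof (cases "m = 0")
      case False
      then have "[1..<Suc m] = [1..<m] @ [m]"
        by simp
      with Suc show ?thesis
        using row[of m "m + 1" "N + 2"]
        by (simp add: sorted_wrt_append del: upt_Suc) (auto simp: pair_less_def simp del: upt_Suc)
    qed simp
  qed simp
  have eq: "Lambda_list N = concat (map (\<lambda>i. map (Pair i) [i + 1..<N + 2]) [1..<N + 1])"
    by (simp add: Lambda_list_def)
  show ?thesis
    unfolding eq by (rule rows)
qed

lemma Lambda_list_nth_less: "i < j \<Longrightarrow> j < length (Lambda_list N) \<Longrightarrow> pair_less (Lambda_list N ! i) (Lambda_list N ! j)"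
  using sorted_Lambda_list sorted_wrt_iff_nth_less by blast

lemma pair_less_irrefl: "\<not> pair_less p p"
  by (simp add: pair_less_def)

lemma Lambda_list_nth_less_iff:
  assumes "i < length (Lambda_list N)" "j < length (Lambda_list N)"
  shows "pair_less (Lambda_list N ! i) (Lambda_list N ! j) \<longleftrightarrow> i < j"
proof (cases i j rule: linorder_cases)
  case greater
  then have "pair_less (Lambda_list N ! j) (Lambda_list N ! i)"
    using assms by (intro Lambda_list_nth_less)
  with greater show ?thesis
    by (auto simp: pair_less_def)
qed (use assms Lambda_list_nth_less pair_less_irrefl in auto)

lemma Lambda_list_nth_inject:
  assumes "i < length (Lambda_list N)" "j < length (Lambda_list N)" "Lambda_list N ! i = Lambda_list N ! j"
  shows "i = j"
  using assms Lambda_list_nth_less_iff[of i N j] Lambda_list_nth_less_iff[of j N i] pair_less_irrefl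
  by (cases i j rule: linorder_cases) auto

locale quantum_group = quantum_parameter q for q :: "'k::field" +
  fixes N :: nat
begin

abbreviation Rel where "Rel \<equiv> Uq_ideal N q"

lemma letters_closed:
  assumes "1 \<le> i" "i \<le> N"
  shows "gE i \<in> carrier (Uq_free N :: ('k, _) module)" "gF i \<in> carrier (Uq_free N :: ('k, _) module)"
    "gK i \<in> carrier (Uq_free N :: ('k, _) module)" "gKi i \<in> carrier (Uq_free N :: ('k, _) module)"
  using assms by (auto simp: Uq_free_def intro!: free_closed)

lemmas Uq_free_closed = free_closed[where G = "\<Union>i\<in>{1..N}. {GenE i, GenK i, GenKinv i, GenF i}", folded Uq_free_def]
  free_closed'[where G = "\<Union>i\<in>{1..N}. {GenE i, GenK i, GenKinv i, GenF i}", folded Uq_free_def]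

lemma serre_closed:
  assumes "1 \<le> i" "i \<le> N" "1 \<le> j" "j \<le> N" "i \<noteq> j"
  shows "serre q gE i j \<in> carrier (Uq_free N)" "serre q gF i j \<in> carrier (Uq_free N)"
  unfolding serre_eq_serre_rel[OF assms(5)] serre_rel_def serre_poly_def
  using assms(1-4) by (auto intro!: Uq_free_closed letters_closed)

lemma Uq_relations_closed: "Uq_relations N q \<subseteq> carrier (Uq_free N)"
proof
  fix p
  have if_mem: "(if P then a else b) \<in> T" if "a \<in> T" "b \<in> T" for P a b and T :: "(qgen, 'k) ncpoly set"
    using that by simp
  assume "p \<in> Uq_relations N q"
  then show "p \<in> carrier (Uq_free N)"
    unfolding Uq_relations_def
    apply (elim UnE UN_E)
      apply (elim insertE emptyE; hypsubst; intro Uq_free_closed letters_closed; simp)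
     apply (elim insertE emptyE; hypsubst; intro if_mem Uq_free_closed letters_closed; simp)
    apply (elim insertE emptyE; hypsubst; rule serre_closed; simp)
    done
qed

sublocale U: algebra_ideal Rel "Uq_free N"
proof -
  interpret assoc_algebra "Uq_free N :: ('k, (qgen, 'k) ncpoly) module"
    unfolding Uq_free_def by (rule free_algebra)
  show "algebra_ideal Rel (Uq_free N)"
    unfolding Uq_ideal_def
    by (intro algebra_ideal.intro assoc_algebra_axioms genideal_ideal Uq_relations_closed)
qed

lemma Rel_sel [simp]:
  "one (Uq_free N :: ('k, _) module) = 1" "ring.zero (Uq_free N :: ('k, _) module) = 0"
  "monoid.mult (Uq_free N :: ('k, _) module) = (*)" "add (Uq_free N :: ('k, _) module) = (+)"
  "module.smult (Uq_free N :: ('k, _) module) c p = scale c p"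
  by (simp_all add: Uq_free_def)

lemma relation_mem: "p \<in> Uq_relations N q \<Longrightarrow> p \<in> Rel"
  unfolding Uq_ideal_def using U.genideal_self[OF Uq_relations_closed] by blast

lemma Uq_eq: "Uq N q = U.Q"
  by (simp add: Uq_def)

lemma minus_free: "x \<in> carrier (Uq_free N) \<Longrightarrow> y \<in> carrier (Uq_free N) \<Longrightarrow> x \<ominus>\<^bsub>Uq_free N\<^esub> y = x - (y :: (qgen, 'k) ncpoly)"
  using U.minus_equality[of "- y" y] by (simp add: a_minus_def Uq_free_closed)

lemma cls_eq_iff: "x \<in> carrier (Uq_free N) \<Longrightarrow> y \<in> carrier (Uq_free N) \<Longrightarrow>
    Uq_class N q x = Uq_class N q y \<longleftrightarrow> x - y \<in> Rel"
  unfolding Uq_class_def by (simp add: U.coset_eq_iff minus_free)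

text \<open>The Verma module shows that a relation between the \<open>E\<^sub>i\<close> in \<^const>\<open>Uq\<close> already follows from
  the Serre relations.\<close>

lemma verma_Rel: assumes "p \<in> Rel" shows "app (verma p) v \<in> serre_ideal"
proof -
  define I where "I = {p \<in> carrier (Uq_free N). \<forall>v. app (verma p) v \<in> serre_ideal}"
  have "ideal I (Uq_free N)"
  proof (rule idealI)
    show "subgroup I (add_monoid (Uq_free N))"
    proof (rule U.add.subgroupI)
      show "I \<noteq> {}"
        using Uq_free_closed(1) serre_ideal.zero by (auto simp: I_def verma_hom)
      fix a b
      assume a: "a \<in> I" and "b \<in> I"
      then show "a \<oplus>\<^bsub>Uq_free N\<^esub> b \<in> I"
        by (auto simp: I_def Uq_free_closed verma_def endo.subst_add app_add serre_ideal.add)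
      have "\<ominus>\<^bsub>Uq_free N\<^esub> a = 0 - a"
        using a minus_free[of 0 a] Uq_free_closed(1) by (simp add: I_def a_minus_def)
      moreover have "0 - a \<in> I"
        using a serre.uminus_mem by (auto simp: I_def Uq_free_closed verma_hom app_diff simp del: diff_0)
           (simp_all add: Uq_free_closed serre.uminus_mem)
      ultimately show "\<ominus>\<^bsub>Uq_free N\<^esub> a \<in> I"
        by simp
    qed (auto simp: I_def)
  qed (auto simp: I_def U.ring_axioms Uq_free_closed verma_hom app_mult verma_serre_ideal)
  moreover have "Uq_relations N q \<subseteq> I"
    using Uq_relations_closed verma_relation by (auto simp: I_def)
  ultimately have "Rel \<subseteq> I"
    unfolding Uq_ideal_def by (rule U.genideal_minimal)
  with assms show ?thesis
    by (auto simp: I_def)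
qed

text \<open>Sending generators outside 1..N to zero makes the Serre relations available for all
  natural indices, as the locale \<open>serre_relations\<close> demands.\<close>

definition specialize :: "(nat, 'k) ncpoly \<Rightarrow> (qgen, 'k) ncpoly" where
  "specialize = const.subst (\<lambda>i. if 1 \<le> i \<and> i \<le> N then gE i else 0)"

lemma specialize_hom:
  "specialize 0 = 0" "specialize 1 = 1" "specialize (p + r) = specialize p + specialize r"
  "specialize (p - r) = specialize p - specialize r" "specialize (p * r) = specialize p * specialize r"
  "specialize (scale c p) = scale c (specialize p)"
  by (simp_all add: specialize_def const.subst_add const.subst_diff const.subst_scale const_eq_scale)

lemma specialize_gen: "specialize (gen i) = (if 1 \<le> i \<and> i \<le> N then gE i else 0)"
  by (simp add: specialize_def)

lemma specialize_closed: "specialize p \<in> carrier (Uq_free N)"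
  by (induction p rule: ncpoly_induct) (auto simp: specialize_hom specialize_gen intro!: Uq_free_closed letters_closed)

definition kernel :: "(nat, 'k) ncpoly set" where "kernel = {p. specialize p \<in> Rel}"

lemma zero_Rel: "0 \<in> Rel"
  using additive_subgroup.zero_closed[OF U.additive_subgroup_axioms] by simp

sublocale kernel: two_sided_ideal kernel
  using U.I_l_closed[OF _ specialize_closed] U.I_r_closed[OF _ specialize_closed] U.a_closed zero_Rel
  by unfold_locales (auto simp: kernel_def specialize_hom)

text \<open>With an index out of range the element becomes zero, since each of its terms contains
  both generators.\<close>

lemma serre_rel_kernel: assumes "i \<noteq> j" shows "serre_rel (const B) gen i j \<in> kernel"
proof (cases "1 \<le> i \<and> i \<le> N \<and> 1 \<le> j \<and> j \<le> N")
  case True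
  then have "specialize (serre_rel (const B) gen i j) = serre_rel (const B) gE i j"
    unfolding specialize_def const.subst_serre_rel by (simp add: serre_rel_def)
  moreover have "serre q gE i j \<in> Uq_relations N q"
    unfolding Uq_relations_def by (intro UnI2 UN_I[of i] UN_I[of j]) (use True assms in auto)
  ultimately show ?thesis
    using relation_mem by (simp add: kernel_def serre_eq_serre_rel[OF assms])
next
  case False
  then have "specialize (serre_rel (const B) gen i j) = 0"
    unfolding specialize_def const.subst_serre_rel by (auto simp: serre_rel_def serre_poly_def)
  then show ?thesis
    by (simp add: kernel_def zero_Rel)
qed

sublocale S: serre_relations "const q" "const (inverse q)" kernel gen "const (inverse B)"
proof -
  interpret central_unit "const q :: (nat, 'k) ncpoly" "const (inverse q)"
    using q_nz by (rule const.sc_central_unit)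
  have b: "const q * const q + const (inverse q) * const (inverse q) = (const B :: (nat, 'k) ncpoly)"
    by (simp add: B_def const.sc_add flip: const.sc_mult)
  have w: "const (inverse B) * const B = (1 :: (nat, 'k) ncpoly)"
    using B_nz by (simp add: const.sc_one flip: const.sc_mult)
  have far: "gen k * gen l - gen l * gen k \<in> kernel" if "Suc k < l" for k l
    using serre_rel_kernel[of k l] that by (simp add: serre_rel_def)
  have adj: "serre_poly (const B) (gen k) (gen l) \<in> kernel" if "k = Suc l \<or> l = Suc k" for k l
    using serre_rel_kernel[of k l] that by (auto simp: serre_rel_def)
  show "serre_relations (const q) (const (inverse q)) kernel gen (const (inverse B))"
    by unfold_locales (simp_all add: b far adj w)
qed

end

section \<open>The PBW basis\<close>

context quantum_group
begin

sublocale Uq: assoc_algebra "Uq N q"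
  unfolding Uq_eq by (rule U.quotient_algebra)

abbreviation E_classes where "E_classes \<equiv> (\<lambda>i. Uq_class N q (gE i)) ` {1..N}"

lemma E_classes_closed: "E_classes \<subseteq> carrier (Uq N q)"
  using letters_closed by (auto simp: Uq_eq U.Q_simps Uq_class_def)

lemma Uq_plus_subalgebra: "is_subalgebra (Uq N q) (carrier (Uq_plus N q))"
  unfolding Uq_plus_def using E_classes_closed by (rule Uq.generated_is_subalgebra)

lemma Uq_plus_sel:
  "one (Uq_plus N q) = one (Uq N q)" "ring.zero (Uq_plus N q) = ring.zero (Uq N q)"
  "monoid.mult (Uq_plus N q) = monoid.mult (Uq N q)" "add (Uq_plus N q) = add (Uq N q)"
  "module.smult (Uq_plus N q) = module.smult (Uq N q)"
  by (simp_all add: Uq_plus_def generated_subalgebra_def)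

sublocale plus: assoc_algebra "Uq_plus N q"
proof -
  have "Uq_plus N q = (Uq N q)\<lparr>carrier := carrier (Uq_plus N q)\<rparr>"
    by (simp add: Uq_plus_def generated_subalgebra_def)
  with Uq.subalgebra_is_algebra[OF Uq_plus_subalgebra] show "assoc_algebra (Uq_plus N q)"
    by simp
qed

definition cls :: "(nat, 'k) ncpoly \<Rightarrow> (qgen, 'k) ncpoly set" where
  "cls p = Uq_class N q (specialize p)"

lemma cls_hom:
  "cls 1 = \<one>\<^bsub>Uq_plus N q\<^esub>" "cls (p * r) = cls p \<otimes>\<^bsub>Uq_plus N q\<^esub> cls r"
  "cls (p + r) = cls p \<oplus>\<^bsub>Uq_plus N q\<^esub> cls r" "cls (scale c p) = c \<odot>\<^bsub>Uq_plus N q\<^esub> cls p"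
  using specialize_closed
  by (simp_all add: cls_def Uq_class_def Uq_plus_sel Uq_eq U.Q_simps specialize_hom)

lemma cls_cong: "kernel.cong p r \<Longrightarrow> cls p = cls r"
  unfolding kernel.cong_def by (simp add: cls_def cls_eq_iff specialize_closed kernel_def specialize_hom)

lemma cls_gen: "1 \<le> i \<Longrightarrow> i \<le> N \<Longrightarrow> cls (gen i) = Uq_class N q (gE i)"
  by (simp add: cls_def specialize_gen)

lemma cls_closed: "cls p \<in> carrier (Uq_plus N q)"
proof (induction p rule: ncpoly_induct)
  case (gen g p)
  have "cls (gen g) \<in> carrier (Uq_plus N q)"
  proof (cases "1 \<le> g \<and> g \<le> N")
    case True
    then show ?thesis
      unfolding Uq_plus_def using Uq.generated_subset[of E_classes] by (auto simp: cls_gen)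
  next
    case False
    then have "specialize (gen g) = specialize (scale 0 1)"
      by (auto simp: specialize_gen specialize_hom)
    then have "cls (gen g) = 0 \<odot>\<^bsub>Uq_plus N q\<^esub> cls 1"
      unfolding cls_hom(4)[symmetric] by (simp add: cls_def)
    then show ?thesis
      by (simp add: cls_hom)
  qed
  with gen show ?case
    by (simp add: cls_hom)
qed (simp_all add: cls_hom)

section \<open>Jimbo's generators in \<open>Uq_plus\<close>\<close>

definition root :: "nat \<times> nat \<Rightarrow> (nat, 'k) ncpoly" where
  "root p = S.rv (fst p) (snd p)"

lemma specialize_root_vector:
  "1 \<le> i \<Longrightarrow> i + k \<le> N \<Longrightarrow> specialize (root_vector (const q) (const (inverse q)) gen i k) = root_poly q i k"
  by (induction k) (simp_all add: specialize_def const.subst_diff)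

lemma specialize_root:
  assumes "p \<in> set (Lambda_list N)" shows "specialize (root p) = root_poly q (fst p) (snd p - fst p - 1)"
  using assms set_Lambda_list[of "fst p" "snd p" N]
  unfolding root_def S.rv_def by (intro specialize_root_vector) auto

abbreviation L where "L \<equiv> Lambda_list N"
abbreviation gens where "gens \<equiv> jimbo_gens N q"

lemma length_gens: "length gens = length L"
  by (simp add: jimbo_gens_def)

lemma gens_nth: "k < length L \<Longrightarrow> gens ! k = cls (root (L ! k))"
  by (simp add: jimbo_gens_def jimbo_gen_def cls_def specialize_root split: prod.split)

lemma word_cls:
  assumes "set w \<subseteq> {..<length L}"
  shows "foldr (\<lambda>i m. gens ! i \<otimes>\<^bsub>Uq_plus N q\<^esub> m) w \<one>\<^bsub>Uq_plus N q\<^esub> =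
    cls (prod_list (map (\<lambda>i. root (L ! i)) w))"
  using assms by (induction w) (simp_all add: cls_hom gens_nth)

text \<open>Jimbo's relations in the uniform shape required for straightening. The correction words
  are x_{a,n} and x_{a,n} x_{m,b}; their letters follow (a, b) since b < n and a < m.\<close>

lemma root_straighten:
  assumes "p \<in> set L" "r \<in> set L" "pair_less p r"
  shows "\<exists>l c ws. l \<noteq> 0 \<and> (\<forall>s\<in>set ws. s \<in> set L \<and> pair_less p s) \<and>
    kernel.cong (root r * root p) (scale l (root p * root r) + scale c (prod_list (map root ws)))"
proof -
  obtain a b m n where p: "p = (a, b)" and r: "r = (m, n)"
    by (cases p, cases r)
  have ab: "1 \<le> a" "a < b" "b \<le> N + 1" and mn: "1 \<le> m" "m < n" "n \<le> N + 1"
    using assms by (simp_all add: p r set_Lambda_list)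
  \<comment> \<open>The empty word with coefficient zero encodes the absence of a correction
    term.\<close>
  have commute: ?thesis if "S.comm (root r) (root p)"
    using that by (intro exI[of _ 1] exI[of _ 0] exI[of _ "[]"]) (simp add: S.comm_def)
  have qcommute: ?thesis if "S.qcomm (root r) (root p)"
    using that q_nz
    by (intro exI[of _ "inverse q * inverse q"] exI[of _ 0] exI[of _ "[]"])
      (simp add: S.qcomm_def const_eq_scale scale_scale)
  consider "a = m" "b < n" | "a < m" "b < m" | "a < m" "b = m" | "a < m" "m < b" "b < n"
    | "a < m" "b = n" | "a < m" "n < b"
    using assms(3) unfolding p r pair_less_def fst_conv snd_conv by linarith
  then show ?thesis
  proof cases
    case 1
    then show ?thesis
      using S.qcomm_same_left[of a b n] ab by (intro qcommute) (simp add: p r root_def)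
  next
    case 2
    then show ?thesis
      using S.comm_far[of a b m n] ab mn by (intro commute) (simp add: p r root_def S.comm_sym)
  next
    case 3
    have "kernel.cong (root r * root p) (const q * const q * (root p * root r) - const q * root (a, n))"
      using S.rv_adjacent[of a m n] 3 mn by (simp add: p r root_def)
    also have "const q * const q * (root p * root r) - const q * root (a, n) =
        scale (q * q) (root p * root r) + scale (- q) (root (a, n))"
      by (simp add: const.sc_minus const.sc_mult flip: const_eq_scale)
    finally show ?thesis
      using 3 ab mn q_nz
      by (intro exI[of _ "q * q"] exI[of _ "- q"] exI[of _ "[(a, n)]"]) (simp add: p pair_less_def set_Lambda_list)
  next
    case 4
    define e where "e = q * q - inverse q * inverse q"
    have "kernel.cong (root r * root p)
        (root p * root r - (const q * const q - const (inverse q) * const (inverse q)) * (root (a, n) * root (m, b)))"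
      using S.rv_crossing[of a m b n] 4 by (simp add: p r root_def)
    also have "const q * const q - const (inverse q) * const (inverse q) = (const e :: (nat, 'k) ncpoly)"
      by (simp add: e_def const.sc_diff const.sc_mult)
    also have "root p * root r - const e * (root (a, n) * root (m, b)) =
        scale 1 (root p * root r) + scale (- e) (root (a, n) * root (m, b))"
      by (simp add: const.sc_minus const.sc_one flip: const_eq_scale)
    finally show ?thesis
      using 4 ab mn
      by (intro exI[of _ 1] exI[of _ "- e"] exI[of _ "[(a, n), (m, b)]"]) (simp add: p pair_less_def set_Lambda_list)
  next
    case 5
    then show ?thesis
      using S.qcomm_same_right[of a m n] mn by (intro qcommute) (simp add: p r root_def)
  next
    case 6
    then show ?thesis
      using S.comm_nested[of a m n b] mn by (intro commute) (simp add: p r root_def S.comm_sym)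
  qed
qed

lemma gens_straighten:
  assumes "i < j" "j < length gens"
  shows "\<exists>l c w. l \<noteq> 0 \<and> set w \<subseteq> {i<..<length gens} \<and>
    gens ! j \<otimes>\<^bsub>Uq_plus N q\<^esub> gens ! i = l \<odot>\<^bsub>Uq_plus N q\<^esub> (gens ! i \<otimes>\<^bsub>Uq_plus N q\<^esub> gens ! j)
      \<oplus>\<^bsub>Uq_plus N q\<^esub> c \<odot>\<^bsub>Uq_plus N q\<^esub> foldr (\<lambda>i m. gens ! i \<otimes>\<^bsub>Uq_plus N q\<^esub> m) w \<one>\<^bsub>Uq_plus N q\<^esub>"
proof -
  have ij: "i < length L" "j < length L"
    using assms by (simp_all add: length_gens)
  obtain l c ws where l: "l \<noteq> 0" and ws: "\<And>s. s \<in> set ws \<Longrightarrow> s \<in> set L \<and> pair_less (L ! i) s"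
    and cong: "kernel.cong (root (L ! j) * root (L ! i))
      (scale l (root (L ! i) * root (L ! j)) + scale c (prod_list (map root ws)))"
    using root_straighten[OF nth_mem[OF ij(1)] nth_mem[OF ij(2)] Lambda_list_nth_less[OF assms(1) ij(2)]]
    by blast
  define index where "index s = (SOME k. k < length L \<and> L ! k = s)" for s
  have index: "index s < length L \<and> L ! index s = s" if "s \<in> set ws" for s
  proof -
    have "\<exists>k. k < length L \<and> L ! k = s"
      using ws[OF that] unfolding in_set_conv_nth by blast
    then show ?thesis
      unfolding index_def by (rule someI_ex)
  qed
  have less: "i < index s" if "s \<in> set ws" for s
    using index[OF that] ws[OF that] Lambda_list_nth_less_iff[OF ij(1), of "index s"] by metis
  define w where "w = map index ws"
  have w: "set w \<subseteq> {i<..<length L}"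
    using index less by (auto simp: w_def)
  have "map (\<lambda>k. root (L ! k)) w = map root ws"
    using index by (simp add: w_def)
  then have "foldr (\<lambda>i m. gens ! i \<otimes>\<^bsub>Uq_plus N q\<^esub> m) w \<one>\<^bsub>Uq_plus N q\<^esub> = cls (prod_list (map root ws))"
    using word_cls[of w] w by (simp add: subset_iff)
  then have "gens ! j \<otimes>\<^bsub>Uq_plus N q\<^esub> gens ! i = l \<odot>\<^bsub>Uq_plus N q\<^esub> (gens ! i \<otimes>\<^bsub>Uq_plus N q\<^esub> gens ! j)
      \<oplus>\<^bsub>Uq_plus N q\<^esub> c \<odot>\<^bsub>Uq_plus N q\<^esub> foldr (\<lambda>i m. gens ! i \<otimes>\<^bsub>Uq_plus N q\<^esub> m) w \<one>\<^bsub>Uq_plus N q\<^esub>"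
    using cls_cong[OF cong] by (simp only: cls_hom gens_nth ij)
  with l w show ?thesis
    unfolding length_gens by blast
qed

definition eval_label :: "(nat \<Rightarrow> nat) \<Rightarrow> (nat, 'k) ncpoly \<Rightarrow> 'k" where
  "eval_label \<alpha> p = Poly_Mapping.lookup (app (endo.subst E_op p) (Poly_Mapping.single (\<lambda>a b. 0) 1))
     (word_label (map ((!) L) (sorted_word (length L) \<alpha>)))"

text \<open>A class is represented by a polynomial, applied to the lowest weight vector, and the
  resulting polynomial in the E_i then acts on the zero label. The choice of representative is
  harmless by \<open>coord_class\<close>.\<close>

definition coord :: "(nat \<Rightarrow> nat) \<Rightarrow> (qgen, 'k) ncpoly set \<Rightarrow> 'k" where
  "coord \<alpha> C = eval_label \<alpha> (app (verma (SOME y. y \<in> carrier (Uq_free N) \<and> Uq_class N q y = C)) 1)"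

text \<open>Two representatives differ by an element of \<open>Rel\<close>, which maps 1 into the
  Serre ideal, and that ideal acts as zero through \<open>E_op\<close>.\<close>

lemma coord_class:
  assumes "y \<in> carrier (Uq_free N)" shows "coord \<alpha> (Uq_class N q y) = eval_label \<alpha> (app (verma y) 1)"
proof -
  define z where "z = (SOME z. z \<in> carrier (Uq_free N) \<and> Uq_class N q z = Uq_class N q y)"
  have z: "z \<in> carrier (Uq_free N) \<and> Uq_class N q z = Uq_class N q y"
    unfolding z_def by (rule someI_ex, rule exI[of _ y]) (simp add: assms)
  then have "z - y \<in> Rel"
    using assms cls_eq_iff by blast
  then have "endo.subst E_op (app (verma (z - y)) 1) = 0"
    by (intro subst_E_op_serre_ideal verma_Rel)
  then have "endo.subst E_op (app (verma z) 1) = endo.subst E_op (app (verma y) 1)"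
    by (simp add: verma_hom app_diff endo.subst_diff)
  then show ?thesis
    unfolding coord_def eval_label_def z_def by simp
qed

lemma class_surj:
  assumes "C \<in> carrier (Uq_plus N q)" obtains y where "y \<in> carrier (Uq_free N)" "C = Uq_class N q y"
proof -
  have "C \<in> carrier U.Q"
    using assms Uq.is_subalgebraD(1)[OF Uq_plus_subalgebra] unfolding Uq_eq by blast
  with that show ?thesis
    unfolding U.Q_simps(1) Uq_class_def by blast
qed

lemma coord_add:
  assumes "x \<in> carrier (Uq_plus N q)" "y \<in> carrier (Uq_plus N q)"
  shows "coord \<alpha> (x \<oplus>\<^bsub>Uq_plus N q\<^esub> y) = coord \<alpha> x + coord \<alpha> y"
proof -
  obtain v w where vw: "v \<in> carrier (Uq_free N)" "x = Uq_class N q v" "w \<in> carrier (Uq_free N)" "y = Uq_class N q w"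
    using class_surj[OF assms(1)] class_surj[OF assms(2)] by metis
  then have "x \<oplus>\<^bsub>Uq_plus N q\<^esub> y = Uq_class N q (v + w)"
    by (simp add: Uq_plus_sel Uq_eq U.Q_simps Uq_class_def)
  with vw show ?thesis
    by (simp add: coord_class Uq_free_closed verma_def endo.subst_add app_add eval_label_def lookup_add)
qed

lemma coord_smult:
  assumes "x \<in> carrier (Uq_plus N q)" shows "coord \<alpha> (c \<odot>\<^bsub>Uq_plus N q\<^esub> x) = c * coord \<alpha> x"
proof -
  obtain v where v: "v \<in> carrier (Uq_free N)" "x = Uq_class N q v"
    using class_surj[OF assms] by metis
  then have "c \<odot>\<^bsub>Uq_plus N q\<^esub> x = Uq_class N q (scale c v)"
    by (simp add: Uq_plus_sel Uq_eq U.Q_simps Uq_class_def)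
  with v show ?thesis
    by (simp add: coord_class Uq_free_closed verma_def endo.subst_scale app_mult eval_label_def)
qed

lemma gens_closed: "set gens \<subseteq> carrier (Uq_plus N q)"
  using gens_nth cls_closed by (auto simp: in_set_conv_nth length_gens)

lemma std_monomial_cls:
  "std_monomial (Uq_plus N q) gens \<beta> =
     cls (prod_list (map (\<lambda>i. root (L ! i)) (sorted_word (length L) \<beta>)))"
  using plus.std_monomial_eq_foldr[OF gens_closed] word_cls[OF sorted_word_subset]
  by (simp add: length_gens)

lemma subst_E_op_root: "endo.subst E_op (root p) = x_op (fst p) (snd p - fst p - 1)"
  by (simp add: root_def S.rv_def endo.subst_root_vector x_op_def)

lemma coord_monomial:
  assumes "\<alpha> \<in> exponents (length gens)" "\<beta> \<in> exponents (length gens)"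
  shows "coord \<alpha> (std_monomial (Uq_plus N q) gens \<beta>) = (if \<alpha> = \<beta> then 1 else 0)"
proof -
  define word where "word \<gamma> = map ((!) L) (sorted_word (length L) \<gamma>)" for \<gamma>
  have word_L: "set (word \<gamma>) \<subseteq> set L" for \<gamma>
    using sorted_word_subset[of "length L" \<gamma>] by (auto simp: word_def)
  have word_less: "i < j" if "(i, j) \<in> set (word \<gamma>)" for i j \<gamma>
    using subsetD[OF word_L that] by (simp add: set_Lambda_list)
  define P where "P = prod_list (map root (word \<beta>))"
  \<comment> \<open>Words over \<open>L\<close> involve only generators with index in 1..N, on which
    \<open>specialize\<close> is the plain inclusion; this makes \<open>verma_gE\<close>
    applicable.\<close>
  have "specialize P = const.subst gE P"
  proof -
    have "specialize (prod_list (map root ws)) = const.subst gE (prod_list (map root ws))"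
      if "set ws \<subseteq> set L" for ws
      using that
    proof (induction ws)
      case (Cons p ws)
      have "const.subst gE (root p) = root_poly q (fst p) (snd p - fst p - 1)"
        by (simp add: root_def S.rv_def const.subst_root_vector root_poly_eq_root_vector)
      with Cons show ?case
        by (simp add: specialize_hom specialize_root)
    qed (simp add: specialize_hom)
    with word_L show ?thesis
      by (simp add: P_def)
  qed
  moreover have "std_monomial (Uq_plus N q) gens \<beta> = cls P"
    by (simp add: std_monomial_cls P_def word_def comp_def)
  moreover have "coord \<alpha> (cls P) = eval_label \<alpha> (app (verma (specialize P)) 1)"
    unfolding cls_def by (rule coord_class[OF specialize_closed])
  ultimately have "coord \<alpha> (std_monomial (Uq_plus N q) gens \<beta>) = eval_label \<alpha> P"
    by (simp add: verma_gE)
  also have "endo.subst E_op P = prod_list (map (\<lambda>(i, j). x_op i (j - i - 1)) (word \<beta>))"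
    by (simp add: P_def endo.subst_prod_list comp_def subst_E_op_root case_prod_unfold)
  then have "eval_label \<alpha> P = Poly_Mapping.lookup (Poly_Mapping.single (word_label (word \<beta>)) 1) (word_label (word \<alpha>))"
  proof -
    have "sorted_wrt (\<lambda>(i, j) (m, n). i < m \<or> i = m \<and> j \<le> n) (word \<beta>)"
      unfolding word_def sorted_wrt_map
    proof (rule sorted_wrt_mono_rel[OF _ sorted_sorted_word[of "length L" \<beta>]])
      fix i j
      assume "i \<in> set (sorted_word (length L) \<beta>)" "j \<in> set (sorted_word (length L) \<beta>)" "i \<le> j"
      then have "i = j \<or> pair_less (L ! i) (L ! j)"
        using Lambda_list_nth_less[of i j N] sorted_word_subset[of "length L" \<beta>] by force
      then show "(case L ! i of (i, k) \<Rightarrow> \<lambda>(m, n). i < m \<or> i = m \<and> k \<le> n) (L ! j)"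
        by (auto simp: pair_less_def split: prod.split)
    qed
    then have "app (endo.subst E_op P) (Poly_Mapping.single (\<lambda>a b. 0) 1) = Poly_Mapping.single (word_label (word \<beta>)) 1"
      unfolding \<open>endo.subst E_op P = _\<close> by (intro app_x_op_word word_less)
    then show ?thesis
      by (simp add: eval_label_def word_def)
  qed
  also have "\<dots> = (if \<alpha> = \<beta> then 1 else 0)"
  proof -
    \<comment> \<open>The label of a sorted word determines its exponents: the entry at the position
      \<open>L ! k\<close>, above the diagonal, counts the occurrences of generator k.\<close>
    have count: "word_label (word \<gamma>) (fst (L ! k)) (snd (L ! k)) = int (\<gamma> k)"
      if "k < length L" "\<gamma> \<in> exponents (length L)" for \<gamma> k
    proof -
      have "count_list (map ((!) L) xs) (L ! k) = count_list xs k" if "set xs \<subseteq> {..<length L}" for xs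
        using that \<open>k < length L\<close> by (induction xs) (auto dest: Lambda_list_nth_inject)
      then have "count_list (word \<gamma>) (L ! k) = letter_count (sorted_word (length L) \<gamma>) k"
        using sorted_word_subset by (simp add: word_def letter_count_def count_mset)
      moreover have "fst (L ! k) < snd (L ! k)"
        using that(1) set_Lambda_list[of "fst (L ! k)" "snd (L ! k)" N] by simp
      ultimately show ?thesis
        using that(2) word_label_count[of "fst (L ! k)" "snd (L ! k)" "word \<gamma>", OF _ word_less]
        by (simp add: letter_count_sorted_word)
    qed
    have "\<alpha> = \<beta>" if "word_label (word \<beta>) = word_label (word \<alpha>)"
    proof
      fix k
      show "\<alpha> k = \<beta> k"
      proof (cases "k < length L")
        case True
        then show ?thesis
          using count[of k \<alpha>] count[of k \<beta>] that assms by (simp add: length_gens)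
      qed (use assms in \<open>simp add: exponents_def length_gens\<close>)
    qed
    then show ?thesis
      by (auto simp: lookup_single)
  qed
  finally show ?thesis .
qed

sublocale straightening "Uq_plus N q" gens coord
proof
  show "set gens \<subseteq> carrier (Uq_plus N q)"
    by (rule gens_closed)
  show "carrier (generated_subalgebra (Uq_plus N q) (set gens)) = carrier (Uq_plus N q)"
  proof -
    have "E_classes \<subseteq> set gens"
    proof
      fix C
      assume "C \<in> E_classes"
      then obtain i where i: "1 \<le> i" "i \<le> N" "C = Uq_class N q (gE i)"
        by auto
      then have "(i, Suc i) \<in> set L" "C = jimbo_gen N q i (Suc i)"
        by (simp_all add: set_Lambda_list jimbo_gen_def)
      then show "C \<in> set gens"
        by (force simp: jimbo_gens_def)
    qed
    with Uq.generated_generated[OF E_classes_closed] gens_closed show ?thesis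
      by (simp add: Uq_plus_def)
  qed
qed (use gens_straighten coord_add coord_smult coord_monomial in auto)

end

theorem theorem2p3:
  fixes q :: "'k::field_char_0" and N :: nat
  assumes "N \<ge> 1" and "q \<noteq> 0" and "q ^ 8 \<noteq> 1"
  shows "solvable_polynomial_algebra (Uq_plus N q) (jimbo_gens N q)"
proof -
  interpret quantum_group q N
    using assms by unfold_locales
  show ?thesis
    by (rule solvable)
qed

end
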